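(* The class of intersection bodies of symmetric convex bodies of revolution in dimension $n\ge 4$ has uniform equatorial power type $2$. Namely, if $K$ is a symmetric convex body of revolution in $\mathbb{R}^n$ with $n\ge 4$, then its intersection body $IK$ has modulus of convexity at the equator of the form $$\delta^e_{IK}(\varepsilon)=c_K\,\varepsilon^2+O(\varepsilon^3)\qquad(\varepsilon\to 0^+),$$ where $c_K>0$ is a constant depending on $K$ which is bounded above and below by positive absolute constants (independent of $K$ and $n$).
   Context: A body in $\mathbb{R}^n$ is a compact set equal to the closure of its interior. A set is symmetric if $S=-S$. All bodies of revolution have the $e_1$-axis as axis of revolution. The radial function of a star-shaped set $K$ is $\rho_K(u)=\sup\{\lambda\ge 0:\lambda u\in K\}$, $u\in\mathbb{S}^{n-1}$; for a body of revolution $\rho_K(\theta)$ denotes its value at any direction making angle $\theta$ with the $e_1$-axis. The intersection body $IK$ of a star body $K$ is the star body with $\rho_{IK}(u)=|K\cap u^\perp|$ (the $(n-1)$-dimensional volume); by Busemann's theorem $IK$ is convex when $K$ is symmetric and convex. For a symmetric convex body of revolution $K$ with Minkowski functional $\|\cdot\|_K$, the modulus of convexity of $K$ at the equator is $$\delta_K^{e}(\varepsilon)=\inf\left\{1-\left\|\tfrac{x+y}{2}\right\|_K:\ x,y\in K,\ \|x-y\|_K\ge 2\varepsilon,\ x-y\in\mathrm{span}\{e_1\}\right\},\quad \varepsilon\in(0,1].$$ Equivalently, $\delta^e_K(\varepsilon)=\dfrac{\rho_K(\pi/2)-\rho_K(\theta)\sin\theta}{\rho_K(\pi/2)}$, where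 the angle $\theta$ is obtained from $\varepsilon=\frac{\rho_K(\theta)}{\rho_K(0)}\cos\theta$. Put $\psi_K(x)=\rho_K(\theta)|\sin\theta|$ for $\theta=\tan^{-1}(1/x)$ (with $\theta=\pi/2$ for $x=0$). A body of revolution $K$ has equatorial power type $p$ ($1\le p<\infty$) if there are constants $c_1,c_2>0$, depending on $K$, with $c_1<|\psi_K(x)-\psi_K(0)|/|x|^p<c_2$ for all $x\neq 0$ in a neighborhood of $0$; for a symmetric convex body of revolution this is equivalent to the existence of $c_1,c_2>0$ with $c_1<\delta_K^e(\varepsilon)/\varepsilon^p<c_2$ for all $\varepsilon\in(0,1]$. A collection $\mathcal{C}$ of convex bodies of revolution has uniform equatorial power type $p$ if every body in $\mathcal{C}$ has equatorial power type $p$ and there are uniform constants $c_1,c_2>0$ with $c_1<\delta^e_K(\varepsilon)/\varepsilon^p<c_2$ for every $\varepsilon\in(0,1]$ and every $K\in\mathcal{C}$. $f(\varepsilon)=O(\varepsilon^3)$ means $|f(\varepsilon)|\le c\,\varepsilon^3$ for small $\varepsilon>0$ with an absolute constant $c>0$. *)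

theory Defs
  imports "HOL-Analysis.Analysis"
begin

text \<open>
  The constants in the result are uniform in the dimension, so the dimension has to be a term
  rather than a type. We work in \<^const>\<open>Euclidean_space\<close> \<open>n\<close>, whose points are the sequences
  \<open>x :: nat \<Rightarrow> real\<close> with \<open>x i = 0\<close> for \<open>i \<ge> n\<close>. The coordinates are thus \<open>x 0, \<dots>, x (n - 1)\<close>;
  in particular \<open>e\<^sub>1\<close> is the unit vector with index \<open>0\<close>.
\<close>

abbreviation Rn :: "nat \<Rightarrow> (nat \<Rightarrow> real) set"
  where "Rn n \<equiv> topspace (Euclidean_space n)"

definition dot :: "nat \<Rightarrow> (nat \<Rightarrow> real) \<Rightarrow> (nat \<Rightarrow> real) \<Rightarrow> real"
  where "dot n x y = (\<Sum>i<n. x i * y i)"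

definition scale :: "real \<Rightarrow> (nat \<Rightarrow> real) \<Rightarrow> (nat \<Rightarrow> real)"
  where "scale t x = (\<lambda>i. t * x i)"

definition unit_sphere :: "nat \<Rightarrow> (nat \<Rightarrow> real) set"
  where "unit_sphere n = {u \<in> Rn n. dot n u u = 1}"

definition e1 :: "nat \<Rightarrow> real"
  where "e1 = (\<lambda>i. if i = 0 then 1 else 0)"


subsection \<open>Symmetric convex bodies of revolution\<close>

definition is_body :: "nat \<Rightarrow> (nat \<Rightarrow> real) set \<Rightarrow> bool"
  where "is_body n K \<longleftrightarrow>
    compactin (Euclidean_space n) K \<and>
    K = (Euclidean_space n) closure_of ((Euclidean_space n) interior_of K)"

definition is_symmetric :: "(nat \<Rightarrow> real) set \<Rightarrow> bool"
  where "is_symmetric K \<longleftrightarrow> K = scale (-1) ` K"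

definition is_convex :: "(nat \<Rightarrow> real) set \<Rightarrow> bool"
  where "is_convex K \<longleftrightarrow>
    (\<forall>x\<in>K. \<forall>y\<in>K. \<forall>t. 0 \<le> t \<and> t \<le> 1 \<longrightarrow> (\<lambda>i. (1 - t) * x i + t * y i) \<in> K)"

text \<open>
  With each point, a set of revolution about the \<open>e\<^sub>1\<close>-axis contains all points with the same
  orthogonal projection to the axis and the same distance from the axis.
\<close>

definition is_revolution :: "nat \<Rightarrow> (nat \<Rightarrow> real) set \<Rightarrow> bool"
  where "is_revolution n K \<longleftrightarrow>
    (\<forall>x\<in>K. \<forall>y\<in>Rn n. y 0 = x 0 \<and> (\<Sum>i\<in>{1..<n}. (y i)\<^sup>2) = (\<Sum>i\<in>{1..<n}. (x i)\<^sup>2) \<longrightarrow> y \<in> K)"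

text \<open>The empty set satisfies \<^const>\<open>is_body\<close> and has to be excluded.\<close>

definition sym_convex_body_of_revolution :: "nat \<Rightarrow> (nat \<Rightarrow> real) set \<Rightarrow> bool"
  where "sym_convex_body_of_revolution n K \<longleftrightarrow>
    K \<noteq> {} \<and> is_body n K \<and> is_symmetric K \<and> is_convex K \<and> is_revolution n K"


subsection \<open>Intersection bodies\<close>

definition radial_function :: "(nat \<Rightarrow> real) set \<Rightarrow> (nat \<Rightarrow> real) \<Rightarrow> real"
  where "radial_function K u = Sup {l. 0 \<le> l \<and> scale l u \<in> K}"

definition hyperplane_section :: "nat \<Rightarrow> (nat \<Rightarrow> real) set \<Rightarrow> (nat \<Rightarrow> real) \<Rightarrow> (nat \<Rightarrow> real) set"
  where "hyperplane_section n K u = {x \<in> K. dot n x u = 0}"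

definition orthonormal_basis_of_perp :: "nat \<Rightarrow> (nat \<Rightarrow> real) \<Rightarrow> (nat \<Rightarrow> nat \<Rightarrow> real) \<Rightarrow> bool"
  where "orthonormal_basis_of_perp n u b \<longleftrightarrow>
    (\<forall>j<n-1. b j \<in> Rn n \<and> dot n (b j) u = 0 \<and>
       (\<forall>k<n-1. dot n (b j) (b k) = (if j = k then 1 else 0)))"

text \<open>
  The \<open>(n - 1)\<close>-dimensional volume of a subset of \<open>u\<^sup>\<bottom>\<close> is the Lebesgue measure of its coordinate
  set with respect to an orthonormal basis of \<open>u\<^sup>\<bottom>\<close>. By orthogonal invariance of Lebesgue measure
  it does not depend on the choice of that basis.
\<close>

definition hyperplane_volume :: "nat \<Rightarrow> (nat \<Rightarrow> real) \<Rightarrow> (nat \<Rightarrow> real) set \<Rightarrow> real"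
  where "hyperplane_volume n u A =
    (let b = (SOME b. orthonormal_basis_of_perp n u b) in
     measure (\<Pi>\<^sub>M j\<in>{..<n-1}. lborel)
       {y \<in> {..<n-1} \<rightarrow>\<^sub>E UNIV. (\<lambda>i. \<Sum>j<n-1. y j * b j i) \<in> A})"

definition intersection_body :: "nat \<Rightarrow> (nat \<Rightarrow> real) set \<Rightarrow> (nat \<Rightarrow> real) set"
  where "intersection_body n K =
    {scale r u | r u. u \<in> unit_sphere n \<and>
       0 \<le> r \<and> r \<le> hyperplane_volume n u (hyperplane_section n K u)}"

lemma radial_function_intersection_body:
  assumes u: "u \<in> unit_sphere n"
  shows "radial_function (intersection_body n K) u =
    hyperplane_volume n u (hyperplane_section n K u)"
proof -
  let ?V = "\<lambda>u. hyperplane_volume n u (hyperplane_section n K u)"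
  have nonneg: "0 \<le> ?V u"
    by (simp add: hyperplane_volume_def Let_def)
  have "l \<le> ?V u" if l: "0 \<le> l" "scale l u \<in> intersection_body n K" for l
  proof -
    from l obtain r v where v: "v \<in> unit_sphere n" "0 \<le> r" "r \<le> ?V v"
      and eq: "scale l u = scale r v"
      by (auto simp: intersection_body_def)
    have "dot n (scale t w) (scale t w) = t\<^sup>2" if "w \<in> unit_sphere n" for t w
      using that by (simp add: unit_sphere_def dot_def scale_def power2_eq_square
          mult.assoc mult.left_commute flip: sum_distrib_left)
    with eq u v have "l\<^sup>2 = r\<^sup>2"
      by metis
    with l v have lr: "l = r"
      by (simp add: power2_eq_iff_nonneg)
    show ?thesis
    proof (cases "l = 0")
      case True
      with nonneg show ?thesis by simp
    next
      case False
      with eq lr have "u = v"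
        by (auto simp: scale_def fun_eq_iff)
      with lr v show ?thesis by simp
    qed
  qed
  moreover have "scale (?V u) u \<in> intersection_body n K"
    using u nonneg by (auto simp: intersection_body_def)
  ultimately show ?thesis
    unfolding radial_function_def using nonneg by (intro cSup_eq_maximum) auto
qed


subsection \<open>Convexity at the equator\<close>

definition minkowski_functional :: "(nat \<Rightarrow> real) set \<Rightarrow> (nat \<Rightarrow> real) \<Rightarrow> real"
  where "minkowski_functional K x = Inf {t. 0 < t \<and> x \<in> scale t ` K}"

definition equatorial_modulus :: "(nat \<Rightarrow> real) set \<Rightarrow> real \<Rightarrow> real"
  where "equatorial_modulus K \<epsilon> =
    Inf {1 - minkowski_functional K (\<lambda>i. (x i + y i) / 2) | x y.
      x \<in> K \<and> y \<in> K \<and>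
      minkowski_functional K (\<lambda>i. x i - y i) \<ge> 2 * \<epsilon> \<and>
      (\<exists>s. (\<lambda>i. x i - y i) = scale s e1)}"

text \<open>
  For a body of revolution in dimension at least 2, the radial function at angle \<open>\<theta>\<close> with the
  axis can be evaluated at the direction \<open>cos \<theta> e\<^sub>1 + sin \<theta> e\<^sub>2\<close>.
\<close>

definition radial_angle :: "(nat \<Rightarrow> real) set \<Rightarrow> real \<Rightarrow> real"
  where "radial_angle K \<theta> =
    radial_function K (\<lambda>i. if i = 0 then cos \<theta> else if i = 1 then sin \<theta> else 0)"

definition psi :: "(nat \<Rightarrow> real) set \<Rightarrow> real \<Rightarrow> real"
  where "psi K x =
    (let \<theta> = (if x = 0 then pi / 2 else arctan (1 / x)) in radial_angle K \<theta> * \<bar>sin \<theta>\<bar>)"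

definition equatorial_power_type :: "real \<Rightarrow> (nat \<Rightarrow> real) set \<Rightarrow> bool"
  where "equatorial_power_type p K \<longleftrightarrow> 1 \<le> p \<and>
    (\<exists>c\<^sub>1 c\<^sub>2. 0 < c\<^sub>1 \<and> 0 < c\<^sub>2 \<and>
      (\<forall>\<^sub>F x in at 0. c\<^sub>1 < \<bar>psi K x - psi K 0\<bar> / \<bar>x\<bar> powr p \<and>
                     \<bar>psi K x - psi K 0\<bar> / \<bar>x\<bar> powr p < c\<^sub>2))"

definition uniform_equatorial_power_type :: "real \<Rightarrow> (nat \<Rightarrow> real) set set \<Rightarrow> bool"
  where "uniform_equatorial_power_type p C \<longleftrightarrow>
    (\<forall>K\<in>C. equatorial_power_type p K) \<and>
    (\<exists>c\<^sub>1 c\<^sub>2. 0 < c\<^sub>1 \<and> 0 < c\<^sub>2 \<and>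
      (\<forall>K\<in>C. \<forall>\<epsilon>. 0 < \<epsilon> \<and> \<epsilon> \<le> 1 \<longrightarrow>
        c\<^sub>1 < equatorial_modulus K \<epsilon> / \<epsilon> powr p \<and> equatorial_modulus K \<epsilon> / \<epsilon> powr p < c\<^sub>2))"

end

theory Submission
  imports Defs
begin

text \<open>
  Let \<open>K\<close> be the set of points whose distance from the axis is at most \<open>f t\<close>, where \<open>t\<close> is the axial
  coordinate and \<open>f\<close> is even and concave on \<open>[-A, A]\<close>, and put \<open>m = n - 2\<close>. Slicing a central
  hyperplane section by the planes orthogonal to the axis shows that \<open>psi\<close> of the intersection body at \<open>x\<close>
  is proportional to the integral of the \<open>m\<close>-th power of \<open>sqrt (max 0 (f t ^ 2 - (x * t) ^ 2))\<close>. With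
  \<open>h s = f (A * s) / f 0\<close> this becomes the function \<open>J\<close> below, at the rescaled argument
  \<open>y = (A / f 0) * \<bar>x\<bar>\<close>.

  Convexity of the intersection body (Busemann) amounts to convexity of \<open>1 / J\<close>, which is
  proved by transporting mass. It implies that the modulus of convexity at the equator is attained by the
  chord centred at the equator, so that it equals \<open>1 - J y / J 0\<close> where \<open>y * J y = \<epsilon> * beta_half m\<close>.
  Expanding the integrand gives \<open>J y = J 0 - m / 2 * y ^ 2 * P + O((sqrt m * y * J 0) ^ 3) * J 0\<close>, where
  \<open>P\<close> is the integral of \<open>t ^ 2 * h t ^ (m - 2)\<close>; this is where \<open>n \<ge> 4\<close> enters. Concavity of
  \<open>h\<close> makes \<open>P\<close> comparable to \<open>J 0 ^ 3\<close>, and \<open>beta_half m\<close> is comparable to \<open>1 / sqrt m\<close>, so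
  all constants are absolute.
\<close>

section \<open>Convexity of intersection bodies via mass transport\<close>

text \<open>At a point with axial coordinate X and distance W from the axis, the gauge of the
  intersection body is, after rescaling both coordinates, \<open>W / J (X / W)\<close>. This is the
  perspective of \<open>1 / J\<close>, so convexity of the body is convexity of
  \<open>1 / J\<close>, and statements about chords become planar geometry. The obstacle is
  uniformity in the dimension. \<open>J 0\<close> ranges from about \<open>1 / m\<close> for a
  double cone to 1 for a cylinder, so \<open>y\<close> by itself is no useful expansion parameter;
  \<open>sqrt m * y * J 0\<close> is comparable to \<open>\<epsilon>\<close> for every profile. To
  express remainders in it, moments of \<open>h\<close> are bounded by powers of \<open>J 0\<close>
  with absolute constants. The condition \<open>n \<ge> 4\<close> means \<open>m \<ge> 2\<close> and
  makes the exponent \<open>m - 2\<close> in \<open>P\<close> nonnegative. For \<open>m = 1\<close>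
  and the double cone, the integral of \<open>t ^ 2 / (1 - t)\<close> diverges, so there is no
  finite quadratic coefficient. The cubic remainder has exponent \<open>m - 3\<close>, hence
  \<open>m = 2\<close> gets an argument of its own.\<close>

text \<open>Asks for continuity in the open interval only, since that is all that concavity of a
  profile provides.\<close>

lemma integrable_on_unit_interval:
  fixes f :: "real \<Rightarrow> real"
  assumes cont: "continuous_on {0<..<1} f" and bound: "\<And>t. t \<in> {0<..<1} \<Longrightarrow> \<bar>f t\<bar> \<le> B"
  shows "f integrable_on {0..1}"
proof -
  have "f integrable_on {0<..<1}"
  proof (rule measurable_bounded_by_integrable_imp_integrable)
    show "f \<in> borel_measurable (lebesgue_on {0<..<1})"
      using cont by (rule continuous_imp_measurable_on_sets_lebesgue) simp
    show "(\<lambda>t. B) integrable_on {0<..<1::real}"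
      using integrable_const_ivl[of 0 1 B] integrable_on_Icc_iff_Ioo by blast
  qed (use bound in auto)
  then show ?thesis
    using integrable_on_Icc_iff_Ioo by blast
qed

lemma indefinite_integral_DERIV:
  fixes f :: "real \<Rightarrow> real"
  assumes "f integrable_on {a..b}" "continuous_on {a<..<b} f" "a < x" "x < b"
  shows "((\<lambda>t. integral {a..t} f) has_real_derivative f x) (at x)"
proof -
  have "continuous (at x within ({a..b} - {})) f"
    using assms by (metis continuous_at_imp_continuous_within continuous_on_eq_continuous_at
        greaterThanLessThan_iff open_greaterThanLessThan)
  then have "((\<lambda>t. integral {a..t} f) has_vector_derivative f x) (at x within ({a..b} - {}))"
    using assms by (intro integral_has_vector_derivative_continuous_at) auto
  then have "((\<lambda>t. integral {a..t} f) has_real_derivative f x) (at x within {a..b})"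
    by (simp add: has_real_derivative_iff_has_vector_derivative)
  then show ?thesis
    using assms by (simp add: at_within_Icc_at)
qed

text \<open>An antimonotone density is positive wherever mass remains, so its distribution function
  increases strictly until it reaches \<open>J\<close>. This makes the quantile function a genuine
  inverse, differentiable by the inverse function rule.\<close>

lemma quantile_exists:
  fixes \<phi> :: "real \<Rightarrow> real"
  assumes cont: "continuous_on {0<..<1} \<phi>" and int: "\<phi> integrable_on {0..1}"
    and anti: "antimono_on {0..1} \<phi>" and nonneg: "\<And>t. t \<in> {0..1} \<Longrightarrow> 0 \<le> \<phi> t"
    and J: "J = integral {0..1} \<phi>" "0 < J"
  shows "\<exists>T. \<forall>u\<in>{0<..<1}. T u \<in> {0<..<1} \<and> 0 < \<phi> (T u) \<and> integral {0..T u} \<phi> = u * J \<and>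
    (T has_real_derivative J / \<phi> (T u)) (at u)"
proof -
  define H where "H t = integral {0..t} \<phi>" for t
  have sub: "\<phi> integrable_on {a..b}" if "0 \<le> a" "b \<le> 1" for a b
    using int that by (auto intro: integrable_on_subinterval)
  have H_cont: "continuous_on {0..1} H"
    unfolding H_def using int by (rule indefinite_integral_continuous_1)
  have H_add: "H b = H a + integral {a..b} \<phi>" if "0 \<le> a" "a \<le> b" "b \<le> 1" for a b
    unfolding H_def using that by (intro Henstock_Kurzweil_Integration.integral_combine[symmetric] sub) auto
  \<comment> \<open>Once \<open>\<phi>\<close> vanishes it stays zero, and then \<open>H t\<close>
    would already be the total mass \<open>J\<close>.\<close>
  have pos: "0 < \<phi> t" if t: "0 \<le> t" "t \<le> 1" "H t < J" for t
  proof (rule ccontr)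
    assume "\<not> 0 < \<phi> t"
    then have "\<phi> s = 0" if "s \<in> {t..1}" for s
      using monotone_onD[OF anti, of t s] nonneg[of s] that t by auto
    then have "integral {t..1} \<phi> = 0"
      by (metis integral_cong integral_0)
    with H_add[of t 1] t J show False by (simp add: H_def)
  qed
  have strict: "H a < H b" if ab: "0 \<le> a" "a < b" "b < 1" "H a < J" for a b
  proof (cases "H b < J")
    case True
    then have "\<phi> b > 0" using pos ab by auto
    have "(b - a) * \<phi> b = integral {a..b} (\<lambda>_. \<phi> b)"
      using ab by simp
    also have "\<dots> \<le> integral {a..b} \<phi>"
      using ab monotone_onD[OF anti] by (intro integral_le sub) auto
    finally show ?thesis
      using H_add[of a b] ab \<open>\<phi> b > 0\<close> by (smt (verit) mult_pos_pos)
  qed (use ab in auto)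
  have H01: "H 0 = 0" "H 1 = J"
    by (auto simp: H_def J)
  have ex: "\<exists>t\<in>{0<..<1}. H t = u * J" if u: "u \<in> {0<..<1}" for u
  proof -
    have "\<exists>t. 0 \<le> t \<and> t \<le> 1 \<and> H t = u * J"
      using u J H01 H_cont by (intro IVT') auto
    then obtain t where t: "0 \<le> t" "t \<le> 1" "H t = u * J" by auto
    moreover have "t \<noteq> 0" "t \<noteq> 1"
      using t H01 u J by auto
    ultimately show ?thesis by (intro bexI[of _ t]) auto
  qed
  obtain T where "\<forall>u\<in>{0<..<1}. T u \<in> {0<..<1} \<and> H (T u) = u * J"
    using bchoice[of "{0<..<1}" "\<lambda>u t. t \<in> {0<..<1} \<and> H t = u * J"] ex by blast
  then have T: "T u \<in> {0<..<1}" "H (T u) = u * J" if "u \<in> {0<..<1}" for u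
    using that by auto
  have Tpos: "0 < \<phi> (T u)" if u: "u \<in> {0<..<1}" for u
    using T[OF u] pos[of "T u"] u J by auto
  have inj: "T (H t / J) = t" if t: "0 < t" "t < 1" "H t < J" for t
  proof -
    have "0 < H t"
      using strict[of 0 t] t H01 J by auto
    with t have u: "H t / J \<in> {0<..<1}" by auto
    note T[OF this]
    then have "H (T (H t / J)) = H t" using J by simp
    with strict[of t "T (H t / J)"] strict[of "T (H t / J)" t] T[OF u] t show ?thesis
      by fastforce
  qed
  have Hder: "(H has_real_derivative \<phi> t) (at t)" if "0 < t" "t < 1" for t
    unfolding H_def using that by (intro indefinite_integral_DERIV[OF int cont]) auto
  have "(T has_real_derivative J / \<phi> (T u)) (at u)" if u: "u \<in> {0<..<1}" for u
  proof -
    define t where "t = T u"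
    have t: "0 < t" "t < 1" "H t = u * J" "H t < J"
      using T[OF u] u J by (auto simp: t_def)
    \<comment> \<open>Beyond the point of full mass \<open>H\<close> is constant, so the inverse
      function rule is applied in a neighbourhood where \<open>H z < J\<close>.\<close>
    have "isCont H t"
      using Hder t DERIV_isCont by blast
    then have "\<forall>\<^sub>F z in at t. H z < J"
      using t unfolding isCont_def by (metis order_tendstoD(2))
    moreover have "\<forall>\<^sub>F z in at t. z \<in> {0<..<1}"
      using t by (intro eventually_at_in_open') auto
    ultimately have "\<forall>\<^sub>F z in at t. 0 < z \<and> z < 1 \<and> H z < J"
      by eventually_elim auto
    then obtain d where d: "d > 0" "\<And>z. z \<noteq> t \<Longrightarrow> dist z t \<le> d \<Longrightarrow> 0 < z \<and> z < 1 \<and> H z < J"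
      unfolding eventually_at_le by auto
    have dd: "0 < z \<and> z < 1 \<and> H z < J" if "\<bar>z - t\<bar> \<le> d" for z
      using d(2)[of z] t that by (cases "z = t") (auto simp: dist_real_def)
    have "isCont T ((\<lambda>z. H z / J) t)"
    proof (rule isCont_inverse_function[where f = "\<lambda>z. H z / J" and x = t and d = d])
      show "T (H z / J) = z" if "\<bar>z - t\<bar> \<le> d" for z
        using dd[OF that] inj by auto
      show "isCont (\<lambda>z. H z / J) z" if "\<bar>z - t\<bar> \<le> d" for z
        using dd[OF that] Hder[of z] J by (intro continuous_intros DERIV_isCont) auto
    qed (rule d)
    then have "isCont T u"
      using t J by simp
    then have "(T has_real_derivative inverse (\<phi> (T u) / J)) (at u)"
    proof (intro DERIV_inverse_function[where f = "\<lambda>z. H z / J" and a = 0 and b = 1])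
      show "((\<lambda>z. H z / J) has_real_derivative \<phi> (T u) / J) (at (T u))"
        using T[OF u] Hder[of "T u"] J by (intro DERIV_cdivide) auto
    qed (use T J u Tpos[OF u] in auto)
    then show ?thesis by (simp add: inverse_eq_divide)
  qed
  with T Tpos show ?thesis
    unfolding H_def by blast
qed

text \<open>The arithmetic-geometric mean inequality for the reciprocals.\<close>

lemma harmonic_le_weighted_geometric:
  fixes a b :: real
  assumes "0 < a" "0 < b" "0 \<le> \<alpha>" "0 \<le> \<beta>" "\<alpha> + \<beta> = 1"
  shows "1 / (\<alpha> / a + \<beta> / b) \<le> a powr \<alpha> * b powr \<beta>"
proof -
  have "inverse a powr \<alpha> * inverse b powr \<beta> \<le> \<alpha> * inverse a + \<beta> * inverse b"
    using assms by (intro Youngs_inequality_0) auto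
  moreover have "inverse a powr \<alpha> * inverse b powr \<beta> = inverse (a powr \<alpha> * b powr \<beta>)"
    using assms by (simp add: inverse_powr)
  ultimately have "inverse (a powr \<alpha> * b powr \<beta>) \<le> \<alpha> / a + \<beta> / b"
    by (simp add: divide_inverse)
  moreover have "0 < a powr \<alpha> * b powr \<beta>" using assms by simp
  ultimately show ?thesis
    by (smt (verit, best) inverse_eq_divide inverse_inverse_eq inverse_positive_iff_positive le_imp_inverse_le)
qed

text \<open>
  Both masses are transported to the uniform distribution on the unit interval by their quantile
  functions, which turns the claim into a pointwise inequality between the densities.
\<close>
lemma Ball_Prekopa_Leindler:
  fixes \<phi>\<^sub>0 \<phi>\<^sub>1 \<phi>\<^sub>2 :: "real \<Rightarrow> real" and a b :: real
  assumes cont: "continuous_on {0<..<1} \<phi>\<^sub>0" "continuous_on {0<..<1} \<phi>\<^sub>1" "continuous_on {0<..<1} \<phi>\<^sub>2"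
    and int: "\<phi>\<^sub>0 integrable_on {0..1}" "\<phi>\<^sub>1 integrable_on {0..1}" "\<phi>\<^sub>2 integrable_on {0..1}"
    and anti: "antimono_on {0..1} \<phi>\<^sub>0" "antimono_on {0..1} \<phi>\<^sub>1"
    and nonneg: "\<And>t. t \<in> {0..1} \<Longrightarrow> 0 \<le> \<phi>\<^sub>0 t" "\<And>t. t \<in> {0..1} \<Longrightarrow> 0 \<le> \<phi>\<^sub>1 t"
      "\<And>t. t \<in> {0..1} \<Longrightarrow> 0 \<le> \<phi>\<^sub>2 t"
    and pos: "0 < integral {0..1} \<phi>\<^sub>0" "0 < integral {0..1} \<phi>\<^sub>1"
    and ab: "0 < a" "0 < b" "a + b = 1"
    and ineq: "\<And>r s t. \<lbrakk>r \<in> {0<..<1}; s \<in> {0<..<1}; 0 < \<phi>\<^sub>0 r; 0 < \<phi>\<^sub>1 s; t = 1 / (a / r + b / s)\<rbrakk>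
       \<Longrightarrow> \<phi>\<^sub>0 r powr (a * t / r) * \<phi>\<^sub>1 s powr (b * t / s) \<le> \<phi>\<^sub>2 t"
  shows "1 / (a / integral {0..1} \<phi>\<^sub>0 + b / integral {0..1} \<phi>\<^sub>1) \<le> integral {0..1} \<phi>\<^sub>2"
proof -
  define J\<^sub>0 J\<^sub>1 where J: "J\<^sub>0 = integral {0..1} \<phi>\<^sub>0" "J\<^sub>1 = integral {0..1} \<phi>\<^sub>1"
  define H where "H = 1 / (a / J\<^sub>0 + b / J\<^sub>1)"
  have Jpos: "0 < J\<^sub>0" "0 < J\<^sub>1" using pos J by auto
  then have Hpos: "0 < H" using ab by (auto simp: H_def intro!: divide_pos_pos add_pos_pos)
  obtain R where "\<forall>u\<in>{0<..<1}. R u \<in> {0<..<1} \<and> 0 < \<phi>\<^sub>0 (R u) \<and>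
      integral {0..R u} \<phi>\<^sub>0 = u * J\<^sub>0 \<and> (R has_real_derivative J\<^sub>0 / \<phi>\<^sub>0 (R u)) (at u)"
    using quantile_exists[OF cont(1) int(1) anti(1) nonneg(1) J(1) Jpos(1)] by (rule exE)
  then have R: "R u \<in> {0<..<1}" "0 < \<phi>\<^sub>0 (R u)" "(R has_real_derivative J\<^sub>0 / \<phi>\<^sub>0 (R u)) (at u)"
    if "u \<in> {0<..<1}" for u
    using that by blast+
  obtain S where "\<forall>u\<in>{0<..<1}. S u \<in> {0<..<1} \<and> 0 < \<phi>\<^sub>1 (S u) \<and>
      integral {0..S u} \<phi>\<^sub>1 = u * J\<^sub>1 \<and> (S has_real_derivative J\<^sub>1 / \<phi>\<^sub>1 (S u)) (at u)"
    using quantile_exists[OF cont(2) int(2) anti(2) nonneg(2) J(2) Jpos(2)] by (rule exE)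
  then have S: "S u \<in> {0<..<1}" "0 < \<phi>\<^sub>1 (S u)" "(S has_real_derivative J\<^sub>1 / \<phi>\<^sub>1 (S u)) (at u)"
    if "u \<in> {0<..<1}" for u
    using that by blast+
  \<comment> \<open>The weighted harmonic mean of the two quantiles. The claim follows once
    \<open>F (T u)\<close> is shown to grow at rate at least \<open>H\<close>.\<close>
  define T where "T u = 1 / (a / R u + b / S u)" for u
  define F where "F t = integral {0..t} \<phi>\<^sub>2" for t
  have T: "T u \<in> {0<..<1}" if u: "u \<in> {0<..<1}" for u
  proof -
    have "a < a / R u" "b < b / S u"
      using R(1)[OF u] S(1)[OF u] ab by (simp_all add: less_divide_eq)
    then have "1 < a / R u + b / S u"
      using ab by simp
    then show ?thesis by (simp add: T_def)
  qed
  have Tder: "(T has_real_derivative (a * T u / R u) * (a * T u / R u * (J\<^sub>0 / a) / \<phi>\<^sub>0 (R u))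
      + (b * T u / S u) * (b * T u / S u * (J\<^sub>1 / b) / \<phi>\<^sub>1 (S u))) (at u)"
    if u: "u \<in> {0<..<1}" for u
  proof -
    have ne: "R u > 0" "S u > 0" "a / R u + b / S u > 0"
      using R(1)[OF u] S(1)[OF u] ab by (auto intro!: add_pos_pos)
    have inv: "((\<lambda>u. c / f u) has_real_derivative - (c * D / (f u)\<^sup>2)) (at u)"
      if "(f has_real_derivative D) (at u)" "f u > 0" for f :: "real \<Rightarrow> real" and c D
      using DERIV_divide[OF DERIV_const[of c] that(1)] that(2) by (simp add: power2_eq_square)
    have "((\<lambda>u. a / R u + b / S u) has_real_derivative
        - (a * (J\<^sub>0 / \<phi>\<^sub>0 (R u)) / (R u)\<^sup>2) + - (b * (J\<^sub>1 / \<phi>\<^sub>1 (S u)) / (S u)\<^sup>2)) (at u)"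
      using ne by (intro DERIV_add inv R(3)[OF u] S(3)[OF u])
    from inv[OF this ne(3), of 1]
    have "((\<lambda>u. 1 / (a / R u + b / S u)) has_real_derivative
        - (- (a * (J\<^sub>0 / \<phi>\<^sub>0 (R u)) / (R u)\<^sup>2) - b * (J\<^sub>1 / \<phi>\<^sub>1 (S u)) / (S u)\<^sup>2) / (a / R u + b / S u)\<^sup>2) (at u)"
      by (simp only: mult_1_left minus_divide_left diff_conv_add_uminus)
    moreover have T2: "1 / (a / R u + b / S u)\<^sup>2 = (T u)\<^sup>2"
      by (simp add: T_def power_divide)
    have "- (- (a * (J\<^sub>0 / \<phi>\<^sub>0 (R u)) / (R u)\<^sup>2) - b * (J\<^sub>1 / \<phi>\<^sub>1 (S u)) / (S u)\<^sup>2) / (a / R u + b / S u)\<^sup>2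
      = (a * T u / R u) * (a * T u / R u * (J\<^sub>0 / a) / \<phi>\<^sub>0 (R u))
      + (b * T u / S u) * (b * T u / S u * (J\<^sub>1 / b) / \<phi>\<^sub>1 (S u))" (is "?A / ?B = ?C")
    proof -
      have "?A / ?B = ?A * (T u)\<^sup>2" by (simp flip: T2)
      also have "\<dots> = ?C" using ab by (simp add: field_simps power2_eq_square)
      finally show ?thesis .
    qed
    ultimately show ?thesis unfolding T_def[abs_def] by metis
  qed
  have Fder: "(F has_real_derivative \<phi>\<^sub>2 t) (at t)" if "t \<in> {0<..<1}" for t
    unfolding F_def using that by (intro indefinite_integral_DERIV[OF int(3) cont(3)]) auto
  have mono: "F (T u) - H * u \<le> F (T v) - H * v" if uv: "0 < u" "u < v" "v < 1" for u v
  proof (rule DERIV_nonneg_imp_nondecreasing[where f = "\<lambda>u. F (T u) - H * u"])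
    fix w assume "u \<le> w" "w \<le> v"
    with uv have w: "w \<in> {0<..<1}" by auto
    define \<alpha> \<beta> where \<alpha>: "\<alpha> = a * T w / R w" and \<beta>: "\<beta> = b * T w / S w"
    have \<alpha>\<beta>: "0 < \<alpha>" "0 < \<beta>"
      using ab T[OF w] R(1)[OF w] S(1)[OF w] by (auto simp: \<alpha> \<beta>)
    have sum1: "\<alpha> + \<beta> = 1"
    proof -
      have "a / R w + b / S w > 0" using ab R(1)[OF w] S(1)[OF w] by (auto intro!: add_pos_pos)
      moreover have "\<alpha> + \<beta> = T w * (a / R w + b / S w)" by (simp add: \<alpha> \<beta> algebra_simps)
      ultimately show ?thesis by (simp add: T_def)
    qed
    \<comment> \<open>\<open>D\<close> is the derivative of \<open>T\<close> at
      \<open>w\<close>.\<close>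
    define D where "D = \<alpha> * (\<alpha> * (J\<^sub>0 / a) / \<phi>\<^sub>0 (R w)) + \<beta> * (\<beta> * (J\<^sub>1 / b) / \<phi>\<^sub>1 (S w))"
    note ph = R(2)[OF w] S(2)[OF w]
    \<comment> \<open>Writing \<open>a / J\<^sub>0\<close> as \<open>\<alpha>\<close> over
      \<open>\<alpha> * (J\<^sub>0 / a)\<close> exhibits \<open>H\<close> as a harmonic mean with
      the weights of the pointwise hypothesis.\<close>
    have "H = 1 / (\<alpha> / (\<alpha> * (J\<^sub>0 / a)) + \<beta> / (\<beta> * (J\<^sub>1 / b)))"
      using \<alpha>\<beta> by (simp add: H_def)
    also have "\<dots> \<le> (\<alpha> * (J\<^sub>0 / a)) powr \<alpha> * (\<beta> * (J\<^sub>1 / b)) powr \<beta>"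
      using \<alpha>\<beta> sum1 ab Jpos by (intro harmonic_le_weighted_geometric) auto
    also have "\<dots> = \<phi>\<^sub>0 (R w) powr \<alpha> * \<phi>\<^sub>1 (S w) powr \<beta> *
        ((\<alpha> * (J\<^sub>0 / a) / \<phi>\<^sub>0 (R w)) powr \<alpha> * (\<beta> * (J\<^sub>1 / b) / \<phi>\<^sub>1 (S w)) powr \<beta>)"
      using \<alpha>\<beta> ab Jpos ph by (simp add: powr_divide powr_mult)
    also have "\<dots> \<le> \<phi>\<^sub>0 (R w) powr \<alpha> * \<phi>\<^sub>1 (S w) powr \<beta> * D"
      unfolding D_def using \<alpha>\<beta> sum1 ab Jpos ph by (intro mult_left_mono Youngs_inequality_0) auto
    also have "\<dots> \<le> \<phi>\<^sub>2 (T w) * D"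
    proof (rule mult_right_mono)
      show "\<phi>\<^sub>0 (R w) powr \<alpha> * \<phi>\<^sub>1 (S w) powr \<beta> \<le> \<phi>\<^sub>2 (T w)"
        unfolding \<alpha> \<beta> using R(1)[OF w] S(1)[OF w] ph T_def by (intro ineq) auto
      show "0 \<le> D"
        unfolding D_def using \<alpha>\<beta> ab Jpos ph by (auto intro!: add_nonneg_nonneg mult_nonneg_nonneg)
    qed
    finally have "0 \<le> \<phi>\<^sub>2 (T w) * D - H" by simp
    moreover have "((\<lambda>u. F (T u) - H * u) has_real_derivative \<phi>\<^sub>2 (T w) * D - H) (at w)"
      unfolding D_def \<alpha> \<beta>
      by (auto intro!: derivative_eq_intros DERIV_chain2[OF Fder[OF T[OF w]] Tder[OF w]])
    ultimately show "\<exists>y. ((\<lambda>u. F (T u) - H * u) has_real_derivative y) (at w) \<and> 0 \<le> y"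
      by blast
  qed (use uv in auto)
  have bound: "H * (v - u) \<le> integral {0..1} \<phi>\<^sub>2" if uv: "0 < u" "u < v" "v < 1" for u v
  proof -
    have sub: "\<phi>\<^sub>2 integrable_on {0..t}" if "t \<in> {0..1}" for t
      using int(3) that by (auto intro: integrable_on_subinterval)
    have Tuv: "T u \<in> {0<..<1}" "T v \<in> {0<..<1}"
      using uv T[of u] T[of v] by simp_all
    have "0 \<le> F (T u)"
      unfolding F_def using Tuv(1) nonneg(3) by (intro Henstock_Kurzweil_Integration.integral_nonneg sub) auto
    moreover have "F (T v) \<le> integral {0..1} \<phi>\<^sub>2"
      unfolding F_def using Tuv(2) nonneg(3) by (intro integral_subset_le sub int(3)) auto
    ultimately show ?thesis using mono[OF uv] by (simp add: algebra_simps)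
  qed
  \<comment> \<open>The quantiles are controlled only inside the open interval, so the full mass is
    reached in the limit.\<close>
  have "((\<lambda>e. H * ((1 - e) - e)) \<longlongrightarrow> H * ((1 - 0) - 0)) (at_right 0)"
    by (intro tendsto_intros)
  moreover have "\<forall>\<^sub>F e in at_right 0. H * ((1 - e) - e) \<le> integral {0..1} \<phi>\<^sub>2"
    unfolding eventually_at_right_field
  proof (intro exI[of _ "1/2"] conjI allI impI)
    show "H * ((1 - e) - e) \<le> integral {0..1} \<phi>\<^sub>2" if "0 < e" "e < 1/2" for e
      using bound[of e "1 - e"] that by auto
  qed simp
  ultimately have "H * ((1 - 0) - 0) \<le> integral {0..1} \<phi>\<^sub>2"
    by (intro tendsto_upperbound) auto
  then show ?thesis by (simp add: H_def J)
qed

section \<open>Normalized convex profiles\<close>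

text \<open>The left side is the tangent at 1 of the function \<open>s powr (m / 2)\<close> of
  \<open>s = w ^ 2\<close>, convex for \<open>m \<ge> 2\<close>. Induction on \<open>m\<close>
  avoids half-integral exponents: multiplying the bound for \<open>m\<close> by \<open>w\<close>
  exceeds the bound for \<open>m + 1\<close> by a term with a double root at 1.\<close>

lemma power_ge_tangent:
  fixes w :: real
  assumes "0 \<le> w" "2 \<le> m"
  shows "1 + real m / 2 * (w\<^sup>2 - 1) \<le> w ^ m"
  using assms(2)
proof (induction m rule: nat_induct_at_least)
  case base
  show ?case by simp
next
  case (Suc m)
  have "0 \<le> (1 - w)\<^sup>2 * (real m - 1 + real m * w) / 2"
    using assms(1) Suc.hyps by (intro divide_nonneg_nonneg mult_nonneg_nonneg add_nonneg_nonneg) auto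
  also have "\<dots> = w * (1 + real m / 2 * (w\<^sup>2 - 1)) - (1 + real (Suc m) / 2 * (w\<^sup>2 - 1))"
    by (simp add: power2_eq_square field_simps)
  also have "\<dots> \<le> w * w ^ m - (1 + real (Suc m) / 2 * (w\<^sup>2 - 1))"
    using Suc.IH assms(1) by (intro diff_right_mono mult_left_mono)
  finally show ?case by simp
qed

lemma sqrt_power_ge_tangent:
  fixes z :: real
  assumes "0 \<le> z" "2 \<le> m"
  shows "1 - real m / 2 * z \<le> sqrt (max 0 (1 - z)) ^ m"
proof (cases "z \<le> 1")
  case True
  then show ?thesis
    using power_ge_tangent[of "sqrt (1 - z)" m] assms by (simp add: field_simps)
next
  case False
  then have "1 \<le> real m / 2 * z"
    using assms mult_mono[of 1 "real m / 2" 1 z] by auto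
  moreover have "0 \<le> sqrt (max 0 (1 - z)) ^ m" by simp
  ultimately show ?thesis by linarith
qed

text \<open>Since \<open>(1 - z) * (1 + z) \<le> 1\<close>, the tangent bound at
  \<open>1 + z\<close> controls the reciprocal. The majorant sees \<open>m\<close> only through
  \<open>m * z\<close>, which keeps later estimates free of the dimension.\<close>

lemma sqrt_power_le_inverse:
  fixes z :: real
  assumes "0 \<le> z" "2 \<le> m"
  shows "sqrt (max 0 (1 - z)) ^ m \<le> 1 / (1 + real m / 2 * z)"
proof -
  have pos: "0 < 1 + real m / 2 * z"
    using assms by (intro add_pos_nonneg) auto
  have "max 0 (1 - z) * (1 + z) \<le> 1"
    using assms by (auto simp: max_def algebra_simps)
  then have le1: "sqrt (max 0 (1 - z)) * sqrt (1 + z) \<le> 1"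
    by (simp flip: real_sqrt_mult)
  have "sqrt (max 0 (1 - z)) ^ m * (1 + real m / 2 * z) \<le> sqrt (max 0 (1 - z)) ^ m * sqrt (1 + z) ^ m"
    using power_ge_tangent[of "sqrt (1 + z)" m] assms by (intro mult_left_mono) auto
  also have "\<dots> \<le> 1"
    using le1 assms by (simp add: power_le_one flip: power_mult_distrib)
  finally show ?thesis
    using pos by (simp add: pos_le_divide_eq)
qed

lemma antimono_integral_ge:
  fixes \<phi> :: "real \<Rightarrow> real"
  assumes "antimono_on {0..1} \<phi>" "\<phi> integrable_on {0..1}" "\<And>t. t \<in> {0..1} \<Longrightarrow> 0 \<le> \<phi> t" "t \<in> {0..1}"
  shows "t * \<phi> t \<le> integral {0..1} \<phi>"
proof -
  have sub: "\<phi> integrable_on {0..t}"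
    using assms by (auto intro: integrable_on_subinterval)
  have "t * \<phi> t = integral {0..t} (\<lambda>_. \<phi> t)"
    using assms by simp
  also have "\<dots> \<le> integral {0..t} \<phi>"
    using assms monotone_onD[OF assms(1)] by (intro integral_le sub) auto
  also have "\<dots> \<le> integral {0..1} \<phi>"
    using assms by (intro integral_subset_le sub) auto
  finally show ?thesis .
qed

text \<open>Concavity of the Lorentz norm on the forward light cone. It rests on the reversed
  Cauchy-Schwarz inequality, which bounds the product of the two norms by
  \<open>a * b - y * z\<close>.\<close>

lemma reverse_Minkowski_Lorentz:
  fixes a b :: real
  assumes "\<bar>y\<bar> \<le> a" "\<bar>z\<bar> \<le> b" "0 \<le> \<alpha>" "0 \<le> \<beta>"
  shows "\<alpha> * sqrt (a\<^sup>2 - y\<^sup>2) + \<beta> * sqrt (b\<^sup>2 - z\<^sup>2) \<le> sqrt ((\<alpha> * a + \<beta> * b)\<^sup>2 - (\<alpha> * y + \<beta> * z)\<^sup>2)"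
proof (rule real_le_rsqrt)
  have sq: "0 \<le> a\<^sup>2 - y\<^sup>2" "0 \<le> b\<^sup>2 - z\<^sup>2"
    using assms by (simp_all add: abs_le_square_iff[symmetric])
  have "\<bar>y * z\<bar> \<le> a * b"
    using assms by (auto simp: abs_mult intro!: mult_mono)
  then have "0 \<le> a * b - y * z" by linarith
  moreover have "(a\<^sup>2 - y\<^sup>2) * (b\<^sup>2 - z\<^sup>2) = (a * b - y * z)\<^sup>2 - (a * z - b * y)\<^sup>2"
    by (simp add: power2_eq_square algebra_simps)
  ultimately have "sqrt (a\<^sup>2 - y\<^sup>2) * sqrt (b\<^sup>2 - z\<^sup>2) \<le> a * b - y * z"
    unfolding real_sqrt_mult[symmetric] by (intro real_le_lsqrt) auto
  then have "2 * (\<alpha> * \<beta>) * (sqrt (a\<^sup>2 - y\<^sup>2) * sqrt (b\<^sup>2 - z\<^sup>2)) \<le> 2 * (\<alpha> * \<beta>) * (a * b - y * z)"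
    using assms by (intro mult_left_mono) auto
  moreover have "(\<alpha> * sqrt (a\<^sup>2 - y\<^sup>2) + \<beta> * sqrt (b\<^sup>2 - z\<^sup>2))\<^sup>2 =
      \<alpha>\<^sup>2 * (a\<^sup>2 - y\<^sup>2) + \<beta>\<^sup>2 * (b\<^sup>2 - z\<^sup>2) + 2 * (\<alpha> * \<beta>) * (sqrt (a\<^sup>2 - y\<^sup>2) * sqrt (b\<^sup>2 - z\<^sup>2))"
    using sq by (simp add: power2_sum power_mult_distrib)
  ultimately show "(\<alpha> * sqrt (a\<^sup>2 - y\<^sup>2) + \<beta> * sqrt (b\<^sup>2 - z\<^sup>2))\<^sup>2 \<le>
      (\<alpha> * a + \<beta> * b)\<^sup>2 - (\<alpha> * y + \<beta> * z)\<^sup>2"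
    by (simp add: power2_eq_square algebra_simps)
qed

section \<open>The section function of a profile and convexity of its reciprocal\<close>

locale convex_profile =
  fixes h :: "real \<Rightarrow> real" and m :: nat
  assumes concave: "concave_on {0..1} h" and h_zero: "h 0 = 1"
    and h_nonneg: "\<And>t. t \<in> {0..1} \<Longrightarrow> 0 \<le> h t" and h_le_1: "\<And>t. t \<in> {0..1} \<Longrightarrow> h t \<le> 1"
    and m_ge_2: "2 \<le> m"
begin

definition \<phi> :: "real \<Rightarrow> real \<Rightarrow> real"
  where "\<phi> y t = sqrt (max 0 ((h t)\<^sup>2 - (y * t)\<^sup>2)) ^ m"

definition J :: "real \<Rightarrow> real"
  where "J y = integral {0..1} (\<phi> y)"

definition P :: real
  where "P = integral {0..1} (\<lambda>t. t\<^sup>2 * h t ^ (m - 2))"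

lemma h_scaled_ge:
  assumes "t \<in> {0..1}" "0 \<le> c" "c \<le> 1"
  shows "1 - c * (1 - h t) \<le> h (c * t)"
  using concave_onD[OF concave assms(2,3), of 0 t] assms h_zero by (simp add: algebra_simps)

lemma h_ge: "t \<in> {0..1} \<Longrightarrow> 1 - t \<le> h t"
  using h_scaled_ge[of 1 t] h_nonneg[of 1] by (smt (verit) atLeastAtMost_iff mult_left_le mult.right_neutral)

lemma h_antimono: "antimono_on {0..1} h"
proof (rule monotone_onI)
  fix s t :: real assume st: "s \<in> {0..1}" "t \<in> {0..1}" "s \<le> t"
  show "h t \<le> h s"
  proof (cases "t = 0")
    case False
    then have "1 - s / t * (1 - h t) \<le> h s"
      using h_scaled_ge[of t "s / t"] st by (simp add: field_simps)
    moreover have "s / t * (1 - h t) \<le> 1 * (1 - h t)"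
      using False st h_le_1[of t] by (intro mult_right_mono) auto
    ultimately show ?thesis by simp
  qed (use st in auto)
qed

text \<open>Concavity gives \<open>h (t / j) \<ge> 1 + (h t - 1) / j\<close>, and Bernoulli's
  inequality raises this to the power \<open>j\<close>.\<close>

lemma h_power_le:
  assumes t: "t \<in> {0..1}" and j: "0 < j"
  shows "h t \<le> h (t / real j) ^ j"
proof -
  have "-1 \<le> (h t - 1) / real j"
    using h_nonneg[OF t] j by (simp add: pos_le_divide_eq)
  then have "1 + real j * ((h t - 1) / real j) \<le> (1 + (h t - 1) / real j) ^ j"
    by (rule Bernoulli_inequality)
  also have "\<dots> \<le> h (t / real j) ^ j"
  proof (rule power_mono)
    show "1 + (h t - 1) / real j \<le> h (t / real j)"
      using h_scaled_ge[OF t, of "1 / real j"] j by (simp add: diff_divide_distrib)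
    show "0 \<le> 1 + (h t - 1) / real j"
      using h_nonneg[OF t] j by (simp add: field_simps)
  qed
  finally show ?thesis using j by simp
qed

lemma h_continuous: "continuous_on {0<..<1} h"
proof -
  have "convex_on {0<..<1} (\<lambda>t. - h t)"
    using concave unfolding concave_on_def by (rule convex_on_subset) auto
  then have "continuous_on {0<..<1} (\<lambda>t. - h t)"
    by (rule convex_on_continuous[rotated]) simp
  then show ?thesis
    using continuous_on_minus by fastforce
qed

lemma moment_integrable: "(\<lambda>t. t ^ k * h t ^ l) integrable_on {0..1}"
proof (rule integrable_on_unit_interval[where B = 1])
  show "\<bar>t ^ k * h t ^ l\<bar> \<le> 1" if "t \<in> {0<..<1}" for t
    using that h_nonneg[of t] h_le_1[of t] by (auto simp: abs_mult intro!: mult_le_one power_le_one)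
qed (intro continuous_intros h_continuous)

lemma \<phi>_nonneg: "0 \<le> \<phi> y t"
  by (simp add: \<phi>_def)

lemma \<phi>_zero: "t \<in> {0..1} \<Longrightarrow> \<phi> 0 t = h t ^ m"
  using h_nonneg[of t] by (simp add: \<phi>_def)

lemma \<phi>_antimono: "antimono_on {0..1} (\<phi> y)"
proof (rule monotone_onI)
  fix s t :: real assume st: "s \<in> {0..1}" "t \<in> {0..1}" "s \<le> t"
  have "(h t)\<^sup>2 \<le> (h s)\<^sup>2"
    using monotone_onD[OF h_antimono st] h_nonneg[OF st(2)] by (intro power_mono) auto
  moreover have "(y * s)\<^sup>2 \<le> (y * t)\<^sup>2"
    using st by (auto simp: power_mult_distrib intro!: mult_left_mono power_mono)
  ultimately show "\<phi> y t \<le> \<phi> y s"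
    unfolding \<phi>_def by (intro power_mono real_sqrt_le_mono) auto
qed

lemma \<phi>_le_1: "t \<in> {0..1} \<Longrightarrow> \<phi> y t \<le> 1"
proof -
  assume t: "t \<in> {0..1}"
  have "(h t)\<^sup>2 \<le> 1"
    using h_nonneg[OF t] h_le_1[OF t] by (simp add: abs_square_le_1)
  then have "(h t)\<^sup>2 - (y * t)\<^sup>2 \<le> 1"
    using zero_le_power2[of "y * t"] by linarith
  then show ?thesis
    unfolding \<phi>_def by (intro power_le_one) auto
qed

lemma \<phi>_continuous: "continuous_on {0<..<1} (\<phi> y)"
  unfolding \<phi>_def[abs_def] by (intro continuous_intros h_continuous)

lemma \<phi>_integrable: "\<phi> y integrable_on {0..1}"
  using \<phi>_continuous by (rule integrable_on_unit_interval[where B = 1]) (use \<phi>_nonneg \<phi>_le_1 in \<open>auto simp: abs_of_nonneg\<close>)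

lemma J_ge: "t \<in> {0..1} \<Longrightarrow> t * \<phi> y t \<le> J y"
  unfolding J_def using \<phi>_antimono \<phi>_integrable \<phi>_nonneg by (intro antimono_integral_ge) auto

lemma J_pos: "0 < J y"
proof -
  \<comment> \<open>With \<open>t * (1 + \<bar>y\<bar>) = 1 / 2\<close> the line
    \<open>\<bar>y\<bar> * t\<close> is still below \<open>1 - t\<close>, hence below
    \<open>h t\<close>.\<close>
  define t where "t = 1 / (2 * (1 + \<bar>y\<bar>))"
  have t: "t \<in> {0..1}" "0 < t"
    by (auto simp: t_def field_simps)
  have "t * (1 + \<bar>y\<bar>) = 1 / 2"
    by (simp add: t_def field_simps)
  then have "\<bar>y * t\<bar> < \<bar>h t\<bar>"
    using h_ge[OF t(1)] t by (simp add: abs_mult algebra_simps)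
  then have "(y * t)\<^sup>2 < (h t)\<^sup>2"
    by (metis abs_ge_zero power2_abs power_strict_mono pos2)
  then have "0 < \<phi> y t"
    by (simp add: \<phi>_def)
  then show ?thesis
    using J_ge[OF t(1), of y] t by (smt (verit) mult_pos_pos)
qed

lemma J_zero: "J 0 = integral {0..1} (\<lambda>t. h t ^ m)"
  unfolding J_def by (intro integral_cong) (simp add: \<phi>_zero)

text \<open>Serves the small cases \<open>m = 2\<close> and \<open>m = 3\<close>, where a moment can
  have exponent 0 on \<open>h\<close> and so no decay to exploit.\<close>

lemma J_zero_ge: "1 / 2 ^ Suc m \<le> J 0"
proof -
  have "(1 / 2) ^ m \<le> h (1 / 2) ^ m"
    using h_ge[of "1 / 2"] by (intro power_mono) auto
  then show ?thesis
    using J_ge[of "1 / 2" 0] \<phi>_zero[of "1 / 2"] by (simp add: power_one_over)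
qed

text \<open>The harmonic mean \<open>t\<close> of \<open>r\<close> and \<open>s\<close> with weights
  \<open>a\<close> and \<open>b\<close> is their arithmetic mean with weights
  \<open>\<alpha>\<close> and \<open>\<beta>\<close>, and the same weights turn \<open>z * t\<close>
  into the mean of \<open>x * r\<close> and \<open>y * s\<close>. So concavity of \<open>h\<close>
  and of the Lorentz norm apply to the same convex combination, and weighted AM-GM supplies the
  geometric mean.\<close>

lemma J_convex: "convex_on {0..} (\<lambda>y. 1 / J y)"
proof (rule convex_onI)
  fix b x y :: real assume b: "0 < b" "b < 1"
  define a where "a = 1 - b"
  define z where "z = a * x + b * y"
  have ab: "0 < a" "0 < b" "a + b = 1" using b by (auto simp: a_def)
  have "1 / (a / integral {0..1} (\<phi> x) + b / integral {0..1} (\<phi> y)) \<le> integral {0..1} (\<phi> z)"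
  proof (rule Ball_Prekopa_Leindler)
    fix r s t assume rs: "r \<in> {0<..<1}" "s \<in> {0<..<1}" "0 < \<phi> x r" "0 < \<phi> y s"
      and t: "t = 1 / (a / r + b / s)"
    define \<alpha> \<beta> where \<alpha>\<beta>: "\<alpha> = a * t / r" "\<beta> = b * t / s"
    have D: "0 < a / r + b / s"
      using rs ab by (auto intro!: add_pos_pos)
    then have "0 < t" by (simp add: t)
    then have pos: "0 < \<alpha>" "0 < \<beta>"
      using rs ab by (auto simp: \<alpha>\<beta>)
    have "\<alpha> + \<beta> = t * (a / r + b / s)"
      by (simp add: \<alpha>\<beta> algebra_simps)
    then have sum1: "\<alpha> + \<beta> = 1"
      using D by (simp add: t)
    have "\<alpha> * r + \<beta> * s = t * (a + b)"
      using rs by (simp add: \<alpha>\<beta> algebra_simps)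
    then have t_eq: "\<alpha> * r + \<beta> * s = t"
      using ab by simp
    have z_eq: "z * t = \<alpha> * (x * r) + \<beta> * (y * s)"
      using rs by (simp add: \<alpha>\<beta> z_def algebra_simps)
    have t1: "t \<in> {0..1}"
      using t_eq sum1 rs pos \<open>0 < t\<close> convex_bound_le[of r 1 s \<alpha> \<beta>] by auto
    have root_pos: "0 < sqrt (max 0 ((h u)\<^sup>2 - (v * u)\<^sup>2)) \<and> \<bar>v * u\<bar> \<le> h u"
      if "0 < \<phi> v u" "u \<in> {0<..<1}" for u v
    proof -
      have "0 < (h u)\<^sup>2 - (v * u)\<^sup>2"
        using that m_ge_2 by (cases "0 < (h u)\<^sup>2 - (v * u)\<^sup>2") (auto simp: \<phi>_def power_0_left)
      then have "\<bar>v * u\<bar> \<le> \<bar>h u\<bar>"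
        by (simp add: abs_le_square_iff)
      with \<open>0 < (h u)\<^sup>2 - (v * u)\<^sup>2\<close> show ?thesis using h_nonneg[of u] that by auto
    qed
    define G where "G v u = sqrt (max 0 ((h u)\<^sup>2 - (v * u)\<^sup>2))" for u v
    have G: "0 < G x r" "0 < G y s" "\<bar>x * r\<bar> \<le> h r" "\<bar>y * s\<bar> \<le> h s"
      using root_pos rs by (auto simp: G_def)
    have sq: "G x r = sqrt ((h r)\<^sup>2 - (x * r)\<^sup>2)" "G y s = sqrt ((h s)\<^sup>2 - (y * s)\<^sup>2)"
      using G abs_le_square_iff[of "x * r" "h r"] abs_le_square_iff[of "y * s" "h s"] by (auto simp: G_def)
    have "\<alpha> * h r + \<beta> * h s \<le> h t"
      using concave pos sum1 rs t_eq unfolding concave_on_iff by (simp flip: t_eq)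
    moreover have "0 \<le> \<alpha> * h r + \<beta> * h s"
      using pos rs by (auto intro!: add_nonneg_nonneg mult_nonneg_nonneg h_nonneg)
    ultimately have hh: "(\<alpha> * h r + \<beta> * h s)\<^sup>2 \<le> (h t)\<^sup>2"
      by (intro power_mono)
    have "G x r powr \<alpha> * G y s powr \<beta> \<le> \<alpha> * G x r + \<beta> * G y s"
      using pos sum1 G by (intro Youngs_inequality_0) auto
    also have "\<dots> \<le> sqrt ((\<alpha> * h r + \<beta> * h s)\<^sup>2 - (\<alpha> * (x * r) + \<beta> * (y * s))\<^sup>2)"
      unfolding sq using G pos by (intro reverse_Minkowski_Lorentz) auto
    also have "\<dots> \<le> G z t"
      unfolding G_def z_eq using hh by (intro real_sqrt_le_mono) auto
    finally have "(G x r powr \<alpha> * G y s powr \<beta>) ^ m \<le> G z t ^ m"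
      by (intro power_mono) auto
    moreover have "(G x r ^ m) powr \<alpha> = (G x r powr \<alpha>) ^ m" "(G y s ^ m) powr \<beta> = (G y s powr \<beta>) ^ m"
      using G by (simp_all add: powr_powr mult.commute flip: powr_realpow)
    ultimately show "\<phi> x r powr (a * t / r) * \<phi> y s powr (b * t / s) \<le> \<phi> z t"
      unfolding \<alpha>\<beta>[symmetric] by (simp add: \<phi>_def G_def power_mult_distrib)
  qed (use \<phi>_continuous \<phi>_integrable \<phi>_antimono \<phi>_nonneg J_pos ab in \<open>auto simp: J_def\<close>)
  moreover have "0 < a / J x + b / J y"
    using ab J_pos[of x] J_pos[of y] by (intro add_pos_pos divide_pos_pos)
  ultimately have "1 / J z \<le> a / J x + b / J y"
    using J_pos[of z] unfolding J_def[symmetric] by (simp add: divide_le_eq mult.commute)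
  then show "1 / J ((1 - b) *\<^sub>R x + b *\<^sub>R y) \<le> (1 - b) * (1 / J x) + b * (1 / J y)"
    by (simp add: z_def a_def)
qed simp


text \<open>
  Log-concavity in the form \<open>h t \<le> h (t / j) ^ j\<close> trades the exponent against a dilation, after
  which every factor \<open>s * h s ^ m\<close> is at most \<open>J 0\<close>.
\<close>
lemma moment_le:
  assumes "(k + 1) * m \<le> j * l" "0 < j"
  shows "integral {0..1} (\<lambda>t. t ^ k * h t ^ l) \<le> (real j * J 0) ^ (k + 1)"
proof -
  define G where "G s = (real j * J 0) ^ k * h s ^ m" for s
  have J0: "((\<lambda>s. h s ^ m) has_integral J 0) {0..1}"
    using moment_integrable[of 0 m] by (simp add: J_zero has_integral_integral)
  have sub: "(\<lambda>s. h s ^ m) integrable_on {0..1 / real j}"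
    by (rule integrable_on_subinterval[of _ "{0..1}"]) (use moment_integrable[of 0 m] assms(2) in \<open>auto simp: divide_le_eq\<close>)
  then have I: "(G has_integral (real j * J 0) ^ k * integral {0..1 / real j} (\<lambda>s. h s ^ m)) {0..1 / real j}"
    unfolding G_def[abs_def] by (intro has_integral_mult_right) (simp add: has_integral_integral)
  have img: "(\<lambda>x. x / (1 / real j)) ` {0..1 / real j} = {0..1}"
    using assms(2) image_divide_atLeastAtMost[of "1 / real j" 0 "1 / real j"] by auto
  have stretched: "((\<lambda>t. G (1 / real j * t)) has_integral
      real j * ((real j * J 0) ^ k * integral {0..1 / real j} (\<lambda>s. h s ^ m))) {0..1}"
    using has_integral_stretch_real[OF I, of "1 / real j"] assms(2) unfolding img by simp
  have le_J0: "integral {0..1 / real j} (\<lambda>s. h s ^ m) \<le> J 0"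
    unfolding J_zero using assms(2) h_nonneg moment_integrable[of 0 m]
    by (intro integral_subset_le sub) auto
  have "t ^ k * h t ^ l \<le> G (1 / real j * t)" if t: "t \<in> {0..1}" for t
  proof -
    define s where "s = t / real j"
    have s: "s \<in> {0..1}" "t = real j * s"
      using t assms(2) by (auto simp: s_def field_simps)
    have "h t ^ l \<le> (h s ^ j) ^ l"
      using h_power_le[OF t assms(2)] h_nonneg[OF t] unfolding s_def by (intro power_mono) auto
    also have "\<dots> \<le> h s ^ ((k + 1) * m)"
      using assms h_nonneg[OF s(1)] h_le_1[OF s(1)] by (simp flip: power_mult add: power_decreasing)
    finally have "t ^ k * h t ^ l \<le> t ^ k * h s ^ ((k + 1) * m)"
      using t by (intro mult_left_mono) auto
    \<comment> \<open>Of the \<open>k + 1\<close> factors \<open>h s ^ m\<close>, \<open>k\<close>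
      absorb the powers of \<open>s\<close> through \<open>s * h s ^ m \<le> J 0\<close>, and the
      last one is integrated.\<close>
    also have "\<dots> = real j ^ k * (s * h s ^ m) ^ k * h s ^ m"
      by (simp add: s(2) power_mult_distrib power_add mult_ac flip: power_mult)
    also have "\<dots> \<le> real j ^ k * J 0 ^ k * h s ^ m"
      using J_ge[OF s(1), of 0] \<phi>_zero[OF s(1)] s h_nonneg[OF s(1)]
      by (intro mult_right_mono mult_left_mono power_mono) auto
    also have "\<dots> = G (1 / real j * t)"
      by (simp add: G_def s_def power_mult_distrib)
    finally show ?thesis .
  qed
  then have "integral {0..1} (\<lambda>t. t ^ k * h t ^ l)
      \<le> real j * ((real j * J 0) ^ k * integral {0..1 / real j} (\<lambda>s. h s ^ m))"
    using integral_le[OF moment_integrable has_integral_integrable[OF stretched]]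
      integral_unique[OF stretched] by simp
  also have "\<dots> \<le> real j * ((real j * J 0) ^ k * J 0)"
    using le_J0 J_pos[of 0] by (intro mult_left_mono) auto
  finally show ?thesis by (simp add: mult_ac)
qed

section \<open>The second moment and the expansion of \<open>J\<close> at 0\<close>

lemma P_integrable: "(\<lambda>t. t\<^sup>2 * h t ^ (m - 2)) integrable_on {0..1}"
  by (rule moment_integrable)

text \<open>For \<open>m \<ge> 3\<close>, 9 is the smallest \<open>j\<close> with
  \<open>3 * m \<le> j * (m - 2)\<close> in all cases (equality at \<open>m = 3\<close>), and
  \<open>729 = 9 ^ 3\<close>. For \<open>m = 2\<close> the bound \<open>J 0 \<ge> 1 / 8\<close> fits
  the same constant.\<close>

lemma P_le: "P \<le> 729 * J 0 ^ 3"
proof (cases "m = 2")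
  case True
  have "P \<le> integral {0..1} (\<lambda>t::real. 1)"
    unfolding P_def using True by (intro integral_le P_integrable) (auto simp: power_le_one)
  moreover have "(1 / 8) ^ 3 \<le> J 0 ^ 3"
    using J_zero_ge True by (intro power_mono) auto
  ultimately show ?thesis by (simp add: power_divide)
next
  case False
  then have "P \<le> (real 9 * J 0) ^ (2 + 1)"
    unfolding P_def using m_ge_2 by (intro moment_le) auto
  then show ?thesis by (simp add: power_mult_distrib)
qed

text \<open>Since \<open>h ^ m \<le> 1\<close>, at most half of the mass \<open>J 0\<close> lies
  below \<open>c = J 0 / 2\<close>. The rest has \<open>t ^ 2 \<ge> c ^ 2\<close>, and
  \<open>h ^ (m - 2)\<close> dominates \<open>h ^ m\<close>.\<close>

lemma P_ge: "J 0 ^ 3 / 8 \<le> P"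
proof -
  define c where "c = J 0 / 2"
  have "J 0 \<le> integral {0..1} (\<lambda>t::real. 1)"
    unfolding J_def using \<phi>_le_1 by (intro integral_le \<phi>_integrable) auto
  then have c: "0 < c" "c \<le> 1"
    using J_pos[of 0] by (auto simp: c_def)
  have "((\<lambda>t. if t \<in> {0..c} then c\<^sup>2 else 0) has_integral c\<^sup>2 * c) {0..1}"
    using c has_integral_const_real[of "c\<^sup>2" 0 c]
    by (subst has_integral_restrict) (auto simp: mult.commute)
  then have I: "((\<lambda>t. c\<^sup>2 * h t ^ m - (if t \<in> {0..c} then c\<^sup>2 else 0)) has_integral c\<^sup>2 * J 0 - c\<^sup>2 * c) {0..1}"
    using moment_integrable[of 0 m]
    by (intro has_integral_diff has_integral_mult_right) (auto simp: J_zero has_integral_integral)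
  have "c\<^sup>2 * J 0 - c\<^sup>2 * c \<le> P"
    unfolding P_def
  proof (rule has_integral_le[OF I integrable_integral[OF P_integrable]])
    fix t :: real assume t: "t \<in> {0..1}"
    note hb = h_nonneg[OF t] h_le_1[OF t]
    have hm: "h t ^ m \<le> h t ^ (m - 2)"
      using hb by (intro power_decreasing) auto
    show "c\<^sup>2 * h t ^ m - (if t \<in> {0..c} then c\<^sup>2 else 0) \<le> t\<^sup>2 * h t ^ (m - 2)"
    proof (cases "t \<le> c")
      case True
      have "c\<^sup>2 * h t ^ m \<le> c\<^sup>2 * 1"
        using hb by (intro mult_left_mono power_le_one) auto
      moreover have "0 \<le> t\<^sup>2 * h t ^ (m - 2)"
        using hb by simp
      moreover have "t \<in> {0..c}"
        using True t by simp
      ultimately show ?thesis by simp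
    next
      case False
      have "c\<^sup>2 * h t ^ m \<le> t\<^sup>2 * h t ^ (m - 2)"
        using hm c False hb by (intro mult_mono power_mono) auto
      then show ?thesis using False by simp
    qed
  qed
  then show ?thesis by (simp add: c_def power2_eq_square power3_eq_cube)
qed

lemma \<phi>_factor:
  assumes t: "t \<in> {0..1}" and pos: "0 < h t"
  shows "\<phi> y t = h t ^ m * sqrt (max 0 (1 - (y * t / h t)\<^sup>2)) ^ m"
proof -
  have "max 0 ((h t)\<^sup>2 - (y * t)\<^sup>2) = (h t)\<^sup>2 * max 0 (1 - (y * t / h t)\<^sup>2)"
    using pos by (auto simp: max_def power_divide field_simps)
  then show ?thesis
    using pos by (simp add: \<phi>_def real_sqrt_mult power_mult_distrib)
qed

lemma \<phi>_ge:
  assumes t: "t \<in> {0..1}"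
  shows "h t ^ m - real m / 2 * y\<^sup>2 * (t\<^sup>2 * h t ^ (m - 2)) \<le> \<phi> y t"
proof (cases "h t = 0")
  case True
  moreover have "0 \<le> real m / 2 * y\<^sup>2 * (t\<^sup>2 * h t ^ (m - 2))"
    using h_nonneg[OF t] by (intro mult_nonneg_nonneg) auto
  moreover have "h t ^ m = 0"
    using True m_ge_2 by (simp add: zero_power)
  ultimately show ?thesis using \<phi>_nonneg[of y t] by linarith
next
  case False
  then have pos: "0 < h t" using h_nonneg[OF t] by simp
  have split: "h t ^ m = h t ^ (m - 2) * (h t)\<^sup>2"
    using m_ge_2 by (simp only: power_add[symmetric] le_add_diff_inverse2)
  have "h t ^ m * (1 - real m / 2 * (y * t / h t)\<^sup>2) \<le> \<phi> y t"
    unfolding \<phi>_factor[OF t pos] using pos m_ge_2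
    by (intro mult_left_mono sqrt_power_ge_tangent) auto
  also have "h t ^ m * (1 - real m / 2 * (y * t / h t)\<^sup>2) = h t ^ m - real m / 2 * y\<^sup>2 * (t\<^sup>2 * h t ^ (m - 2))"
    using pos unfolding split by (simp add: field_simps power2_eq_square)
  finally show ?thesis .
qed

text \<open>Expands \<open>1 / (1 + w ^ 2)\<close> with a cubic error, by \<open>(1 - w ^ 2 + w ^ 3)
  * (1 + w ^ 2) = 1 + w ^ 3 * (1 - w + w ^ 2)\<close>. A quartic error would leave the exponent
  \<open>m - 4\<close> on \<open>h\<close> and exclude \<open>m = 3\<close> as well.\<close>

lemma \<phi>_le:
  assumes t: "t \<in> {0..1}" and m: "3 \<le> m" and y: "0 \<le> y"
  shows "\<phi> y t \<le> h t ^ m - real m / 2 * y\<^sup>2 * (t\<^sup>2 * h t ^ (m - 2))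
    + (sqrt (real m / 2) * y) ^ 3 * (t ^ 3 * h t ^ (m - 3))"
proof (cases "h t = 0")
  case True
  then have "\<phi> y t = 0"
    using m by (simp add: \<phi>_def max_def)
  then show ?thesis using True m y t by (simp add: zero_power)
next
  case False
  then have pos: "0 < h t" using h_nonneg[OF t] by simp
  define w where "w = sqrt (real m / 2) * y * t / h t"
  have w: "0 \<le> w" using pos y t by (simp add: w_def)
  have w2: "real m / 2 * (y * t / h t)\<^sup>2 = w\<^sup>2"
    by (simp add: w_def power_mult_distrib power_divide)
  have split: "h t ^ m = h t ^ (m - 2) * (h t)\<^sup>2" "h t ^ m = h t ^ (m - 3) * h t ^ 3"
    using m by (simp_all only: power_add[symmetric] le_add_diff_inverse2 m_ge_2)
  have "w \<le> 1 + w\<^sup>2"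
    using zero_le_power2[of "w - 1"] w by (simp add: power2_eq_square algebra_simps)
  then have "w ^ 3 * w \<le> w ^ 3 * (1 + w\<^sup>2)"
    using w by (intro mult_left_mono) auto
  then have "1 \<le> (1 - w\<^sup>2 + w ^ 3) * (1 + w\<^sup>2)"
    by (simp add: power2_eq_square power3_eq_cube algebra_simps)
  then have "1 / (1 + w\<^sup>2) \<le> 1 - w\<^sup>2 + w ^ 3"
    by (simp add: divide_le_eq add_pos_nonneg)
  then have "\<phi> y t \<le> h t ^ m * (1 - w\<^sup>2 + w ^ 3)"
    unfolding \<phi>_factor[OF t pos] using pos sqrt_power_le_inverse[of "(y * t / h t)\<^sup>2" m] m_ge_2
    unfolding w2 by (intro mult_left_mono) auto
  also have "\<dots> = h t ^ m - h t ^ m * w\<^sup>2 + h t ^ m * w ^ 3"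
    by (simp add: algebra_simps)
  also have "h t ^ m * w\<^sup>2 = real m / 2 * y\<^sup>2 * (t\<^sup>2 * h t ^ (m - 2))"
    unfolding w2[symmetric] split(1) using pos by (simp add: power_divide power_mult_distrib field_simps)
  also have "h t ^ m * w ^ 3 = (sqrt (real m / 2) * y) ^ 3 * (t ^ 3 * h t ^ (m - 3))"
    unfolding w_def split(2) using pos by (simp add: power_divide power_mult_distrib field_simps)
  finally show ?thesis .
qed

lemma taylor_integral:
  "((\<lambda>t. h t ^ m - real m / 2 * y\<^sup>2 * (t\<^sup>2 * h t ^ (m - 2))) has_integral J 0 - real m / 2 * y\<^sup>2 * P) {0..1}"
  using moment_integrable[of 0 m] P_integrable
  by (intro has_integral_diff has_integral_mult_right) (auto simp: J_zero P_def has_integral_integral)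

lemma J_lower: "J 0 - real m / 2 * y\<^sup>2 * P \<le> J y"
  unfolding J_def[of y]
  by (rule has_integral_le[OF taylor_integral integrable_integral[OF \<phi>_integrable]]) (rule \<phi>_ge)

lemma J_le_J_zero: "J y \<le> J 0"
  unfolding J_def
proof (rule integral_le[OF \<phi>_integrable \<phi>_integrable])
  show "\<phi> y t \<le> \<phi> 0 t" if "t \<in> {0..1}" for t
    unfolding \<phi>_def using that by (intro power_mono real_sqrt_le_mono) auto
qed

text \<open>For \<open>m \<ge> 4\<close>, 16 is the smallest \<open>j\<close> with
  \<open>4 * m \<le> j * (m - 3)\<close> in all cases (equality at \<open>m = 4\<close>), and
  \<open>65536 = 16 ^ 4\<close>. The cases \<open>m = 2\<close> and \<open>m = 3\<close> fit this
  constant through \<open>J_zero_ge\<close>.\<close>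

lemma J_upper:
  assumes y: "0 \<le> y"
  shows "J y \<le> J 0 - real m / 2 * y\<^sup>2 * P + 65536 * (sqrt (real m / 2) * y * J 0) ^ 3 * J 0"
proof (cases "m = 2")
  case True
  \<comment> \<open>For \<open>m = 2\<close> the expansion is exact where
    \<open>y * t \<le> h t\<close>. By \<open>h t \<ge> 1 - t\<close> this holds below
    \<open>c\<close>; above it the error is at most \<open>y\<^sup>2\<close>, on an interval of
    length at most \<open>y\<close>.\<close>
  define c where "c = 1 / (1 + y)"
  have c: "0 < c" "c \<le> 1" using y by (auto simp: c_def)
  have "((\<lambda>t. if t \<in> {c..1} then y\<^sup>2 else 0) has_integral y\<^sup>2 * (1 - c)) {0..1}"
    using c has_integral_const_real[of "y\<^sup>2" c 1]
    by (subst has_integral_restrict) (auto simp: mult.commute)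
  note I = has_integral_add[OF taylor_integral[of y] this]
  have "J y \<le> J 0 - real m / 2 * y\<^sup>2 * P + y\<^sup>2 * (1 - c)"
    unfolding J_def[of y]
  proof (rule has_integral_le[OF integrable_integral[OF \<phi>_integrable] I])
    fix t :: real assume t: "t \<in> {0..1}"
    have eq: "\<phi> y t = max 0 ((h t)\<^sup>2 - (y * t)\<^sup>2)"
      unfolding \<phi>_def using True by simp
    show "\<phi> y t \<le> h t ^ m - real m / 2 * y\<^sup>2 * (t\<^sup>2 * h t ^ (m - 2)) + (if t \<in> {c..1} then y\<^sup>2 else 0)"
    proof (cases "c \<le> t")
      case ct: True
      have "y\<^sup>2 * t\<^sup>2 \<le> y\<^sup>2 * 1"
        using t by (intro mult_left_mono power_le_one) auto
      then have "0 \<le> (h t)\<^sup>2 - y\<^sup>2 * t\<^sup>2 + y\<^sup>2"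
        using zero_le_power2[of "h t"] by linarith
      with \<open>y\<^sup>2 * t\<^sup>2 \<le> y\<^sup>2 * 1\<close> show ?thesis unfolding eq using True ct t by (simp add: power_mult_distrib)
    next
      case False
      then have "t * (1 + y) < 1"
        using y by (simp add: c_def field_simps)
      then have "y * t \<le> h t"
        using h_ge[OF t] by (simp add: algebra_simps)
      then have "(y * t)\<^sup>2 \<le> (h t)\<^sup>2"
        using y t by (intro power_mono) auto
      then show ?thesis unfolding eq using True False by (simp add: power_mult_distrib)
    qed
  qed
  also have "y\<^sup>2 * (1 - c) \<le> y\<^sup>2 * y"
    using y by (intro mult_left_mono) (auto simp: c_def field_simps)
  also have "y\<^sup>2 * y \<le> 65536 * (sqrt (real m / 2) * y * J 0) ^ 3 * J 0"
  proof -
    have "(1 / 8) ^ 4 \<le> J 0 ^ 4"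
      using J_zero_ge True by (intro power_mono) auto
    then have "y ^ 3 * 1 \<le> y ^ 3 * (65536 * J 0 ^ 4)"
      using y by (intro mult_left_mono) (auto simp: power_divide)
    then show ?thesis using True by (simp add: power_mult_distrib power2_eq_square power3_eq_cube power4_eq_xxxx mult_ac)
  qed
  finally show ?thesis by simp
next
  case False
  then have m: "3 \<le> m" using m_ge_2 by simp
  define Q where "Q = integral {0..1} (\<lambda>t. t ^ 3 * h t ^ (m - 3))"
  have Q: "Q \<le> 65536 * J 0 ^ 4"
  proof (cases "m = 3")
    case True
    have "Q \<le> integral {0..1} (\<lambda>t::real. 1)"
      unfolding Q_def using True by (intro integral_le moment_integrable) (auto simp: power_le_one)
    moreover have "(1 / 16) ^ 4 \<le> J 0 ^ 4"
      using J_zero_ge True by (intro power_mono) auto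
    ultimately show ?thesis by (simp add: power_divide)
  next
    case False
    then have "Q \<le> (real 16 * J 0) ^ (3 + 1)"
      unfolding Q_def using m by (intro moment_le) auto
    then show ?thesis by (simp add: power_mult_distrib)
  qed
  have "J y \<le> J 0 - real m / 2 * y\<^sup>2 * P + (sqrt (real m / 2) * y) ^ 3 * Q"
    unfolding J_def[of y]
  proof (rule has_integral_le[OF integrable_integral[OF \<phi>_integrable]])
    show "((\<lambda>t. h t ^ m - real m / 2 * y\<^sup>2 * (t\<^sup>2 * h t ^ (m - 2)) +
        (sqrt (real m / 2) * y) ^ 3 * (t ^ 3 * h t ^ (m - 3))) has_integral
        J 0 - real m / 2 * y\<^sup>2 * P + (sqrt (real m / 2) * y) ^ 3 * Q) {0..1}"
      unfolding Q_def
      by (intro has_integral_add[OF taylor_integral] has_integral_mult_right integrable_integral moment_integrable)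
  qed (use \<phi>_le m y in auto)
  also have "(sqrt (real m / 2) * y) ^ 3 * Q \<le> (sqrt (real m / 2) * y) ^ 3 * (65536 * J 0 ^ 4)"
    using Q y by (intro mult_left_mono) auto
  also have "\<dots> = 65536 * (sqrt (real m / 2) * y * J 0) ^ 3 * J 0"
    by (simp add: power_mult_distrib power3_eq_cube power4_eq_xxxx)
  finally show ?thesis by simp
qed

end

section \<open>The beta integral and the deficit as a function of the chord length\<close>

text \<open>\<open>2 * beta_half m\<close> is the quotient of the volumes of the unit balls in
  dimensions \<open>m + 1\<close> and \<open>m\<close>.\<close>

definition beta_half :: "nat \<Rightarrow> real"
  where "beta_half m = integral {0..1} (\<lambda>s. sqrt (1 - s\<^sup>2) ^ m)"

lemma beta_half_integrable: "(\<lambda>s::real. sqrt (1 - s\<^sup>2) ^ m) integrable_on {a..b}"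
  by (intro integrable_continuous_real continuous_intros)

text \<open>The tangent bound is integrated up to its zero \<open>c\<close>, which yields
  \<open>2 / 3 * c\<close>.\<close>

lemma beta_half_ge:
  assumes "2 \<le> m"
  shows "2 / 3 \<le> sqrt (real m / 2) * beta_half m"
proof -
  define q where "q = real m / 2"
  define c where "c = 1 / sqrt q"
  have q: "1 \<le> q" using assms by (simp add: q_def)
  have c: "0 < c" "c \<le> 1" "q * c\<^sup>2 = 1"
    using q by (auto simp: c_def power_divide)
  have "((\<lambda>s. 1 - q * s\<^sup>2) has_integral (c - q * c ^ 3 / 3) - (0 - q * 0 ^ 3 / 3)) {0..c}"
    using c by (intro fundamental_theorem_of_calculus)
      (auto intro!: derivative_eq_intros simp: power2_eq_square simp flip: has_real_derivative_iff_has_vector_derivative)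
  then have "(c - q * c ^ 3 / 3) - (0 - q * 0 ^ 3 / 3) \<le> integral {0..c} (\<lambda>s. sqrt (1 - s\<^sup>2) ^ m)"
  proof (rule has_integral_le[OF _ integrable_integral[OF beta_half_integrable]])
    fix s assume s: "s \<in> {0..c}"
    then have "s\<^sup>2 \<le> 1" using c by (simp add: abs_square_le_1)
    then show "1 - q * s\<^sup>2 \<le> sqrt (1 - s\<^sup>2) ^ m"
      using sqrt_power_ge_tangent[of "s\<^sup>2" m] assms by (simp add: q_def)
  qed
  also have "\<dots> \<le> beta_half m"
    unfolding beta_half_def using c
    by (intro integral_subset_le beta_half_integrable) (auto simp: abs_square_le_1)
  finally have "c - c * (q * c\<^sup>2) / 3 \<le> beta_half m"
    by (simp add: power2_eq_square power3_eq_cube mult_ac)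
  then have "sqrt q * (2 / 3 * c) \<le> sqrt q * beta_half m"
    using c q by (intro mult_left_mono) auto
  then show ?thesis using q by (simp add: c_def q_def)
qed

text \<open>The rational majorant integrates to \<open>arctan r / r\<close>.\<close>

lemma beta_half_le:
  assumes "2 \<le> m"
  shows "sqrt (real m / 2) * beta_half m \<le> 2"
proof -
  define r where "r = sqrt (real m / 2)"
  have r: "0 < r" "r\<^sup>2 = real m / 2" using assms by (auto simp: r_def)
  have I: "((\<lambda>s. 1 / (1 + r\<^sup>2 * s\<^sup>2)) has_integral arctan (r * 1) / r - arctan (r * 0) / r) {0..1}"
    using r by (intro fundamental_theorem_of_calculus)
      (auto intro!: derivative_eq_intros simp: power_mult_distrib divide_simps
        simp flip: has_real_derivative_iff_has_vector_derivative)
  have "beta_half m \<le> arctan (r * 1) / r - arctan (r * 0) / r"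
    unfolding beta_half_def
  proof (rule has_integral_le[OF integrable_integral[OF beta_half_integrable] I])
    fix s :: real assume s: "s \<in> {0..1}"
    then have "s\<^sup>2 \<le> 1" by (simp add: abs_square_le_1)
    then show "sqrt (1 - s\<^sup>2) ^ m \<le> 1 / (1 + r\<^sup>2 * s\<^sup>2)"
      using sqrt_power_le_inverse[of "s\<^sup>2" m] assms by (simp add: r)
  qed
  then have "r * beta_half m \<le> arctan r"
    using r by (simp add: field_simps)
  also have "\<dots> \<le> 2"
    using arctan_ubound[of r] pi_less_4 by linarith
  finally show ?thesis by (simp add: r_def)
qed

lemma beta_half_pos: "2 \<le> m \<Longrightarrow> 0 < beta_half m"
  using beta_half_ge[of m] zero_less_mult_pos[of "sqrt (real m / 2)" "beta_half m"] by simp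

context convex_profile
begin

text \<open>The first factor depends on the shape and lies in \<open>[1 / 8, 729]\<close>. The
  second depends on the dimension and lies in \<open>[(2 / 3) ^ 2, 2 ^ 2]\<close>; it converts
  \<open>\<eta>\<close> to \<open>\<epsilon>\<close>.\<close>

definition modulus_coeff :: real
  where "modulus_coeff = P / J 0 ^ 3 * (sqrt (real m / 2) * beta_half m)\<^sup>2"

lemma modulus_coeff_bounds: "1 / 18 \<le> modulus_coeff" "modulus_coeff \<le> 2916"
proof -
  have p: "1 / 8 \<le> P / J 0 ^ 3" "P / J 0 ^ 3 \<le> 729"
    using P_ge P_le J_pos[of 0] by (simp_all add: field_simps)
  have k: "(2 / 3)\<^sup>2 \<le> (sqrt (real m / 2) * beta_half m)\<^sup>2" "(sqrt (real m / 2) * beta_half m)\<^sup>2 \<le> 2\<^sup>2"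
    using beta_half_ge[OF m_ge_2] beta_half_le[OF m_ge_2] by (intro power_mono; simp)+
  show "1 / 18 \<le> modulus_coeff"
    using mult_mono[OF p(1) k(1)] p by (simp add: modulus_coeff_def power2_eq_square)
  show "modulus_coeff \<le> 2916"
    using mult_mono[OF p(2) k(2)] p by (simp add: modulus_coeff_def)
qed

text \<open>Convexity of \<open>1 / J\<close> gives continuity only at positive arguments. At 0,
  \<open>J\<close> is squeezed between its quadratic lower bound and \<open>J 0\<close>.\<close>

lemma J_continuous: "continuous_on {0..} J"
proof -
  have "convex_on {0<..} (\<lambda>y. 1 / J y)"
    using J_convex by (rule convex_on_subset) auto
  then have "continuous_on {0<..} (\<lambda>y. 1 / J y)"
    by (rule convex_on_continuous[rotated]) simp
  then have "continuous_on {0<..} (\<lambda>y. inverse (1 / J y))"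
    using J_pos by (intro continuous_on_inverse) (auto simp: less_imp_neq[symmetric])
  then have pos: "isCont J y" if "0 < y" for y
    using that by (simp add: continuous_on_eq_continuous_at)
  have "((\<lambda>y. J 0 - real m / 2 * y\<^sup>2 * P) \<longlongrightarrow> J 0 - real m / 2 * 0\<^sup>2 * P) (at 0)"
    by (intro tendsto_intros)
  then have lower: "((\<lambda>y. J 0 - real m / 2 * y\<^sup>2 * P) \<longlongrightarrow> J 0) (at 0)"
    by simp
  have "(J \<longlongrightarrow> J 0) (at 0)"
    by (rule tendsto_sandwich[OF _ _ lower tendsto_const])
      (use J_lower J_le_J_zero in auto)
  then have "isCont J 0" by (simp add: isCont_def)
  with pos have "isCont J y" if "0 \<le> y" for y
    using that by (cases "y = 0") auto
  then show ?thesis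
    by (intro continuous_at_imp_continuous_on) auto
qed

definition deficit :: "real \<Rightarrow> real"
  where "deficit y = 1 - J y / J 0"

lemma deficit_nonneg: "0 \<le> deficit y"
  using J_le_J_zero[of y] J_pos[of 0] by (simp add: deficit_def divide_le_eq)

lemma deficit_expansion:
  assumes "0 \<le> y" and \<eta>: "\<eta> = sqrt (real m / 2) * y * J 0"
  shows "deficit y \<le> P / J 0 ^ 3 * \<eta>\<^sup>2" "P / J 0 ^ 3 * \<eta>\<^sup>2 - 65536 * \<eta> ^ 3 \<le> deficit y"
proof -
  note J0 = J_pos[of 0]
  have eq: "P / J 0 ^ 3 * \<eta>\<^sup>2 = real m / 2 * y\<^sup>2 * P / J 0"
    using J0 by (simp add: \<eta> power_mult_distrib field_simps power2_eq_square power3_eq_cube)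
  have d: "deficit y = (J 0 - J y) / J 0"
    using J0 by (simp add: deficit_def diff_divide_distrib)
  show "deficit y \<le> P / J 0 ^ 3 * \<eta>\<^sup>2"
    unfolding eq d using J0 J_lower[of y] by (intro divide_right_mono) auto
  have "P / J 0 ^ 3 * \<eta>\<^sup>2 - 65536 * \<eta> ^ 3 = (real m / 2 * y\<^sup>2 * P - 65536 * \<eta> ^ 3 * J 0) / J 0"
    unfolding eq using J0 by (simp add: diff_divide_distrib)
  also have "\<dots> \<le> deficit y"
    unfolding d using J0 J_upper[OF assms(1)] by (intro divide_right_mono) (auto simp: \<eta>)
  finally show "P / J 0 ^ 3 * \<eta>\<^sup>2 - 65536 * \<eta> ^ 3 \<le> deficit y" .
qed

text \<open>
  With \<open>\<eta> = sqrt (m / 2) * y * J 0\<close> and \<open>\<kappa> = sqrt (m / 2) * beta_half m\<close>, the equation for \<open>y\<close>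
  reads \<open>\<kappa> * \<epsilon> = \<eta> * (1 - deficit y)\<close>; these two quantities are of order one uniformly in \<open>m\<close>.
\<close>
lemma deficit_at_eps:
  assumes eps: "0 < \<epsilon>" "\<epsilon> < 1 / 12000"
  obtains y y' where "0 < y" "y < y'" "y * J y = \<epsilon> * beta_half m" "\<epsilon> * beta_half m < y' * J y'"
    "\<bar>deficit y - modulus_coeff * \<epsilon>\<^sup>2\<bar> \<le> 300000000 * \<epsilon> ^ 3" "deficit y \<le> \<epsilon>"
proof -
  define r where "r = sqrt (real m / 2)"
  define \<kappa> where "\<kappa> = r * beta_half m"
  define p where "p = P / J 0 ^ 3"
  \<comment> \<open>Chosen so that \<open>\<eta> = 1 / 40\<close> at \<open>y'\<close>. Then
    \<open>p * \<eta>\<^sup>2 \<le> 729 / 1600\<close>, which is below one half.\<close>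
  define y' where "y' = 1 / 40 / (r * J 0)"
  note J0 = J_pos[of 0]
  have r: "0 < r" using m_ge_2 by (simp add: r_def)
  have \<kappa>: "2 / 3 \<le> \<kappa>" "\<kappa> \<le> 2"
    using beta_half_ge[OF m_ge_2] beta_half_le[OF m_ge_2] by (auto simp: \<kappa>_def r_def)
  have p: "0 \<le> p" "p \<le> 729"
    using P_ge P_le J0 by (simp_all add: p_def field_simps)
  have y': "0 < y'" using r J0 by (simp add: y'_def)
  have J_eq: "J y = J 0 * (1 - deficit y)" for y
    using J0 by (simp add: deficit_def)
  have d_le: "deficit y \<le> p * (r * y * J 0)\<^sup>2" if "0 \<le> y" for y
    using deficit_expansion(1)[OF that refl] by (simp add: p_def r_def)
  have half: "deficit y \<le> 1 / 2" if y: "0 \<le> y" "y \<le> y'" for y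
  proof -
    have "r * y * J 0 \<le> 1 / 40"
      using y r J0 by (simp add: y'_def field_simps)
    then have "(r * y * J 0)\<^sup>2 \<le> (1 / 40)\<^sup>2"
      using y r J0 by (intro power_mono) auto
    then have "p * (r * y * J 0)\<^sup>2 \<le> 729 * (1 / 40)\<^sup>2"
      using p by (intro mult_mono) auto
    with d_le[OF y(1)] show ?thesis by (simp add: power2_eq_square)
  qed
  have big: "\<epsilon> * beta_half m < y' * J y'"
  proof -
    have "r * (\<epsilon> * beta_half m) = \<kappa> * \<epsilon>" by (simp add: \<kappa>_def)
    also have "\<dots> \<le> 2 * \<epsilon>" using \<kappa> eps by (intro mult_right_mono) auto
    also have "\<dots> < 1 / 40 * (1 / 2)" using eps by simp
    also have "\<dots> \<le> 1 / 40 * (1 - deficit y')"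
      using half[of y'] y' by (intro mult_left_mono) auto
    also have "\<dots> = r * (y' * J y')"
    proof -
      have "r * y' * J 0 = 1 / 40"
        using r J0 by (simp add: y'_def)
      then have "1 / 40 * (1 - deficit y') = r * y' * J 0 * (1 - deficit y')"
        by simp
      then show ?thesis
        by (simp add: J_eq[of y'])
    qed
    finally show ?thesis using r by simp
  qed
  have "\<exists>y. 0 \<le> y \<and> y \<le> y' \<and> y * J y = \<epsilon> * beta_half m"
  proof (rule IVT'[of "\<lambda>y. y * J y"])
    show "0 * J 0 \<le> \<epsilon> * beta_half m"
      using eps beta_half_pos[OF m_ge_2] by simp
    show "continuous_on {0..y'} (\<lambda>y. y * J y)"
      by (intro continuous_intros continuous_on_subset[OF J_continuous]) auto
    show "\<epsilon> * beta_half m \<le> y' * J y'" "0 \<le> y'"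
      using big y' by simp_all
  qed
  then obtain y where y: "0 \<le> y" "y \<le> y'" "y * J y = \<epsilon> * beta_half m" by blast
  have y0: "0 < y"
    using y eps beta_half_pos[OF m_ge_2] by (cases "y = 0") auto
  have yy': "y < y'"
    using y big by (cases "y = y'") auto
  define \<eta> where "\<eta> = r * y * J 0"
  define d where "d = deficit y"
  have d: "0 \<le> d" "d \<le> 1 / 2"
    using deficit_nonneg half y by (auto simp: d_def)
  have \<eta>0: "0 \<le> \<eta>" using r y J0 by (simp add: \<eta>_def)
  have key: "\<kappa> * \<epsilon> = \<eta> * (1 - d)"
  proof -
    have "\<kappa> * \<epsilon> = r * (y * J y)" unfolding y(3) by (simp add: \<kappa>_def)
    then show ?thesis by (simp add: J_eq[of y] \<eta>_def d_def)
  qed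
  have "\<eta> * (1 / 2) \<le> \<eta> * (1 - d)"
    using d \<eta>0 by (intro mult_left_mono) auto
  then have "\<eta> \<le> 2 * (\<kappa> * \<epsilon>)" using key by simp
  also have "\<dots> \<le> 2 * (2 * \<epsilon>)" using \<kappa> eps by (intro mult_left_mono mult_right_mono) auto
  finally have \<eta>4: "\<eta> \<le> 4 * \<epsilon>" by simp
  have \<eta>2: "\<eta>\<^sup>2 \<le> 16 * \<epsilon>\<^sup>2"
    using power_mono[OF \<eta>4 \<eta>0, of 2] by (simp add: power_mult_distrib)
  have \<eta>3: "\<eta> ^ 3 \<le> 64 * \<epsilon> ^ 3"
    using power_mono[OF \<eta>4 \<eta>0, of 3] by (simp add: power_mult_distrib)
  have exp1: "d \<le> p * \<eta>\<^sup>2" and exp2: "p * \<eta>\<^sup>2 - 65536 * \<eta> ^ 3 \<le> d"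
    using deficit_expansion[OF y(1) refl] by (auto simp: p_def \<eta>_def d_def r_def)
  have p\<eta>: "p * \<eta>\<^sup>2 \<le> 11664 * \<epsilon>\<^sup>2"
    using mult_mono[OF p(2) \<eta>2] by simp
  then have d2: "d \<le> 11664 * \<epsilon>\<^sup>2" using exp1 by simp
  \<comment> \<open>Here \<open>\<epsilon> < 1 / 12000\<close> brings
    \<open>11664 * \<epsilon>\<close> below 1, where \<open>11664 = 729 * 16\<close>.\<close>
  also have "11664 * \<epsilon>\<^sup>2 = (11664 * \<epsilon>) * \<epsilon>"
    by (simp add: power2_eq_square)
  also have "\<dots> \<le> 1 * \<epsilon>"
    using eps by (intro mult_right_mono) auto
  finally have d_eps: "d \<le> \<epsilon>" by simp
  have coeff: "modulus_coeff * \<epsilon>\<^sup>2 = p * \<eta>\<^sup>2 * (1 - d)\<^sup>2"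
  proof -
    have "modulus_coeff * \<epsilon>\<^sup>2 = p * (\<kappa> * \<epsilon>)\<^sup>2"
      by (simp add: modulus_coeff_def p_def \<kappa>_def r_def power_mult_distrib)
    then show ?thesis unfolding key by (simp add: power_mult_distrib)
  qed
  define E where "E = p * \<eta>\<^sup>2"
  have E: "0 \<le> E" using p by (simp add: E_def)
  have sq1: "1 - 2 * d \<le> (1 - d)\<^sup>2"
    by (simp add: power2_eq_square algebra_simps)
  have sq2: "(1 - d)\<^sup>2 \<le> 1"
    using d by (intro power_le_one) auto
  have "E * (1 - d)\<^sup>2 \<le> E"
    using sq2 E by (rule mult_left_le)
  moreover have "E - 2 * (E * d) \<le> E * (1 - d)\<^sup>2"
    using mult_left_mono[OF sq1 E] by (simp add: algebra_simps)
  moreover have "E * d \<le> (11664 * \<epsilon>\<^sup>2) * \<epsilon>"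
    unfolding E_def by (rule mult_mono[OF p\<eta> d_eps]) (use d in auto)
  then have "E * d \<le> 11664 * \<epsilon> ^ 3"
    by (simp add: power2_eq_square power3_eq_cube)
  moreover have "0 \<le> \<epsilon> ^ 3" using eps by simp
  moreover have "modulus_coeff * \<epsilon>\<^sup>2 = E * (1 - d)\<^sup>2"
    unfolding coeff E_def ..
  moreover have "d \<le> E" "E - 65536 * \<eta> ^ 3 \<le> d"
    using exp1 exp2 by (simp_all add: E_def)
  \<comment> \<open>The two one-sided errors are \<open>65536 * 64\<close> and
    \<open>2 * 11664\<close> times \<open>\<epsilon> ^ 3\<close>, both well within the stated
    constant.\<close>
  ultimately have "\<bar>d - modulus_coeff * \<epsilon>\<^sup>2\<bar> \<le> 300000000 * \<epsilon> ^ 3"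
    unfolding abs_le_iff using \<eta>3 by linarith
  then show thesis
    using that[OF y0 yy' y(3) big] d_eps by (simp add: d_def)
qed

text \<open>Meant for the power type of an individual body, so the neighbourhood of 0 may depend on
  the profile.\<close>

lemma deficit_quadratic:
  "\<forall>\<^sub>F y in at_right 0. real m / 2 * P / J 0 / 2 * y\<^sup>2 \<le> deficit y"
proof -
  define A where "A = real m / 2 * P / J 0"
  define B where "B = 65536 * (sqrt (real m / 2) * J 0) ^ 3"
  have "0 < P"
    using P_ge zero_less_power[OF J_pos, of 0 3] by linarith
  then have A: "0 < A" using m_ge_2 J_pos[of 0] by (simp add: A_def)
  have B: "0 < B" using m_ge_2 J_pos[of 0] by (simp add: B_def)
  have "A / 2 * y\<^sup>2 \<le> deficit y" if y: "0 < y" "y < A / (2 * B)" for y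
  proof -
    have "B * y \<le> A / 2" using y B by (simp add: field_simps)
    then have "B * y * y\<^sup>2 \<le> A / 2 * y\<^sup>2" by (intro mult_right_mono) auto
    moreover have "A * y\<^sup>2 - B * y * y\<^sup>2 \<le> deficit y"
    proof -
      have "P / J 0 ^ 3 * (sqrt (real m / 2) * y * J 0)\<^sup>2 = A * y\<^sup>2"
        using J_pos[of 0] by (simp add: A_def power_mult_distrib field_simps power2_eq_square power3_eq_cube)
      moreover have "65536 * (sqrt (real m / 2) * y * J 0) ^ 3 = B * y * y\<^sup>2"
        by (simp add: B_def power_mult_distrib power2_eq_square power3_eq_cube)
      ultimately show ?thesis using deficit_expansion(2)[of y, OF _ refl] y by simp
    qed
    ultimately show ?thesis by simp
  qed
  then show ?thesis
    unfolding eventually_at_right_field A_def[symmetric] using A B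
    by (intro exI[of _ "A / (2 * B)"]) auto
qed

end

section \<open>Volume of central sections\<close>

lemma sum_squares_orthonormal_combination:
  fixes b :: "nat \<Rightarrow> nat \<Rightarrow> real"
  assumes "\<And>j k. j < p \<Longrightarrow> k < p \<Longrightarrow> dot n (b j) (b k) = (if j = k then 1 else 0)"
  shows "(\<Sum>i<n. (\<Sum>k<p. y k * b k i)\<^sup>2) = (\<Sum>k<p. (y k)\<^sup>2)"
proof -
  have "(\<Sum>i<n. (\<Sum>k<p. y k * b k i)\<^sup>2) = (\<Sum>i<n. \<Sum>j<p. \<Sum>k<p. (y j * y k) * (b j i * b k i))"
    by (simp add: power2_eq_square sum_product mult_ac)
  also have "\<dots> = (\<Sum>j<p. \<Sum>k<p. \<Sum>i<n. (y j * y k) * (b j i * b k i))"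
    by (subst sum.swap, intro sum.cong refl sum.swap)
  also have "\<dots> = (\<Sum>j<p. \<Sum>k<p. y j * y k * dot n (b j) (b k))"
    by (simp add: dot_def sum_distrib_left)
  also have "\<dots> = (\<Sum>j<p. \<Sum>k<p. if k = j then (y j)\<^sup>2 else 0)"
    by (intro sum.cong refl) (auto simp: assms power2_eq_square)
  also have "\<dots> = (\<Sum>k<p. (y k)\<^sup>2)"
    by (intro sum.cong refl) simp
  finally show ?thesis .
qed

text \<open>
  Bessel's inequality gives \<open>\<le>\<close> in every coordinate, and the coordinates sum to \<open>n\<close> on both sides.
\<close>
lemma orthonormal_basis_column:
  assumes on: "\<And>j k. j < n \<Longrightarrow> k < n \<Longrightarrow> dot n (b j) (b k) = (if j = k then 1 else 0)"
    and i: "i < n"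
  shows "(\<Sum>k<n. (b k i)\<^sup>2) = 1"
proof -
  define S where "S i = (\<Sum>k<n. (b k i)\<^sup>2)" for i
  have S1: "S i \<le> 1" if i: "i < n" for i
  proof -
    have "(S i)\<^sup>2 = (\<Sum>k<n. b k i * b k i)\<^sup>2"
      by (simp add: S_def power2_eq_square)
    also have "\<dots> \<le> (\<Sum>l<n. (\<Sum>k<n. b k i * b k l)\<^sup>2)"
      using i by (intro member_le_sum) auto
    also have "\<dots> = S i"
      unfolding S_def by (rule sum_squares_orthonormal_combination) (rule on)
    finally have "S i * S i \<le> S i * 1" by (simp add: power2_eq_square)
    moreover have "0 \<le> S i" by (simp add: S_def sum_nonneg)
    ultimately show ?thesis by (cases "S i = 0") auto
  qed
  have "(\<Sum>i<n. S i) = (\<Sum>k<n. dot n (b k) (b k))"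
    unfolding S_def dot_def by (subst sum.swap) (simp add: power2_eq_square)
  also have "\<dots> = real n"
    by (simp add: on)
  finally have "(\<Sum>i<n. 1 - S i) = 0"
    by (simp add: sum_subtractf)
  then have "1 - S i = 0"
    using S1 i by (subst (asm) sum_nonneg_eq_0_iff) auto
  then show ?thesis by (simp add: S_def)
qed

text \<open>\<open>hyperplane_volume\<close> selects its basis with \<open>SOME\<close>, so nothing
  is known about that basis before existence is shown.\<close>

lemma orthonormal_basis_of_perp_exists:
  assumes u: "u \<in> unit_sphere n"
  shows "\<exists>b. orthonormal_basis_of_perp n u b"
proof -
  have uu: "(\<Sum>i<n. u i * u i) = 1" and uR: "u \<in> Rn n"
    using u by (auto simp: unit_sphere_def dot_def)
  then have n: "0 < n" by (cases n) auto
  define \<delta> where "\<delta> k = (\<lambda>i. if i = k then 1 else 0 :: real)" for k :: nat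
  have d\<delta>: "dot n x (\<delta> k) = x k" "dot n (\<delta> k) x = x k" if "k < n" for x k
    using that by (simp_all add: dot_def \<delta>_def if_distrib[of "\<lambda>z. _ * z"] if_distrib[of "\<lambda>z. z * _"] cong: if_cong)
  have du: "dot n u u = 1" using uu by (simp add: dot_def)
  have lin: "dot n (\<lambda>i. x i - a * z i) w = dot n x w - a * dot n z w"
    "dot n w (\<lambda>i. x i - a * z i) = dot n w x - a * dot n w z" for x z w a
    by (simp_all add: dot_def algebra_simps sum_subtractf sum_distrib_left)
  show ?thesis
  proof (cases "u 0 = 1")
    case True
    have "u i = 0" if i: "0 < i" "i < n" for i
    proof -
      have "(\<Sum>i\<in>{..<n} - {0}. u i * u i) = 0"
        using uu n True by (subst (asm) sum.remove[of _ 0]) auto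
      then show ?thesis
        using i by (subst (asm) sum_nonneg_eq_0_iff) auto
    qed
    then have "orthonormal_basis_of_perp n u (\<lambda>j. \<delta> (Suc j))"
      unfolding orthonormal_basis_of_perp_def
      by (auto simp: d\<delta>) (auto simp: \<delta>_def topspace_Euclidean_space)
    then show ?thesis by (rule exI[of _ "\<lambda>j. \<delta> (Suc j)"])
  next
    case False
    \<comment> \<open>The Householder reflection exchanging \<open>e\<^sub>1\<close> and \<open>u\<close>, applied to the other unit vectors.\<close>
    define w where "w = 1 - u 0"
    have w: "w \<noteq> 0" using False by (simp add: w_def)
    define v where "v = (\<lambda>i. u i - 1 * \<delta> 0 i)"
    define b where "b j = (\<lambda>i. \<delta> (Suc j) i - u (Suc j) / w * v i)" for j
    have vu: "dot n v u = w"
      unfolding v_def lin using n by (simp add: du d\<delta> w_def)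
    have v\<delta>: "dot n v (\<delta> (Suc j)) = u (Suc j)" "dot n (\<delta> (Suc j)) v = u (Suc j)" if "j < n - 1" for j
      using that by (auto simp: d\<delta>) (auto simp: v_def \<delta>_def)
    have vv: "dot n v v = 2 * w"
    proof -
      have "dot n v v = dot n v u - 1 * dot n v (\<delta> 0)"
        by (subst (2) v_def) (rule lin)
      also have "\<dots> = 2 * w"
        using vu n by (simp add: d\<delta>) (simp add: v_def \<delta>_def w_def)
      finally show ?thesis .
    qed
    have "dot n (b j) u = 0" if "j < n - 1" for j
      unfolding b_def lin using that w by (simp add: vu d\<delta>)
    moreover have "dot n (b j) (b k) = (if j = k then 1 else 0)" if "j < n - 1" "k < n - 1" for j k
    proof -
      have "dot n (\<delta> (Suc j)) (\<delta> (Suc k)) = (if j = k then 1 else 0)"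
        using that by (auto simp: d\<delta>) (auto simp: \<delta>_def)
      then show ?thesis
        unfolding b_def lin using that w by (simp add: v\<delta> vv field_simps)
    qed
    moreover have "b j \<in> Rn n" if "j < n - 1" for j
      using that uR n by (auto simp: b_def v_def \<delta>_def topspace_Euclidean_space)
    ultimately have "orthonormal_basis_of_perp n u b"
      by (simp add: orthonormal_basis_of_perp_def)
    then show ?thesis by (rule exI[of _ b])
  qed
qed

text \<open>Adjoining \<open>u\<close> completes the basis. For \<open>i = 0\<close> this is the
  norm of the axial coordinate as a linear form on the hyperplane, the only trace that the chosen
  basis leaves in the section volume.\<close>

lemma orthonormal_basis_of_perp_column:
  assumes b: "orthonormal_basis_of_perp n u b" and u: "u \<in> unit_sphere n" and i: "i < n"
  shows "(\<Sum>j<n-1. (b j i)\<^sup>2) = 1 - (u i)\<^sup>2"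
proof -
  define B where "B k = (if k = n - 1 then u else b k)" for k
  have sym: "dot n x y = dot n y x" for x y
    by (simp add: dot_def mult.commute)
  have "(\<Sum>k<n. (B k i)\<^sup>2) = 1"
  proof (rule orthonormal_basis_column[OF _ i])
    show "dot n (B j) (B k) = (if j = k then 1 else 0)" if "j < n" "k < n" for j k
      using b u that sym[of u "b k"] unfolding orthonormal_basis_of_perp_def unit_sphere_def
      by (simp add: B_def)
  qed
  also have "{..<n} = insert (n - 1) {..<n-1}"
    using i by auto
  finally show ?thesis by (simp add: B_def)
qed

section \<open>Rotation invariance of product Lebesgue measure\<close>

lemma measurable_shear:
  fixes i j :: 'i and a :: real
  assumes "i \<in> I" "j \<in> I" and [measurable]: "g \<in> N \<rightarrow>\<^sub>M Pi\<^sub>M I (\<lambda>_. lborel)"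
  shows "(\<lambda>x. (g x)(i := g x i + a * g x j)) \<in> N \<rightarrow>\<^sub>M Pi\<^sub>M I (\<lambda>_. lborel)"
proof (rule measurable_fun_upd[where J = I])
  have g: "(\<lambda>x. g x i) \<in> N \<rightarrow>\<^sub>M lborel" "(\<lambda>x. g x j) \<in> N \<rightarrow>\<^sub>M lborel"
    by (rule measurable_compose[OF assms(3) measurable_component_singleton], fact)+
  show "(\<lambda>x. g x i + a * g x j) \<in> N \<rightarrow>\<^sub>M lborel"
    using g by simp
qed (use assms in auto)

text \<open>With the other coordinates frozen, the shear is a translation of coordinate
  \<open>i\<close>.\<close>

lemma PiM_lborel_shear:
  fixes f :: "('i \<Rightarrow> real) \<Rightarrow> ennreal"
  assumes I: "finite I" "i \<in> I" "j \<in> I" "i \<noteq> j"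
    and f[measurable]: "f \<in> borel_measurable (Pi\<^sub>M I (\<lambda>_. lborel))"
  shows "(\<integral>\<^sup>+ x. f (x(i := x i + a * x j)) \<partial>Pi\<^sub>M I (\<lambda>_. lborel)) = (\<integral>\<^sup>+ x. f x \<partial>Pi\<^sub>M I (\<lambda>_. lborel))"
proof -
  interpret product_sigma_finite "\<lambda>_::'i. lborel :: real measure" by standard
  define I' where "I' = I - {i}"
  have I': "finite I'" "i \<notin> I'" "I = insert i I'"
    using I by (auto simp: I'_def)
  have f'[measurable]: "f \<in> borel_measurable (Pi\<^sub>M (insert i I') (\<lambda>_. lborel))"
    using f I' by simp
  have meas: "(\<lambda>x. f (x(i := x i + a * x j))) \<in> borel_measurable (Pi\<^sub>M (insert i I') (\<lambda>_. lborel))"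
    by (rule measurable_compose[OF measurable_shear f']) (use I I' in auto)
  have "(\<integral>\<^sup>+ x. f (x(i := x i + a * x j)) \<partial>Pi\<^sub>M (insert i I') (\<lambda>_. lborel)) =
      (\<integral>\<^sup>+ x. \<integral>\<^sup>+ y. f (x(i := y + a * x j)) \<partial>lborel \<partial>Pi\<^sub>M I' (\<lambda>_. lborel))"
    using I by (subst product_nn_integral_insert[OF I'(1,2) meas]) simp
  also have "\<dots> = (\<integral>\<^sup>+ x. \<integral>\<^sup>+ y. f (x(i := y)) \<partial>lborel \<partial>Pi\<^sub>M I' (\<lambda>_. lborel))"
  proof (rule nn_integral_cong)
    fix x assume x: "x \<in> space (Pi\<^sub>M I' (\<lambda>_. lborel :: real measure))"
    have "(\<lambda>y. f (x(i := y))) \<in> borel_measurable lborel"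
      using measurable_comp[OF measurable_component_update[OF x I'(2)] f'] by (simp add: comp_def)
    then show "(\<integral>\<^sup>+ y. f (x(i := y + a * x j)) \<partial>lborel) = (\<integral>\<^sup>+ y. f (x(i := y)) \<partial>lborel)"
      by (subst (2) nn_integral_real_affine[where c = 1 and t = "a * x j"]) (simp_all add: add.commute)
  qed
  also have "\<dots> = (\<integral>\<^sup>+ x. f x \<partial>Pi\<^sub>M (insert i I') (\<lambda>_. lborel))"
    by (rule product_nn_integral_insert[OF I'(1,2) f', symmetric])
  finally show ?thesis by (simp add: I'(3))
qed

text \<open>A plane rotation is a product of three shears.\<close>
lemma PiM_lborel_rotation:
  fixes f :: "('i \<Rightarrow> real) \<Rightarrow> ennreal"
  assumes I: "finite I" "i \<in> I" "j \<in> I" "i \<noteq> j" and cs: "c\<^sup>2 + s\<^sup>2 = 1" "s \<noteq> 0"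
    and f[measurable]: "f \<in> borel_measurable (Pi\<^sub>M I (\<lambda>_. lborel))"
  shows "(\<integral>\<^sup>+ x. f (x(i := c * x i - s * x j, j := s * x i + c * x j)) \<partial>Pi\<^sub>M I (\<lambda>_. lborel)) =
    (\<integral>\<^sup>+ x. f x \<partial>Pi\<^sub>M I (\<lambda>_. lborel))"
proof -
  \<comment> \<open>Minus the tangent of half the rotation angle, as in the factorisation into the
    shears \<open>t\<close>, \<open>s\<close>, \<open>t\<close>.\<close>
  define t where "t = (c - 1) / s"
  define S where "S k l a x = x(k := x k + a * x l)" for k l :: 'i and a :: real and x :: "'i \<Rightarrow> real"
  have st: "1 + t * s = c" "t * (1 + c) = - s"
    using cs by (auto simp: t_def field_simps power2_eq_square)
  have "S i j t (S j i s (S i j t x)) = x(i := c * x i - s * x j, j := s * x i + c * x j)" for x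
  proof
    fix k
    have "x i + t * x j + t * (x j + s * (x i + t * x j)) = (1 + t * s) * x i + t * (1 + (1 + t * s)) * x j"
      by (simp add: algebra_simps)
    moreover have "x j + s * (x i + t * x j) = s * x i + (1 + t * s) * x j"
      by (simp add: algebra_simps)
    ultimately show "S i j t (S j i s (S i j t x)) k = (x(i := c * x i - s * x j, j := s * x i + c * x j)) k"
      using I by (auto simp: S_def st)
  qed
  moreover have S: "S k l a \<in> Pi\<^sub>M I (\<lambda>_. lborel) \<rightarrow>\<^sub>M Pi\<^sub>M I (\<lambda>_. lborel)"
    if "k \<in> I" "l \<in> I" for k l a
    unfolding S_def using that by (intro measurable_shear) auto
  have "(\<lambda>x. f (S i j t x)) \<in> borel_measurable (Pi\<^sub>M I (\<lambda>_. lborel))"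
    by (rule measurable_compose[OF S f]) (use I in auto)
  moreover from this have "(\<lambda>x. f (S i j t (S j i s x))) \<in> borel_measurable (Pi\<^sub>M I (\<lambda>_. lborel))"
    by (rule measurable_compose[OF S, rotated 2]) (use I in auto)
  ultimately show ?thesis
    using PiM_lborel_shear[OF I(1,2,3,4), of "\<lambda>x. f (S i j t (S j i s x))" t]
      PiM_lborel_shear[OF I(1,3,2) I(4)[symmetric], of "\<lambda>x. f (S i j t x)" s]
      PiM_lborel_shear[OF I(1,2,3,4), of f t]
    by (simp add: S_def)
qed

text \<open>
  The coordinates of \<open>c\<close> other than the one at \<open>z\<close> are rotated away one by one, each in the plane
  that it spans with \<open>z\<close>.
\<close>
lemma PiM_lborel_linear_form:
  fixes G :: "real \<Rightarrow> real \<Rightarrow> ennreal" and c :: "'i \<Rightarrow> real"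
  assumes I: "finite I" "z \<in> I"
    and G: "(\<lambda>(a, b). G a b) \<in> borel_measurable borel" and even: "\<And>a b. G (- a) b = G a b"
  shows "(\<integral>\<^sup>+ x. G (\<Sum>i\<in>I. c i * x i) (\<Sum>i\<in>I. (x i)\<^sup>2) \<partial>Pi\<^sub>M I (\<lambda>_. lborel)) =
    (\<integral>\<^sup>+ x. G (sqrt (\<Sum>i\<in>I. (c i)\<^sup>2) * x z) (\<Sum>i\<in>I. (x i)\<^sup>2) \<partial>Pi\<^sub>M I (\<lambda>_. lborel))"
proof -
  \<comment> \<open>\<open>N\<close> contains all coordinates other than \<open>z\<close> at which
    \<open>c\<close> may be nonzero, so the induction removes one of them at a time.\<close>
  have "finite N \<Longrightarrow> N \<subseteq> I - {z} \<Longrightarrow> (\<forall>i\<in>I - {z} - N. c i = 0) \<Longrightarrow> ?thesis" for N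
  proof (induction N arbitrary: c rule: finite_induct)
    case empty
    then have c0: "c i = 0" if "i \<in> I - {z}" for i
      using that by auto
    have "(\<Sum>i\<in>I. c i * x i) = c z * x z" for x :: "'i \<Rightarrow> real"
      using I c0 by (subst sum.remove[of _ z]) auto
    moreover have "sqrt (\<Sum>i\<in>I. (c i)\<^sup>2) = \<bar>c z\<bar>"
      using I c0 by (subst sum.remove[of _ z]) auto
    \<comment> \<open>Evenness of \<open>G\<close> absorbs the sign of the remaining
      coefficient.\<close>
    moreover have "G (\<bar>c z\<bar> * x) b = G (c z * x) b" for x b
      using even[of "c z * x" b] by (auto simp: abs_if)
    ultimately show ?case by simp
  next
    case (insert k N)
    then have k: "k \<in> I" "k \<noteq> z" by auto
    show ?case
    proof (cases "c k = 0")
      case True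
      then show ?thesis using insert by (intro insert.IH) auto
    next
      case False
      define r where "r = sqrt ((c z)\<^sup>2 + (c k)\<^sup>2)"
      have r2: "r\<^sup>2 = (c z)\<^sup>2 + (c k)\<^sup>2" by (simp add: r_def)
      have r: "0 < r" using False by (simp add: r_def add_nonneg_pos)
      \<comment> \<open>Composition with \<open>T\<close> replaces the coefficients
        \<open>(c z, c k)\<close> of the linear form by \<open>(r, 0)\<close> and preserves the sum
        of squares.\<close>
      define T where "T x = x(z := c z / r * x z - c k / r * x k, k := c k / r * x z + c z / r * x k)" for x
      have cs: "(c z / r)\<^sup>2 + (c k / r)\<^sup>2 = 1"
        using r by (simp add: power_divide r2[symmetric] flip: add_divide_distrib)
      define F where "F x = G (\<Sum>i\<in>I. c i * x i) (\<Sum>i\<in>I. (x i)\<^sup>2)" for x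
      define c' where "c' = c(z := r, k := 0)"
      have split: "(\<Sum>i\<in>I. g i) = g z + g k + (\<Sum>i\<in>I - {z} - {k}. g i)" for g :: "'i \<Rightarrow> real"
        using I k by (simp add: sum.remove[of I z] sum.remove[of "I - {z}" k] add.assoc)
      have rest: "(\<Sum>i\<in>I - {z} - {k}. g (T x i) i) = (\<Sum>i\<in>I - {z} - {k}. g (x i) i)"
        for g :: "real \<Rightarrow> 'i \<Rightarrow> real" and x
        by (intro sum.cong) (auto simp: T_def)
      have lin: "(\<Sum>i\<in>I. c i * T x i) = (\<Sum>i\<in>I. c' i * x i)" for x
      proof -
        have "c z * (c z / r * x z - c k / r * x k) + c k * (c k / r * x z + c z / r * x k) =
            ((c z)\<^sup>2 + (c k)\<^sup>2) / r * x z"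
          by (simp add: algebra_simps power2_eq_square add_divide_distrib)
        also have "\<dots> = r * x z"
          using r unfolding r2[symmetric] by (simp add: power2_eq_square)
        finally have "c z * T x z + c k * T x k = r * x z"
          using k by (simp add: T_def)
        moreover have "(\<Sum>i\<in>I - {z} - {k}. c i * x i) = (\<Sum>i\<in>I - {z} - {k}. c' i * x i)"
          by (intro sum.cong) (auto simp: c'_def)
        ultimately show ?thesis
          unfolding split[of "\<lambda>i. c i * T x i"] split[of "\<lambda>i. c' i * x i"]
          using rest[of "\<lambda>t i. c i * t"] k by (simp add: c'_def)
      qed
      have sq: "(\<Sum>i\<in>I. (T x i)\<^sup>2) = (\<Sum>i\<in>I. (x i)\<^sup>2)" for x
      proof -
        have "(c z / r * x z - c k / r * x k)\<^sup>2 + (c k / r * x z + c z / r * x k)\<^sup>2 =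
            ((c z / r)\<^sup>2 + (c k / r)\<^sup>2) * ((x z)\<^sup>2 + (x k)\<^sup>2)"
          by (simp add: power2_eq_square algebra_simps)
        then have "(T x z)\<^sup>2 + (T x k)\<^sup>2 = (x z)\<^sup>2 + (x k)\<^sup>2"
          using k by (simp add: T_def cs)
        then show ?thesis
          unfolding split[of "\<lambda>i. (T x i)\<^sup>2"] split[of "\<lambda>i. (x i)\<^sup>2"] using rest[of "\<lambda>t i. t\<^sup>2"] by simp
      qed
      have c'sq: "(\<Sum>i\<in>I. (c' i)\<^sup>2) = (\<Sum>i\<in>I. (c i)\<^sup>2)"
      proof -
        have "(\<Sum>i\<in>I - {z} - {k}. (c' i)\<^sup>2) = (\<Sum>i\<in>I - {z} - {k}. (c i)\<^sup>2)"
          by (intro sum.cong) (auto simp: c'_def)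
        then show ?thesis
          unfolding split[of "\<lambda>i. (c' i)\<^sup>2"] split[of "\<lambda>i. (c i)\<^sup>2"] using k by (simp add: c'_def r2)
      qed
      have [measurable]: "F \<in> borel_measurable (Pi\<^sub>M I (\<lambda>_. lborel))"
      proof -
        have "(\<lambda>x. (\<Sum>i\<in>I. c i * x i, \<Sum>i\<in>I. (x i)\<^sup>2)) \<in> Pi\<^sub>M I (\<lambda>_. lborel) \<rightarrow>\<^sub>M borel"
          unfolding borel_prod[symmetric] by measurable
        from measurable_compose[OF this G] show ?thesis by (simp add: F_def[abs_def])
      qed
      have "(\<integral>\<^sup>+ x. F x \<partial>Pi\<^sub>M I (\<lambda>_. lborel)) = (\<integral>\<^sup>+ x. F (T x) \<partial>Pi\<^sub>M I (\<lambda>_. lborel))"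
        unfolding T_def using I k False r cs by (intro PiM_lborel_rotation[symmetric]) auto
      also have "\<dots> = (\<integral>\<^sup>+ x. G (\<Sum>i\<in>I. c' i * x i) (\<Sum>i\<in>I. (x i)\<^sup>2) \<partial>Pi\<^sub>M I (\<lambda>_. lborel))"
        unfolding F_def lin sq ..
      also have "\<dots> = (\<integral>\<^sup>+ x. G (sqrt (\<Sum>i\<in>I. (c' i)\<^sup>2) * x z) (\<Sum>i\<in>I. (x i)\<^sup>2) \<partial>Pi\<^sub>M I (\<lambda>_. lborel))"
        using insert.prems by (intro insert.IH) (auto simp: c'_def)
      finally show ?thesis unfolding F_def c'sq .
    qed
  qed
  from this[of "I - {z}"] show ?thesis using I by auto
qed

lemma emeasure_cball_PiM_lborel:
  assumes "finite I" "I \<noteq> {}"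
  shows "emeasure (Pi\<^sub>M I (\<lambda>_. lborel)) {x \<in> space (Pi\<^sub>M I (\<lambda>_. lborel)). (\<Sum>i\<in>I. (x i)\<^sup>2) \<le> R} =
    ennreal (unit_ball_vol (real (card I)) * sqrt (max 0 R) ^ card I)"
proof -
  interpret product_sigma_finite "\<lambda>_::'a. lborel :: real measure" by standard
  let ?S = "{x \<in> space (Pi\<^sub>M I (\<lambda>_. lborel)). (\<Sum>i\<in>I. (x i)\<^sup>2) \<le> R}"
  show ?thesis
  proof (cases "0 < R")
    case True
    then have "?S = {f. sqrt (\<Sum>i\<in>I. (f i)\<^sup>2) \<le> sqrt R} \<inter> space (Pi\<^sub>M I (\<lambda>_. lborel))"
      by auto
    then show ?thesis
      using emeasure_cball_aux[OF assms(1), of "sqrt R"] True by simp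
  next
    case False
    \<comment> \<open>For \<open>R \<le> 0\<close> at most the origin is left, a null set because
      \<open>I\<close> is nonempty.\<close>
    have "?S \<subseteq> Pi\<^sub>E I (\<lambda>_. {0})"
    proof
      fix x assume x: "x \<in> ?S"
      then have "(\<Sum>i\<in>I. (x i)\<^sup>2) \<le> 0" using False by auto
      then have "(\<Sum>i\<in>I. (x i)\<^sup>2) = 0" by (meson antisym sum_nonneg zero_le_power2)
      then have "\<forall>i\<in>I. x i = 0"
        using assms by (subst (asm) sum_nonneg_eq_0_iff) auto
      then show "x \<in> Pi\<^sub>E I (\<lambda>_. {0})"
        using x unfolding PiE_iff by (simp add: space_PiM PiE_def)
    qed
    then have "emeasure (Pi\<^sub>M I (\<lambda>_. lborel)) ?S \<le> emeasure (Pi\<^sub>M I (\<lambda>_. lborel)) (Pi\<^sub>E I (\<lambda>_. {0::real}))"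
      by (rule emeasure_mono) (rule sets_PiM_I_finite, use assms in auto)
    also have "\<dots> = 0"
      using assms by (subst emeasure_PiM) (auto simp: prod_zero_iff)
    finally show ?thesis using False assms by (simp add: max_def power_0_left card_gt_0_iff)
  qed
qed

lemma nn_integral_even_extension:
  fixes f :: "real \<Rightarrow> real"
  assumes f: "(f has_integral I) {0..1}" and nonneg: "\<And>t. t \<in> {0..1} \<Longrightarrow> 0 \<le> f t"
  shows "(\<integral>\<^sup>+ t. ennreal (f \<bar>t\<bar>) * indicator {-1..1} t \<partial>lborel) = ennreal (2 * I)"
proof (rule nn_integral_has_integral_lebesgue')
  have "((\<lambda>t. f \<bar>t\<bar>) has_integral I) {0..1}"
    using f by (rule has_integral_eq[rotated]) auto
  moreover have "((\<lambda>t. f (- t)) has_integral I) {-1..-0}"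
    using f by (subst has_integral_reflect_real) auto
  then have "((\<lambda>t. f (- t)) has_integral I) {-1..0}" by simp
  then have "((\<lambda>t. f \<bar>t\<bar>) has_integral I) {-1..0}"
    by (rule has_integral_eq[rotated]) auto
  ultimately show "((\<lambda>t. f \<bar>t\<bar>) has_integral 2 * I) {-1..1}"
    using has_integral_combine[of "-1" 0 1] by fastforce
qed (use nonneg in auto)

section \<open>Measurability of the profile and planar geometry of midpoints\<close>

context convex_profile
begin

text \<open>Nothing is assumed about \<open>h\<close> outside the unit interval. Clamping the
  argument makes the function monotone on the whole line, hence Borel.\<close>

lemma h_borel: "(\<lambda>t. h (max 0 (min 1 t))) \<in> borel_measurable borel"
proof -
  have "mono (\<lambda>t. - h (max 0 (min 1 t)))"
    using monotone_onD[OF h_antimono] by (intro monoI) (simp add: le_max_iff_disj min_def max_def)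
  then have "(\<lambda>t. - (- h (max 0 (min 1 t)))) \<in> borel_measurable borel"
    by (intro borel_measurable_uminus borel_measurable_mono)
  then show ?thesis by simp
qed

text \<open>
  In the half-plane with coordinates \<open>(X, W)\<close>, the points \<open>(0, J 0)\<close> and \<open>(M + a, W)\<close> have gauge at
  most 1, and \<open>(M, W)\<close> is a combination of them with coefficient sum at most the height, relative to
  \<open>J 0\<close>, of their connecting segment over \<open>a\<close>.
\<close>
lemma midpoint_bound:
  assumes W: "0 < W" "W \<le> J ((M + a) / W)" and M: "0 \<le> M" and a: "y * J y \<le> a"
    and y: "0 < y" "y < y'" "y * J y < y' * J y'"
  shows "W / J (M / W) \<le> J y / J 0"
proof -
  define C where "C x = 1 / J x" for x
  have C_pos: "0 < C x" for x using J_pos by (simp add: C_def)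
  have C_convex: "C (u * x + v * z) \<le> u * C x + v * C z"
    if "0 \<le> u" "0 \<le> v" "u + v = 1" "0 \<le> x" "0 \<le> z" for u v x z
    using J_convex that unfolding convex_on_def C_def by auto
  define e where "e = y * J y"
  have e: "0 < e" "e \<le> a" using y a J_pos[of y] by (auto simp: e_def)
  define Z where "Z = (M + a) / W"
  have Ma: "0 < M + a" using M e by simp
  have Z: "0 < Z" using Ma W by (simp add: Z_def)
  define b where "b = W * C 0"
  have b: "0 < b" "b \<le> 1"
    using W C_pos[of 0] J_le_J_zero[of Z] J_pos[of 0] by (auto simp: b_def C_def Z_def)
  have WCZ: "W * C Z \<le> 1"
    using W J_pos[of Z] by (simp add: C_def Z_def)
  have step1: "W * C (M / W) \<le> 1 - (1 - b) * a / (M + a)"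
  proof -
    have "C (M / (M + a) * Z + a / (M + a) * 0) \<le> M / (M + a) * C Z + a / (M + a) * C 0"
      using M e Ma Z by (intro C_convex) (auto simp flip: add_divide_distrib)
    moreover have "M / (M + a) * Z + a / (M + a) * 0 = M / W"
      using Ma by (simp add: Z_def)
    ultimately have "W * C (M / W) \<le> W * (M / (M + a) * C Z + a / (M + a) * C 0)"
      using W by (intro mult_left_mono) auto
    also have "\<dots> = M / (M + a) * (W * C Z) + a / (M + a) * b"
      by (simp add: b_def algebra_simps)
    also have "\<dots> \<le> M / (M + a) * 1 + a / (M + a) * b"
      using WCZ M Ma e by (intro add_mono mult_left_mono) auto
    also have "\<dots> = 1 - (1 - b) * a / (M + a)"
    proof -
      have "M / (M + a) = 1 - a / (M + a)"
        using Ma by (simp add: field_simps)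
      then show ?thesis by (simp add: algebra_simps diff_divide_distrib)
    qed
    finally show ?thesis .
  qed
  \<comment> \<open>\<open>e \<le> a\<close> weakens the bound to abscissa \<open>e\<close>, where
    the height of the boundary is known to be \<open>J y\<close>.\<close>
  define r where "r = 1 - (1 - b) * e / (M + a)"
  have "(1 - b) * e / (M + a) \<le> (1 - b) * a / (M + a)"
    using b e Ma by (intro divide_right_mono mult_left_mono) auto
  with step1 have step2: "W * C (M / W) \<le> r" by (simp add: r_def)
  have r_Ma: "r * (M + a) = M + a - (1 - b) * e"
    using Ma by (simp add: r_def field_simps)
  have "(1 - b) * e < 1 * e"
    using b e by (intro mult_strict_right_mono) auto
  then have "0 < r * (M + a)" using r_Ma M e by linarith
  then have r: "0 < r" using Ma zero_less_mult_pos2 by blast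
  \<comment> \<open>The height over \<open>e\<close> of the segment from \<open>(0, J 0)\<close> to
    \<open>(M + a, W)\<close>. It remains to see that it does not exceed \<open>J y\<close>.\<close>
  define H where "H = J 0 * r"
  have H: "0 < H" using r J_pos[of 0] by (simp add: H_def)
  define x where "x = e / H"
  have x: "0 < x" using e H by (simp add: x_def)
  have "C x \<le> 1 / H"
  proof -
    define \<mu> where "\<mu> = x / Z"
    have W_eq: "W = b * J 0" using J_pos[of 0] by (simp add: b_def C_def)
    have \<mu>_eq: "\<mu> = e * b / (r * (M + a))"
      using J_pos[of 0] unfolding \<mu>_def x_def Z_def H_def W_eq by simp
    have "e * b \<le> r * (M + a)"
      unfolding r_Ma using M e by (simp add: algebra_simps)
    then have \<mu>: "0 \<le> \<mu>" "\<mu> \<le> 1"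
      using \<mu>_eq r Ma e b by auto
    have "C ((1 - \<mu>) * 0 + \<mu> * Z) \<le> (1 - \<mu>) * C 0 + \<mu> * C Z"
      using \<mu> Z by (intro C_convex) auto
    moreover have "(1 - \<mu>) * 0 + \<mu> * Z = x"
      using Z by (simp add: \<mu>_def)
    ultimately have "C x \<le> (1 - \<mu>) * C 0 + \<mu> * C Z" by simp
    also have "\<dots> \<le> (1 - \<mu>) * C 0 + \<mu> * (C 0 / b)"
    proof -
      have "C Z \<le> C 0 / b"
        using WCZ W C_pos[of 0] by (simp add: b_def field_simps)
      then show ?thesis using \<mu> by (intro add_left_mono mult_left_mono) auto
    qed
    also have "\<dots> = C 0 * (1 + \<mu> * (1 - b) / b)"
      using b by (simp add: field_simps)
    also have "\<mu> * (1 - b) / b = (1 - r) / r"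
      using b r Ma by (simp add: \<mu>_eq r_def mult.commute)
    also have "C 0 * (1 + (1 - r) / r) = 1 / H"
      using r J_pos[of 0] by (simp add: C_def H_def field_simps)
    finally show ?thesis .
  qed
  have "H \<le> J y"
  proof (rule ccontr)
    assume "\<not> H \<le> J y"
    then have "y * J y < y * H" using y(1) by simp
    then have "x < y"
      using H by (simp add: x_def e_def pos_divide_less_eq)
    \<comment> \<open>The convex function \<open>C\<close> lies on or below the line through the origin and \<open>(y, C y)\<close> at \<open>x\<close>, and
      strictly below it at \<open>y'\<close>.\<close>
    define \<nu> where "\<nu> = (y - x) / (y' - x)"
    have \<nu>: "0 < \<nu>" "\<nu> \<le> 1" using \<open>x < y\<close> y by (auto simp: \<nu>_def)
    have "\<nu> * (y' - x) = y - x"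
      using \<open>x < y\<close> y by (simp add: \<nu>_def)
    then have y_eq: "(1 - \<nu>) * x + \<nu> * y' = y"
      by (simp add: algebra_simps)
    have "C ((1 - \<nu>) * x + \<nu> * y') \<le> (1 - \<nu>) * C x + \<nu> * C y'"
      using \<nu> x y by (intro C_convex) auto
    also have "\<dots> < (1 - \<nu>) * (x / e) + \<nu> * (y' / e)"
    proof (rule add_le_less_mono)
      show "(1 - \<nu>) * C x \<le> (1 - \<nu>) * (x / e)"
        using \<open>C x \<le> 1 / H\<close> \<nu> e by (intro mult_left_mono) (auto simp: x_def)
      show "\<nu> * C y' < \<nu> * (y' / e)"
        using y(3) J_pos[of y'] e \<nu> by (intro mult_strict_left_mono) (auto simp: C_def e_def[symmetric] field_simps)
    qed
    also have "\<dots> = ((1 - \<nu>) * x + \<nu> * y') / e"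
      by (simp add: add_divide_distrib)
    finally have "C y < y / e" unfolding y_eq .
    then show False using y(1) J_pos[of y] by (simp add: C_def e_def)
  qed
  then have "r \<le> J y / J 0"
    using J_pos[of 0] by (simp add: H_def field_simps)
  with step2 show ?thesis by (simp add: C_def)
qed

end

section \<open>Section volumes in terms of \<open>J\<close>\<close>

definition axis_dist :: "nat \<Rightarrow> (nat \<Rightarrow> real) \<Rightarrow> real"
  where "axis_dist n x = sqrt (\<Sum>i\<in>{1..<n}. (x i)\<^sup>2)"

locale revolution_profile = convex_profile +
  fixes n :: nat and A B :: real and K :: "(nat \<Rightarrow> real) set"
  assumes n_eq: "n = m + 2" and A_pos: "0 < A" and B_pos: "0 < B"
    and K_iff: "\<And>x. x \<in> K \<longleftrightarrow> x \<in> Rn n \<and> \<bar>x 0\<bar> \<le> A \<and> axis_dist n x \<le> B * h (\<bar>x 0\<bar> / A)"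
begin

definition D :: real
  where "D = 2 * unit_ball_vol (real m) * A * B ^ m"

text \<open>The volume of the equatorial section, an \<open>(m + 1)\<close>-dimensional ball of
  radius \<open>B\<close>; hence the radius of the intersection body along the axis.\<close>

definition L :: real
  where "L = D * beta_half m * (B / A)"

lemma D_pos: "0 < D"
  using A_pos B_pos by (simp add: D_def)

lemma L_pos: "0 < L"
  using D_pos A_pos B_pos beta_half_pos[OF m_ge_2] by (simp add: L_def)

lemma sum_split_axis: "(\<Sum>i<n. g i) = g 0 + (\<Sum>i\<in>{1..<n}. g i)" for g :: "nat \<Rightarrow> real"
proof -
  have "{..<n} = insert 0 {1..<n}" using n_eq by auto
  then show ?thesis by simp
qed

text \<open>In basis coordinates the axial coordinate is a linear form with coefficient norm
  \<open>\<sigma>\<close>. A rotation makes it \<open>\<sigma> * t\<close> with \<open>t\<close> a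
  single coordinate, and Fubini leaves an \<open>m\<close>-dimensional ball for each
  \<open>t\<close>.\<close>

lemma section_emeasure:
  assumes u: "u \<in> unit_sphere n" and b: "orthonormal_basis_of_perp n u b"
    and \<sigma>: "\<sigma> = sqrt (1 - (u 0)\<^sup>2)"
  shows "emeasure (\<Pi>\<^sub>M j\<in>{..<n-1}. lborel)
      {y \<in> {..<n-1} \<rightarrow>\<^sub>E UNIV. (\<lambda>i. \<Sum>j<n-1. y j * b j i) \<in> hyperplane_section n K u} =
    (\<integral>\<^sup>+ t. ennreal (unit_ball_vol (real m) *
        sqrt (max 0 ((B * h (max 0 (min 1 (\<bar>\<sigma> * t\<bar> / A))))\<^sup>2 - (u 0 * t)\<^sup>2)) ^ m) *
      indicator {t. \<bar>\<sigma> * t\<bar> \<le> A} t \<partial>lborel)"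
    (is "emeasure ?M ?S = _")
    and "(\<lambda>t. ennreal (unit_ball_vol (real m) *
        sqrt (max 0 ((B * h (max 0 (min 1 (\<bar>\<sigma> * t\<bar> / A))))\<^sup>2 - (u 0 * t)\<^sup>2)) ^ m) *
      indicator {t. \<bar>\<sigma> * t\<bar> \<le> A} t) \<in> borel_measurable borel"
proof -
  interpret product_sigma_finite "\<lambda>_::nat. lborel :: real measure" by standard
  note [measurable] = h_borel
  define F where "F a = (B * h (max 0 (min 1 (\<bar>a\<bar> / A))))\<^sup>2" for a
  have F[measurable]: "F \<in> borel_measurable borel"
  proof -
    have "(\<lambda>a. h (max 0 (min 1 (\<bar>a\<bar> / A)))) \<in> borel_measurable borel"
      by (rule measurable_compose[OF _ h_borel]) measurable
    then show ?thesis unfolding F_def[abs_def] by measurable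
  qed
  \<comment> \<open>Membership in the section depends only on the axial coordinate \<open>a\<close>
    and the squared length \<open>r\<close>.\<close>
  define Q where "Q = {(a, r). \<bar>a\<bar> \<le> A \<and> r - a\<^sup>2 \<le> F a}"
  have Q[measurable]: "Q \<in> sets borel"
  proof -
    have "{z \<in> space (borel \<Otimes>\<^sub>M borel). \<bar>fst z\<bar> \<le> A \<and> snd z - (fst z)\<^sup>2 \<le> F (fst z)} \<in> sets (borel \<Otimes>\<^sub>M borel)"
      by measurable
    moreover have "{z \<in> space (borel \<Otimes>\<^sub>M borel). \<bar>fst z\<bar> \<le> A \<and> snd z - (fst z)\<^sup>2 \<le> F (fst z)} = Q"
      by (auto simp: Q_def space_pair_measure)
    ultimately show ?thesis by (subst borel_prod[symmetric]) simp
  qed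
  define G :: "real \<Rightarrow> real \<Rightarrow> ennreal" where "G a r = indicator Q (a, r)" for a r
  have G: "(\<lambda>(a, r). G a r) \<in> borel_measurable borel"
  proof -
    have "indicator Q \<in> borel_measurable borel" using Q by (rule borel_measurable_indicator)
    moreover have "(\<lambda>(a, r). G a r) = indicator Q" by (auto simp: G_def)
    ultimately show ?thesis by simp
  qed
  have G_even: "G (- a) r = G a r" for a r
    by (simp add: G_def Q_def F_def indicator_def)
  let ?I = "{..<n-1}"
  define c where "c j = b j 0" for j
  have bR: "b j i = 0" if "j < n - 1" "n \<le> i" for i j
    using b that by (auto simp: orthonormal_basis_of_perp_def topspace_Euclidean_space)
  have bon: "dot n (b j) (b k) = (if j = k then 1 else 0)" if "j < n - 1" "k < n - 1" for j k
    using b that unfolding orthonormal_basis_of_perp_def by blast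
  have bu: "dot n (b j) u = 0" if "j < n - 1" for j
    using b that unfolding orthonormal_basis_of_perp_def by blast
  have meas: "(\<lambda>y. (\<Sum>j\<in>?I. c j * y j, \<Sum>j\<in>?I. (y j)\<^sup>2)) \<in> ?M \<rightarrow>\<^sub>M borel"
    unfolding borel_prod[symmetric] by measurable
  have S_iff: "y \<in> ?S \<longleftrightarrow> y \<in> space ?M \<and> (\<Sum>j\<in>?I. c j * y j, \<Sum>j\<in>?I. (y j)\<^sup>2) \<in> Q" for y
  proof -
    define x where "x = (\<lambda>i. \<Sum>j<n-1. y j * b j i)"
    have "x \<in> Rn n"
      using bR by (simp add: x_def topspace_Euclidean_space)
    moreover have "dot n x u = 0"
    proof -
      have "dot n x u = (\<Sum>i<n. \<Sum>j<n-1. y j * (b j i * u i))"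
        by (simp add: dot_def x_def sum_distrib_right mult.assoc)
      also have "\<dots> = (\<Sum>j<n-1. y j * dot n (b j) u)"
        by (subst sum.swap) (simp add: dot_def sum_distrib_left)
      finally show ?thesis by (simp add: bu)
    qed
    moreover have x0: "x 0 = (\<Sum>j\<in>?I. c j * y j)"
      by (simp add: x_def c_def mult.commute)
    moreover have "(\<Sum>i\<in>{1..<n}. (x i)\<^sup>2) = (\<Sum>j\<in>?I. (y j)\<^sup>2) - (x 0)\<^sup>2"
      using sum_squares_orthonormal_combination[OF bon, of "n - 1" y] sum_split_axis[of "\<lambda>i. (x i)\<^sup>2"]
      by (simp add: x_def)
    moreover have "axis_dist n x \<le> B * h (\<bar>x 0\<bar> / A) \<longleftrightarrow> (\<Sum>i\<in>{1..<n}. (x i)\<^sup>2) \<le> F (x 0)"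
      if "\<bar>x 0\<bar> \<le> A"
    proof -
      have "max 0 (min 1 (\<bar>x 0\<bar> / A)) = \<bar>x 0\<bar> / A"
        using that A_pos by simp
      moreover have "0 \<le> B * h (\<bar>x 0\<bar> / A)"
        using that A_pos B_pos by (intro mult_nonneg_nonneg h_nonneg) auto
      ultimately show ?thesis
        by (simp add: axis_dist_def F_def real_sqrt_le_iff' sum_nonneg)
    qed
    ultimately have "x \<in> hyperplane_section n K u \<longleftrightarrow> (\<Sum>j\<in>?I. c j * y j, \<Sum>j\<in>?I. (y j)\<^sup>2) \<in> Q"
      by (auto simp: hyperplane_section_def K_iff Q_def)
    then show ?thesis
      by (simp add: x_def space_PiM)
  qed
  have S_eq: "?S = (\<lambda>y. (\<Sum>j\<in>?I. c j * y j, \<Sum>j\<in>?I. (y j)\<^sup>2)) -` Q \<inter> space ?M"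
    using S_iff by blast
  have S_sets: "?S \<in> sets ?M"
    unfolding S_eq using meas Q by (rule measurable_sets)
  have \<sigma>_eq: "sqrt (\<Sum>j\<in>?I. (c j)\<^sup>2) = \<sigma>"
    unfolding c_def \<sigma> using orthonormal_basis_of_perp_column[OF b u, of 0] n_eq by simp
  have u0: "(u 0)\<^sup>2 \<le> 1"
  proof -
    have "(u 0)\<^sup>2 = 1 - (\<Sum>j<n-1. (b j 0)\<^sup>2)"
      using orthonormal_basis_of_perp_column[OF b u, of 0] n_eq by simp
    then show ?thesis by (simp add: sum_nonneg)
  qed
  have \<sigma>2: "\<sigma>\<^sup>2 = 1 - (u 0)\<^sup>2" using u0 by (simp add: \<sigma>)
  define I' where "I' = {1..<n-1}"
  have I': "finite I'" "0 \<notin> I'" "insert 0 I' = ?I" "I' \<noteq> {}" "card I' = m"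
    using n_eq m_ge_2 by (auto simp: I'_def)
  define f where "f = (\<lambda>y::nat\<Rightarrow>real. G (\<sigma> * y 0) (\<Sum>j\<in>?I. (y j)\<^sup>2))"
  have "(\<lambda>y. (\<sigma> * y 0, \<Sum>j\<in>?I. (y j)\<^sup>2)) \<in> ?M \<rightarrow>\<^sub>M borel"
    unfolding borel_prod[symmetric] by measurable (use n_eq m_ge_2 in auto)
  from measurable_compose[OF this G] have f: "f \<in> borel_measurable (Pi\<^sub>M (insert 0 I') (\<lambda>_. lborel))"
    by (simp add: f_def I')
  define W where "W t = ennreal (unit_ball_vol (real m) * sqrt (max 0 (F (\<sigma> * t) - (u 0 * t)\<^sup>2)) ^ m) *
      indicator {t. \<bar>\<sigma> * t\<bar> \<le> A} t" for t
  have inner: "(\<integral>\<^sup>+ x. f (x(0 := t)) \<partial>Pi\<^sub>M I' (\<lambda>_. lborel)) = W t" for t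
  proof -
    have sums: "(\<Sum>j\<in>?I. ((x(0 := t)) j)\<^sup>2) = t\<^sup>2 + (\<Sum>j\<in>I'. (x j)\<^sup>2)" for x
    proof -
      have "(\<Sum>j\<in>I'. ((x(0 := t)) j)\<^sup>2) = (\<Sum>j\<in>I'. (x j)\<^sup>2)"
        using I' by (intro sum.cong) auto
      then show ?thesis unfolding I'(3)[symmetric] using I'(1,2) by simp
    qed
    \<comment> \<open>As \<open>\<sigma>\<^sup>2 = 1 - (u 0)\<^sup>2\<close>, removing the squared
      axial coordinate from \<open>t\<^sup>2\<close> leaves
      \<open>(u 0 * t)\<^sup>2\<close>.\<close>
    define R where "R = F (\<sigma> * t) - (u 0 * t)\<^sup>2"
    have R: "t\<^sup>2 + s - (\<sigma> * t)\<^sup>2 \<le> F (\<sigma> * t) \<longleftrightarrow> s \<le> R" for s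
      by (auto simp: R_def power_mult_distrib \<sigma>2 algebra_simps)
    show ?thesis
    proof (cases "\<bar>\<sigma> * t\<bar> \<le> A")
      case True
      have "(\<integral>\<^sup>+ x. f (x(0 := t)) \<partial>Pi\<^sub>M I' (\<lambda>_. lborel)) =
          (\<integral>\<^sup>+ x. indicator {x \<in> space (Pi\<^sub>M I' (\<lambda>_. lborel)). (\<Sum>i\<in>I'. (x i)\<^sup>2) \<le> R} x \<partial>Pi\<^sub>M I' (\<lambda>_. lborel))"
        using True by (intro nn_integral_cong, unfold f_def sums) (simp add: G_def Q_def R indicator_def)
      also have "\<dots> = emeasure (Pi\<^sub>M I' (\<lambda>_. lborel)) {x \<in> space (Pi\<^sub>M I' (\<lambda>_. lborel)). (\<Sum>i\<in>I'. (x i)\<^sup>2) \<le> R}"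
        by (rule nn_integral_indicator) measurable
      also have "\<dots> = W t"
        using emeasure_cball_PiM_lborel[OF I'(1,4)] True by (simp add: W_def R_def I'(5))
      finally show ?thesis .
    next
      case False
      then show ?thesis by (simp add: f_def G_def Q_def W_def)
    qed
  qed
  have "emeasure ?M ?S = (\<integral>\<^sup>+ y. indicator ?S y \<partial>?M)"
    using S_sets by simp
  also have "\<dots> = (\<integral>\<^sup>+ y. G (\<Sum>j\<in>?I. c j * y j) (\<Sum>j\<in>?I. (y j)\<^sup>2) \<partial>?M)"
    unfolding S_eq by (intro nn_integral_cong) (simp add: G_def indicator_def)
  also have "\<dots> = (\<integral>\<^sup>+ y. f y \<partial>?M)"
    unfolding f_def \<sigma>_eq[symmetric] using n_eq m_ge_2
    by (intro PiM_lborel_linear_form G G_even) auto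
  also have "\<dots> = (\<integral>\<^sup>+ t. (\<integral>\<^sup>+ x. f (x(0 := t)) \<partial>Pi\<^sub>M I' (\<lambda>_. lborel)) \<partial>lborel)"
    using product_nn_integral_insert_rev[OF I'(1,2) f] I'(3) by simp
  also have "\<dots> = (\<integral>\<^sup>+ t. W t \<partial>lborel)"
    by (simp add: inner)
  finally show "emeasure ?M ?S = (\<integral>\<^sup>+ t. ennreal (unit_ball_vol (real m) *
        sqrt (max 0 ((B * h (max 0 (min 1 (\<bar>\<sigma> * t\<bar> / A))))\<^sup>2 - (u 0 * t)\<^sup>2)) ^ m) *
      indicator {t. \<bar>\<sigma> * t\<bar> \<le> A} t \<partial>lborel)"
    by (simp add: W_def F_def)
  have "W \<in> borel_measurable borel"
    unfolding W_def[abs_def] by measurable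
  then show "(\<lambda>t. ennreal (unit_ball_vol (real m) *
        sqrt (max 0 ((B * h (max 0 (min 1 (\<bar>\<sigma> * t\<bar> / A))))\<^sup>2 - (u 0 * t)\<^sup>2)) ^ m) *
      indicator {t. \<bar>\<sigma> * t\<bar> \<le> A} t) \<in> borel_measurable borel"
    by (simp add: W_def[abs_def] F_def)
qed

lemma axis_dist_unit_sphere:
  assumes "u \<in> unit_sphere n"
  shows "axis_dist n u = sqrt (1 - (u 0)\<^sup>2)"
proof -
  have "(u 0)\<^sup>2 + (\<Sum>i\<in>{1..<n}. (u i)\<^sup>2) = 1"
    using assms sum_split_axis[of "\<lambda>i. (u i)\<^sup>2"] by (simp add: unit_sphere_def dot_def power2_eq_square)
  then show ?thesis by (simp add: axis_dist_def algebra_simps)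
qed

text \<open>Rescaling \<open>t\<close> by \<open>A / \<sigma>\<close> turns the slab into
  \<open>[-1, 1]\<close> and the integrand into \<open>\<phi>\<close>. For
  \<open>\<sigma> = 0\<close> the section is a ball of radius \<open>B\<close>, and \<open>t\<close>
  is rescaled by \<open>B\<close>.\<close>

lemma hyperplane_volume_eq:
  assumes u: "u \<in> unit_sphere n"
  shows "hyperplane_volume n u (hyperplane_section n K u) =
    (if axis_dist n u = 0 then L else D / axis_dist n u * J (A / B * \<bar>u 0\<bar> / axis_dist n u))"
proof -
  define b where "b = (SOME b. orthonormal_basis_of_perp n u b)"
  have b: "orthonormal_basis_of_perp n u b"
    unfolding b_def using orthonormal_basis_of_perp_exists[OF u] by (rule someI_ex)
  define \<sigma> where "\<sigma> = axis_dist n u"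
  have \<sigma>: "\<sigma> = sqrt (1 - (u 0)\<^sup>2)" using axis_dist_unit_sphere[OF u] by (simp add: \<sigma>_def)
  have \<sigma>0: "0 \<le> \<sigma>" by (simp add: \<sigma>_def axis_dist_def sum_nonneg)
  define \<omega> where "\<omega> = unit_ball_vol (real m)"
  have \<omega>: "0 < \<omega>" by (simp add: \<omega>_def)
  define W where "W t = ennreal (\<omega> *
        sqrt (max 0 ((B * h (max 0 (min 1 (\<bar>\<sigma> * t\<bar> / A))))\<^sup>2 - (u 0 * t)\<^sup>2)) ^ m) *
      indicator {t. \<bar>\<sigma> * t\<bar> \<le> A} t" for t
  have W_meas: "W \<in> borel_measurable borel"
    using section_emeasure(2)[OF u b \<sigma>] by (simp add: W_def[abs_def] \<omega>_def)
  have V: "hyperplane_volume n u (hyperplane_section n K u) = enn2real (\<integral>\<^sup>+ t. W t \<partial>lborel)"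
    unfolding hyperplane_volume_def Let_def b_def[symmetric] measure_def section_emeasure(1)[OF u b \<sigma>]
    by (simp add: W_def \<omega>_def)
  have scaling: "(\<integral>\<^sup>+ t. W t \<partial>lborel) = ennreal (r * (\<omega> * B ^ m * (2 * I)))"
    if r: "0 < r" and f: "(f has_integral I) {0..1}" "\<And>t. t \<in> {0..1} \<Longrightarrow> 0 \<le> f t"
      and eq: "\<And>t. W (r * t) = ennreal (\<omega> * B ^ m) * (ennreal (f \<bar>t\<bar>) * indicator {-1..1} t)" for r f I
  proof -
    have I: "0 \<le> I" using f by (intro has_integral_nonneg[OF f(1)]) auto
    have "(\<lambda>t. W (r * t)) \<in> borel_measurable borel"
      by (rule measurable_compose[OF _ W_meas]) measurable
    \<comment> \<open>Borel measurability is inherited from \<open>W\<close>, as \<open>f\<close> is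
      controlled only on the unit interval.\<close>
    moreover have "ennreal (f \<bar>t\<bar>) * indicator {-1..1} t = ennreal (inverse (\<omega> * B ^ m)) * W (r * t)" for t
    proof -
      have "0 < \<omega> * B ^ m" using \<omega> B_pos by simp
      moreover have "ennreal (inverse c) * ennreal c = 1" if "0 < c" for c
        using that by (simp flip: ennreal_mult)
      ultimately have "ennreal (inverse (\<omega> * B ^ m)) * ennreal (\<omega> * B ^ m) = 1"
        by blast
      then show ?thesis unfolding eq mult.assoc[symmetric] by simp
    qed
    ultimately have meas: "(\<lambda>t. ennreal (f \<bar>t\<bar>) * indicator {-1..1} t) \<in> borel_measurable lborel"
      by simp
    have "(\<integral>\<^sup>+ t. W t \<partial>lborel) = ennreal r * (\<integral>\<^sup>+ t. W (r * t) \<partial>lborel)"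
      using nn_integral_real_affine[OF W_meas, of r 0] r by simp
    also have "\<dots> = ennreal r * (ennreal (\<omega> * B ^ m) * ennreal (2 * I))"
      using nn_integral_even_extension[OF f] by (simp only: eq nn_integral_cmult[OF meas])
    also have "\<dots> = ennreal (r * (\<omega> * B ^ m * (2 * I)))"
      using r \<omega> B_pos I by (simp add: ennreal_mult)
    finally show ?thesis .
  qed
  show ?thesis
  proof (cases "\<sigma> = 0")
    case True
    have u0: "(u 0)\<^sup>2 = 1" using True \<sigma> by simp
    have "(\<integral>\<^sup>+ t. W t \<partial>lborel) = ennreal (B * (\<omega> * B ^ m * (2 * beta_half m)))"
    proof (rule scaling[OF B_pos])
      show "((\<lambda>s. sqrt (1 - s\<^sup>2) ^ m) has_integral beta_half m) {0..1}"
        unfolding beta_half_def by (rule integrable_integral[OF beta_half_integrable])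
      show "0 \<le> sqrt (1 - t\<^sup>2) ^ m" if "t \<in> {0..1}" for t :: real
        using that by (simp add: abs_square_le_1)
      fix t :: real
      have "W (B * t) = ennreal (\<omega> * sqrt (max 0 (B\<^sup>2 * (1 - t\<^sup>2))) ^ m)"
        using True A_pos by (simp add: W_def h_zero power_mult_distrib u0 algebra_simps)
      also have "max 0 (B\<^sup>2 * (1 - t\<^sup>2)) = B\<^sup>2 * max 0 (1 - t\<^sup>2)"
        using B_pos by (simp add: max_mult_distrib_left)
      also have "ennreal (\<omega> * sqrt (B\<^sup>2 * max 0 (1 - t\<^sup>2)) ^ m) = ennreal (\<omega> * B ^ m) * ennreal (sqrt (max 0 (1 - t\<^sup>2)) ^ m)"
        using B_pos \<omega> by (simp add: real_sqrt_mult power_mult_distrib mult.assoc flip: ennreal_mult)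
      also have "ennreal (sqrt (max 0 (1 - t\<^sup>2)) ^ m) = ennreal (sqrt (1 - \<bar>t\<bar>\<^sup>2) ^ m) * indicator {-1..1} t"
      proof (cases "\<bar>t\<bar> \<le> 1")
        case True
        then have "t\<^sup>2 \<le> 1" by (simp add: abs_square_le_1)
        then show ?thesis using True by (simp add: indicator_def abs_le_iff)
      next
        case False
        then have "1 \<le> t\<^sup>2" using abs_square_le_1[of t] by linarith
        then show ?thesis using False m_ge_2 by (auto simp: indicator_def max_def power_0_left)
      qed
      finally show "W (B * t) = ennreal (\<omega> * B ^ m) * (ennreal (sqrt (1 - \<bar>t\<bar>\<^sup>2) ^ m) * indicator {-1..1} t)" .
    qed
    then show ?thesis
      unfolding V using True \<sigma>_def beta_half_pos[OF m_ge_2] \<omega> B_pos A_pos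
      by (simp add: L_def D_def \<omega>_def)
  next
    case False
    then have \<sigma>1: "0 < \<sigma>" using \<sigma>0 by simp
    define y where "y = A / B * \<bar>u 0\<bar> / \<sigma>"
    have "(\<integral>\<^sup>+ t. W t \<partial>lborel) = ennreal (A / \<sigma> * (\<omega> * B ^ m * (2 * J y)))"
    proof (rule scaling)
      show "0 < A / \<sigma>" using A_pos \<sigma>1 by simp
      show "(\<phi> y has_integral J y) {0..1}"
        unfolding J_def by (rule integrable_integral[OF \<phi>_integrable])
      fix t :: real
      have eqs: "\<bar>\<sigma> * (A / \<sigma> * t)\<bar> / A = \<bar>t\<bar>" "\<bar>\<sigma> * (A / \<sigma> * t)\<bar> \<le> A \<longleftrightarrow> \<bar>t\<bar> \<le> 1"
        using \<sigma>1 A_pos by (simp_all add: abs_mult)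
      have ind: "indicator {t. \<bar>\<sigma> * t\<bar> \<le> A} (A / \<sigma> * t) = (indicator {-1..1} t :: ennreal)"
        using eqs(2) by (simp add: indicator_def abs_le_iff conj_commute minus_le_iff del: times_divide_eq_left)
      have yt: "(u 0 * (A / \<sigma> * t))\<^sup>2 = B\<^sup>2 * (y * \<bar>t\<bar>)\<^sup>2"
        using B_pos by (simp add: y_def power_mult_distrib power_divide)
      show "W (A / \<sigma> * t) = ennreal (\<omega> * B ^ m) * (ennreal (\<phi> y \<bar>t\<bar>) * indicator {-1..1} t)"
      proof (cases "\<bar>t\<bar> \<le> 1")
        case True
        then have "W (A / \<sigma> * t) = ennreal (\<omega> * sqrt (max 0 (B\<^sup>2 * ((h \<bar>t\<bar>)\<^sup>2 - (y * \<bar>t\<bar>)\<^sup>2))) ^ m)"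
          unfolding W_def eqs(1) ind yt by (simp add: indicator_def abs_le_iff power_mult_distrib right_diff_distrib)
        also have "max 0 (B\<^sup>2 * ((h \<bar>t\<bar>)\<^sup>2 - (y * \<bar>t\<bar>)\<^sup>2)) = B\<^sup>2 * max 0 ((h \<bar>t\<bar>)\<^sup>2 - (y * \<bar>t\<bar>)\<^sup>2)"
          using B_pos by (simp add: max_mult_distrib_left)
        also have "ennreal (\<omega> * sqrt \<dots> ^ m) = ennreal (\<omega> * B ^ m) * ennreal (\<phi> y \<bar>t\<bar>)"
          using B_pos \<omega> by (simp add: \<phi>_def real_sqrt_mult power_mult_distrib mult.assoc flip: ennreal_mult)
        finally show ?thesis using True by (simp add: indicator_def abs_le_iff)
      next
        case False
        then show ?thesis unfolding W_def ind by (auto simp: indicator_def)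
      qed
    qed (rule \<phi>_nonneg)
    then show ?thesis
      unfolding V using False \<sigma>1 J_pos[of y] \<omega> B_pos A_pos
      by (simp add: D_def \<omega>_def y_def \<sigma>_def)
  qed
qed

end

section \<open>The intersection body of a body of revolution\<close>

lemma axis_dist_scale: "axis_dist n (scale t x) = \<bar>t\<bar> * axis_dist n x"
  by (simp add: axis_dist_def scale_def power_mult_distrib real_sqrt_mult flip: sum_distrib_left)

lemma axis_dist_nonneg: "0 \<le> axis_dist n x"
  by (simp add: axis_dist_def sum_nonneg)

lemma scale_scale: "scale s (scale t x) = scale (s * t) x"
  by (simp add: scale_def mult.assoc)

lemma scale_one: "scale 1 x = x"
  by (simp add: scale_def)

lemma scale_in_Rn: "x \<in> Rn n \<Longrightarrow> scale t x \<in> Rn n"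
  by (simp add: scale_def topspace_Euclidean_space)

context revolution_profile
begin

abbreviation IK :: "(nat \<Rightarrow> real) set"
  where "IK \<equiv> intersection_body n K"

text \<open>The homogeneous extension of the reciprocal radial function. On the axis the argument of
  \<open>J\<close> would be a division by 0, with value 0 in HOL, hence the separate branch.\<close>

definition gauge_IK :: "(nat \<Rightarrow> real) \<Rightarrow> real"
  where "gauge_IK x = (if axis_dist n x = 0 then \<bar>x 0\<bar> / L
    else axis_dist n x / (D * J (A / B * \<bar>x 0\<bar> / axis_dist n x)))"

lemma gauge_IK_nonneg: "0 \<le> gauge_IK x"
  using L_pos D_pos J_pos axis_dist_nonneg by (simp add: gauge_IK_def less_imp_le)

lemma gauge_IK_scale:
  assumes "0 < t"
  shows "gauge_IK (scale t x) = t * gauge_IK x"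
proof -
  have "scale t x 0 = t * x 0" by (simp add: scale_def)
  then show ?thesis
    using assms by (simp add: gauge_IK_def axis_dist_scale abs_mult)
qed

lemma gauge_IK_unit_sphere:
  assumes "u \<in> unit_sphere n"
  shows "0 < hyperplane_volume n u (hyperplane_section n K u)"
    "gauge_IK u = 1 / hyperplane_volume n u (hyperplane_section n K u)"
proof -
  show "0 < hyperplane_volume n u (hyperplane_section n K u)"
    unfolding hyperplane_volume_eq[OF assms]
    using L_pos D_pos J_pos axis_dist_nonneg[of n u] by (simp add: less_le)
  have "\<bar>u 0\<bar> = 1" if "axis_dist n u = 0"
    using axis_dist_unit_sphere[OF assms] that by (simp add: abs_square_eq_1)
  then show "gauge_IK u = 1 / hyperplane_volume n u (hyperplane_section n K u)"
    unfolding hyperplane_volume_eq[OF assms] by (simp add: gauge_IK_def)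
qed

lemma polar_decomposition:
  assumes x: "x \<in> Rn n" "\<exists>i<n. x i \<noteq> 0"
  obtains r u where "0 < r" "u \<in> unit_sphere n" "x = scale r u"
proof -
  define r where "r = sqrt (dot n x x)"
  obtain i where "i < n" "x i \<noteq> 0" using x(2) by blast
  then have "0 < dot n x x"
    unfolding dot_def by (intro sum_pos2[of _ i]) (auto simp: zero_less_mult_iff linorder_neq_iff)
  then have r: "0 < r" "r\<^sup>2 = dot n x x" by (auto simp: r_def)
  define u where "u = scale (1 / r) x"
  have "dot n u u = dot n x x / r\<^sup>2"
    by (simp add: u_def dot_def scale_def power2_eq_square sum_divide_distrib)
  then have "dot n u u = 1" unfolding r(2)[symmetric] using r(1) by simp
  then have "u \<in> unit_sphere n"
    using x by (simp add: unit_sphere_def u_def scale_in_Rn)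
  moreover have "x = scale r u"
    using r by (simp add: u_def scale_scale scale_one)
  ultimately show thesis using that r by blast
qed

lemma e1_in_unit_sphere: "e1 \<in> unit_sphere n"
proof -
  have "(\<Sum>i\<in>{1..<n}. e1 i * e1 i) = 0"
    by (intro sum.neutral) (auto simp: e1_def)
  then show ?thesis
    unfolding unit_sphere_def dot_def sum_split_axis using n_eq
    by (auto simp: e1_def topspace_Euclidean_space)
qed

lemma IK_iff: "x \<in> IK \<longleftrightarrow> x \<in> Rn n \<and> gauge_IK x \<le> 1"
proof
  assume "x \<in> IK"
  then obtain r u where u: "u \<in> unit_sphere n" and r: "0 \<le> r"
    "r \<le> hyperplane_volume n u (hyperplane_section n K u)" and x: "x = scale r u"
    by (auto simp: intersection_body_def)
  have "x \<in> Rn n"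
    using u by (simp add: x scale_in_Rn unit_sphere_def)
  moreover have "gauge_IK x \<le> 1"
  proof (cases "r = 0")
    case True
    then show ?thesis by (simp add: x gauge_IK_def axis_dist_scale) (simp add: scale_def)
  next
    case False
    then show ?thesis
      using r gauge_IK_unit_sphere[OF u] by (simp add: x gauge_IK_scale)
  qed
  ultimately show "x \<in> Rn n \<and> gauge_IK x \<le> 1" ..
next
  assume x: "x \<in> Rn n \<and> gauge_IK x \<le> 1"
  show "x \<in> IK"
  proof (cases "\<exists>i<n. x i \<noteq> 0")
    case True
    with x obtain r u where r: "0 < r" and u: "u \<in> unit_sphere n" and xu: "x = scale r u"
      using polar_decomposition by blast
    have "r \<le> hyperplane_volume n u (hyperplane_section n K u)"
      using x r gauge_IK_unit_sphere[OF u] by (simp add: xu gauge_IK_scale)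
    then show ?thesis
      using r u xu unfolding intersection_body_def by force
  next
    case False
    have "x i = 0" for i
      using False x by (cases "i < n") (auto simp: topspace_Euclidean_space)
    then have "x = scale 0 e1" by (auto simp: scale_def)
    then show ?thesis
      using e1_in_unit_sphere gauge_IK_unit_sphere(1)[OF e1_in_unit_sphere] less_imp_le
      unfolding intersection_body_def by blast
  qed
qed

lemma minkowski_functional_IK:
  assumes x: "x \<in> Rn n"
  shows "minkowski_functional IK x = gauge_IK x"
proof -
  have "x \<in> scale t ` IK \<longleftrightarrow> gauge_IK x \<le> t" if t: "0 < t" for t
  proof -
    have "x \<in> scale t ` IK \<longleftrightarrow> scale (1 / t) x \<in> IK"
    proof
      assume "x \<in> scale t ` IK"
      then show "scale (1 / t) x \<in> IK"
        using t by (auto simp: scale_scale scale_one)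
    next
      assume "scale (1 / t) x \<in> IK"
      moreover have "x = scale t (scale (1 / t) x)"
        using t by (simp add: scale_scale scale_one)
      ultimately show "x \<in> scale t ` IK" by blast
    qed
    also have "\<dots> \<longleftrightarrow> gauge_IK x \<le> t"
      using t x by (simp add: IK_iff scale_in_Rn gauge_IK_scale)
    finally show ?thesis .
  qed
  then have "{t. 0 < t \<and> x \<in> scale t ` IK} = {t. 0 < t \<and> gauge_IK x \<le> t}"
    by auto
  \<comment> \<open>The functional ranges over \<open>t > 0\<close>, so at gauge 0 the infimum is
    not attained.\<close>
  also have "\<dots> = (if gauge_IK x = 0 then {0<..} else {gauge_IK x..})"
    using gauge_IK_nonneg[of x] by auto
  finally show ?thesis
    by (simp add: minkowski_functional_def)
qed

lemma gauge_IK_scale_e1: "gauge_IK (scale s e1) = \<bar>s\<bar> / L"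
  by (simp add: gauge_IK_def axis_dist_scale) (simp add: axis_dist_def scale_def e1_def)

section \<open>Chords parallel to the axis\<close>

text \<open>The competitors in the modulus, with the norm condition resolved by
  \<open>gauge_IK (scale s e1) = \<bar>s\<bar> / L\<close>.\<close>

definition chord_pair :: "real \<Rightarrow> (nat \<Rightarrow> real) \<Rightarrow> (nat \<Rightarrow> real) \<Rightarrow> bool"
  where "chord_pair \<epsilon> x y \<longleftrightarrow> x \<in> IK \<and> y \<in> IK \<and>
    (\<exists>s. (\<lambda>i. x i - y i) = scale s e1 \<and> 2 * \<epsilon> * L \<le> \<bar>s\<bar>)"

lemma equatorial_modulus_IK:
  "equatorial_modulus IK \<epsilon> = Inf {1 - gauge_IK (\<lambda>i. (x i + y i) / 2) | x y. chord_pair \<epsilon> x y}"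
proof -
  have eq1: "(x \<in> IK \<and> y \<in> IK \<and> minkowski_functional IK (\<lambda>i. x i - y i) \<ge> 2 * \<epsilon> \<and>
      (\<exists>s. (\<lambda>i. x i - y i) = scale s e1)) \<longleftrightarrow> chord_pair \<epsilon> x y" for x y
  proof -
    have "minkowski_functional IK (\<lambda>i. x i - y i) = \<bar>s\<bar> / L" if "(\<lambda>i. x i - y i) = scale s e1" for s
      using that e1_in_unit_sphere
      by (simp add: minkowski_functional_IK scale_in_Rn unit_sphere_def gauge_IK_scale_e1)
    then show ?thesis
      using L_pos by (auto simp: chord_pair_def pos_le_divide_eq)
  qed
  have eq2: "minkowski_functional IK (\<lambda>i. (x i + y i) / 2) = gauge_IK (\<lambda>i. (x i + y i) / 2)"
    if "chord_pair \<epsilon> x y" for x y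
    using that by (intro minkowski_functional_IK) (auto simp: chord_pair_def IK_iff topspace_Euclidean_space)
  show ?thesis
    unfolding equatorial_modulus_def eq1 by (simp add: eq2 cong: rev_conj_cong)
qed

text \<open>Both endpoints are as far from the axis as the midpoint. The one farther from the
  equator lies in the body, and scaling by \<open>k\<close> and \<open>1 / D\<close> puts it into
  the coordinates of \<open>midpoint_bound\<close>.\<close>

lemma chord_pair_gauge_bound:
  assumes xy: "chord_pair \<epsilon> x y"
    and eps: "0 \<le> \<epsilon>" and z: "0 < z" "z < z'" "z * J z = \<epsilon> * beta_half m" "\<epsilon> * beta_half m < z' * J z'"
    and def: "deficit z \<le> \<epsilon>"
  shows "gauge_IK (\<lambda>i. (x i + y i) / 2) \<le> 1 - deficit z"
proof -
  obtain s where s: "(\<lambda>i. x i - y i) = scale s e1" "2 * \<epsilon> * L \<le> \<bar>s\<bar>"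
    and IK: "x \<in> IK" "y \<in> IK"
    using xy by (auto simp: chord_pair_def)
  have diff: "x i - y i = s * e1 i" for i
    using s(1) by (metis scale_def)
  define c where "c = (\<lambda>i. (x i + y i) / 2)"
  define W where "W = axis_dist n c"
  have same: "y i = x i" "c i = x i" if "i \<in> {1..<n}" for i
    using diff[of i] that by (auto simp: e1_def c_def)
  have W: "axis_dist n x = W" "axis_dist n y = W"
    unfolding W_def axis_dist_def using same by (auto intro!: arg_cong[where f = sqrt] sum.cong)
  have s_eq: "x 0 - y 0 = s" using diff[of 0] by (simp add: e1_def)
  define M where "M = \<bar>c 0\<bar>"
  define a where "a = \<bar>s\<bar> / 2"
  have a: "\<epsilon> * L \<le> a" using s(2) by (simp add: a_def)
  \<comment> \<open>Of \<open>c 0 + s / 2\<close> and \<open>c 0 - s / 2\<close>, the larger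
    absolute value is \<open>\<bar>c 0\<bar> + \<bar>s\<bar> / 2\<close>.\<close>
  have "M + a = \<bar>x 0\<bar> \<or> M + a = \<bar>y 0\<bar>"
    using s_eq by (cases "0 \<le> x 0 + y 0"; cases "0 \<le> s") (auto simp: M_def a_def c_def abs_if field_simps)
  then obtain p where p: "p \<in> IK" "axis_dist n p = W" "\<bar>p 0\<bar> = M + a"
    using IK W by metis
  have gp: "gauge_IK p \<le> 1" using p(1) by (simp add: IK_iff)
  show ?thesis
  proof (cases "W = 0")
    \<comment> \<open>A chord on the axis yields the bound \<open>1 - \<epsilon>\<close>, so here
      \<open>deficit z \<le> \<epsilon>\<close> enters.\<close>
    case True
    then have "M + a \<le> L" using gp p L_pos by (simp add: gauge_IK_def)
    then have "M \<le> (1 - \<epsilon>) * L" using a by (simp add: algebra_simps)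
    then have "M / L \<le> 1 - \<epsilon>" using L_pos by (simp add: pos_divide_le_eq)
    moreover have "gauge_IK c = M / L" using True by (simp add: gauge_IK_def W_def M_def)
    ultimately show ?thesis using def by (simp add: c_def)
  next
    case False
    then have W0: "0 < W" using axis_dist_nonneg[of n c] by (simp add: W_def)
    define k where "k = A / B / D"
    have k: "0 < k" using A_pos B_pos D_pos by (simp add: k_def)
    have arg: "A / B * t / W = k * t / (W / D)" for t
      using D_pos by (simp add: k_def)
    have "W / D / J (k * M / (W / D)) \<le> J z / J 0"
    proof (rule midpoint_bound)
      show "0 < W / D" using W0 D_pos by simp
      have "W \<le> D * J (A / B * (M + a) / W)"
        using gp p False D_pos J_pos[of "A / B * (M + a) / W"] by (simp add: gauge_IK_def)
      then show "W / D \<le> J ((k * M + k * a) / (W / D))"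
        using D_pos unfolding arg by (simp add: pos_divide_le_eq mult.commute distrib_left)
      show "0 \<le> k * M" using k by (simp add: M_def)
      have "\<epsilon> * beta_half m = k * (\<epsilon> * L)"
        using A_pos B_pos D_pos by (simp add: k_def L_def)
      also have "\<dots> \<le> k * a" using a k by (intro mult_left_mono) auto
      finally show "z * J z \<le> k * a" using z by simp
    qed (use z in auto)
    moreover have "gauge_IK c = W / D / J (k * M / (W / D))"
      using False unfolding gauge_IK_def W_def[symmetric] M_def[symmetric] arg[symmetric] by simp
    ultimately show ?thesis by (simp add: deficit_def c_def)
  qed
qed

text \<open>The condition \<open>z * J z = \<epsilon> * beta_half m\<close> says that the points at
  axial coordinates \<open>\<epsilon> * L\<close> and \<open>- (\<epsilon> * L)\<close> and distance
  \<open>D * J z\<close> from the axis lie on the boundary. Their midpoint attains the bound of the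
  previous lemma.\<close>

lemma equatorial_modulus_eq_deficit:
  assumes eps: "0 \<le> \<epsilon>" and z: "0 < z" "z < z'" "z * J z = \<epsilon> * beta_half m" "\<epsilon> * beta_half m < z' * J z'"
    and def: "deficit z \<le> \<epsilon>"
  shows "equatorial_modulus IK \<epsilon> = deficit z"
proof -
  define w :: "real \<Rightarrow> nat \<Rightarrow> real" where "w t = (\<lambda>i. if i = 0 then t else if i = 1 then D * J z else 0 :: real)" for t
  have n: "1 < n" using n_eq by simp
  have w_dist: "axis_dist n (w t) = D * J z" for t
  proof -
    have "(\<Sum>i\<in>{1..<n}. (w t i)\<^sup>2) = (\<Sum>i\<in>{1..<n}. if i = 1 then (D * J z)\<^sup>2 else 0)"
      by (intro sum.cong) (auto simp: w_def)
    also have "\<dots> = (D * J z)\<^sup>2" using n by simp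
    finally show ?thesis using D_pos J_pos[of z] by (simp add: axis_dist_def less_imp_le)
  qed
  have wR: "w t \<in> Rn n" for t
    using n by (auto simp: w_def topspace_Euclidean_space)
  have DJ: "D * J z \<noteq> 0" using D_pos J_pos[of z] by simp
  have gw: "gauge_IK (w t) = J z / J (A / B * \<bar>t\<bar> / (D * J z))" for t
    using DJ D_pos unfolding gauge_IK_def w_dist by (simp add: w_def)
  have "\<epsilon> * L * (A / B) = D * (z * J z)"
    using z A_pos B_pos by (simp add: L_def)
  then have "A / B * (\<epsilon> * L) / (D * J z) = z"
    using DJ by (simp add: field_simps)
  then have in_IK: "w t \<in> IK" if "\<bar>t\<bar> = \<epsilon> * L" for t
    using wR J_pos[of z] by (simp add: IK_iff gw that)
  have eL: "0 \<le> \<epsilon> * L" using eps L_pos by simp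
  have "chord_pair \<epsilon> (w (\<epsilon> * L)) (w (- (\<epsilon> * L)))"
    unfolding chord_pair_def
  proof (intro conjI exI)
    show "(\<lambda>i. w (\<epsilon> * L) i - w (- (\<epsilon> * L)) i) = scale (2 * \<epsilon> * L) e1"
      by (auto simp: w_def scale_def e1_def)
  qed (use in_IK eL in auto)
  moreover have "(\<lambda>i. (w (\<epsilon> * L) i + w (- (\<epsilon> * L)) i) / 2) = w 0"
    by (auto simp: w_def)
  moreover have "1 - gauge_IK (w 0) = deficit z"
    by (simp add: gw deficit_def)
  ultimately have "chord_pair \<epsilon> (w (\<epsilon> * L)) (w (- (\<epsilon> * L)))"
    "deficit z = 1 - gauge_IK (\<lambda>i. (w (\<epsilon> * L) i + w (- (\<epsilon> * L)) i) / 2)"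
    by simp_all
  then have "deficit z \<in> {1 - gauge_IK (\<lambda>i. (x i + y i) / 2) | x y. chord_pair \<epsilon> x y}"
    by blast
  moreover have "deficit z \<le> d" if "d \<in> {1 - gauge_IK (\<lambda>i. (x i + y i) / 2) | x y. chord_pair \<epsilon> x y}" for d
    using that chord_pair_gauge_bound[OF _ eps z def] by force
  ultimately show ?thesis
    unfolding equatorial_modulus_IK by (intro cInf_eq_minimum) auto
qed

text \<open>A chord of the axis centred at the origin. It keeps the set of competitors nonempty up
  to \<open>\<epsilon> = 1\<close> and contributes the value 1.\<close>

lemma chord_pair_exists:
  assumes "0 \<le> \<epsilon>" "\<epsilon> \<le> 1"
  shows "chord_pair \<epsilon> (scale (\<epsilon> * L) e1) (scale (- (\<epsilon> * L)) e1)"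
    and "gauge_IK (\<lambda>i. (scale (\<epsilon> * L) e1 i + scale (- (\<epsilon> * L)) e1 i) / 2) = 0"
proof -
  have "\<epsilon> * L \<le> 1 * L" using assms L_pos by (intro mult_right_mono) auto
  then have IK: "scale t e1 \<in> IK" if "\<bar>t\<bar> = \<epsilon> * L" for t
    using e1_in_unit_sphere L_pos that
    by (simp add: IK_iff gauge_IK_scale_e1 scale_in_Rn unit_sphere_def)
  show "chord_pair \<epsilon> (scale (\<epsilon> * L) e1) (scale (- (\<epsilon> * L)) e1)"
    unfolding chord_pair_def
  proof (intro conjI exI)
    show "(\<lambda>i. scale (\<epsilon> * L) e1 i - scale (- (\<epsilon> * L)) e1 i) = scale (2 * \<epsilon> * L) e1"
      by (auto simp: scale_def)
  qed (use IK assms L_pos in auto)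
  show "gauge_IK (\<lambda>i. (scale (\<epsilon> * L) e1 i + scale (- (\<epsilon> * L)) e1 i) / 2) = 0"
    by (simp add: gauge_IK_def scale_def axis_dist_def)
qed

lemma equatorial_modulus_expansion:
  assumes "0 < \<epsilon>" "\<epsilon> < 1 / 12000"
  shows "\<bar>equatorial_modulus IK \<epsilon> - modulus_coeff * \<epsilon>\<^sup>2\<bar> \<le> 300000000 * \<epsilon> ^ 3"
  using deficit_at_eps[OF assms] equatorial_modulus_eq_deficit[of \<epsilon>] assms by (metis less_imp_le)

lemma equatorial_modulus_bounds:
  assumes eps: "0 < \<epsilon>" "\<epsilon> \<le> 1"
  shows "equatorial_modulus IK \<epsilon> \<le> 1"
    and "0 < \<epsilon>' \<Longrightarrow> \<epsilon>' < 1 / 12000 \<Longrightarrow> \<epsilon>' \<le> \<epsilon> \<Longrightarrow> equatorial_modulus IK \<epsilon>' \<le> equatorial_modulus IK \<epsilon>"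
proof -
  let ?S = "\<lambda>\<epsilon>. {1 - gauge_IK (\<lambda>i. (x i + y i) / 2) | x y. chord_pair \<epsilon> x y}"
  have one: "1 \<in> ?S \<epsilon>"
    using chord_pair_exists[of \<epsilon>] eps by force
  have mono: "?S \<epsilon> \<subseteq> ?S \<epsilon>'" if "\<epsilon>' \<le> \<epsilon>" for \<epsilon>'
  proof -
    have "2 * \<epsilon>' * L \<le> 2 * \<epsilon> * L" using that L_pos by simp
    then have "chord_pair \<epsilon>' x y" if "chord_pair \<epsilon> x y" for x y
      using that unfolding chord_pair_def by (meson order_trans)
    then show ?thesis by blast
  qed
  have bdd: "bdd_below (?S \<epsilon>')" if e: "0 < \<epsilon>'" "\<epsilon>' < 1 / 12000" for \<epsilon>'
  proof -
    obtain z z' where z: "0 < z" "z < z'" "z * J z = \<epsilon>' * beta_half m" "\<epsilon>' * beta_half m < z' * J z'"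
      "deficit z \<le> \<epsilon>'"
      using deficit_at_eps[OF e] by metis
    then have "deficit z \<le> d" if "d \<in> ?S \<epsilon>'" for d
      using that chord_pair_gauge_bound[OF _ _ z] e by force
    then show ?thesis by (rule bdd_belowI)
  qed
  \<comment> \<open>Competitors for \<open>\<epsilon>\<close> also compete for smaller values, so a
    lower bound from the range of the expansion suffices; \<open>1 / 12001\<close> is a value in
    that range.\<close>
  have "bdd_below (?S \<epsilon>)"
  proof (rule bdd_below_mono)
    show "bdd_below (?S (min \<epsilon> (1 / 12001)))" using eps by (intro bdd) auto
    show "?S \<epsilon> \<subseteq> ?S (min \<epsilon> (1 / 12001))" by (rule mono) simp
  qed
  then show "equatorial_modulus IK \<epsilon> \<le> 1"
    unfolding equatorial_modulus_IK using one by (intro cInf_lower)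
  show "equatorial_modulus IK \<epsilon>' \<le> equatorial_modulus IK \<epsilon>" if "0 < \<epsilon>'" "\<epsilon>' < 1 / 12000" "\<epsilon>' \<le> \<epsilon>"
    unfolding equatorial_modulus_IK using one mono[OF that(3)] bdd[OF that(1,2)] by (intro cInf_superset_mono) auto
qed

section \<open>The equatorial power type of a single intersection body\<close>

text \<open>\<open>x\<close> is the cotangent of \<open>\<theta>\<close>, and the factor
  \<open>\<bar>sin \<theta>\<bar>\<close> in \<open>psi\<close> cancels the distance from the axis
  in the section formula.\<close>

lemma psi_IK: "psi IK x = D * J (A / B * \<bar>x\<bar>)"
proof -
  define \<theta> where "\<theta> = (if x = 0 then pi / 2 else arctan (1 / x))"
  define u :: "nat \<Rightarrow> real" where "u = (\<lambda>i. if i = 0 then cos \<theta> else if i = 1 then sin \<theta> else 0)"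
  have n: "1 < n" using n_eq by simp
  have sin0: "sin \<theta> \<noteq> 0" and cot: "cos \<theta> = x * sin \<theta>"
  proof -
    have "sin \<theta> \<noteq> 0 \<and> cos \<theta> = x * sin \<theta>"
    proof (cases "x = 0")
      case False
      then have \<theta>: "\<theta> = arctan (1 / x)" by (simp add: \<theta>_def)
      have "cos \<theta> \<noteq> 0" unfolding \<theta> by (rule cos_arctan_not_zero)
      moreover have "tan \<theta> = 1 / x" unfolding \<theta> by (rule tan_arctan)
      ultimately have eqs: "sin \<theta> = cos \<theta> / x" "cos \<theta> \<noteq> 0"
        using False by (simp_all add: tan_def field_simps)
      then have "sin \<theta> \<noteq> 0" using False by (metis divide_eq_0_iff)
      with eqs(1) False show ?thesis by simp
    qed (simp add: \<theta>_def)
    then show "sin \<theta> \<noteq> 0" "cos \<theta> = x * sin \<theta>" by auto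
  qed
  have sq: "(\<Sum>i\<in>{1..<n}. (u i)\<^sup>2) = (sin \<theta>)\<^sup>2"
  proof -
    have "(\<Sum>i\<in>{1..<n}. (u i)\<^sup>2) = (\<Sum>i\<in>{1..<n}. if i = 1 then (sin \<theta>)\<^sup>2 else 0)"
      by (intro sum.cong) (auto simp: u_def)
    then show ?thesis using n by simp
  qed
  have "dot n u u = 1"
    using sum_split_axis[of "\<lambda>i. (u i)\<^sup>2"] sq by (simp add: dot_def power2_eq_square) (simp add: u_def flip: power2_eq_square)
  then have u: "u \<in> unit_sphere n"
    using n by (auto simp: unit_sphere_def u_def topspace_Euclidean_space)
  have dist: "axis_dist n u = \<bar>sin \<theta>\<bar>" unfolding axis_dist_def sq by simp
  have "radial_angle IK \<theta> = D / \<bar>sin \<theta>\<bar> * J (A / B * \<bar>cos \<theta>\<bar> / \<bar>sin \<theta>\<bar>)"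
    unfolding radial_angle_def u_def[symmetric] radial_function_intersection_body[OF u]
      hyperplane_volume_eq[OF u] dist
    using sin0 by (simp add: u_def)
  also have "A / B * \<bar>cos \<theta>\<bar> / \<bar>sin \<theta>\<bar> = A / B * \<bar>x\<bar>"
    using sin0 by (simp add: cot abs_mult)
  finally show ?thesis
    unfolding psi_def Let_def \<theta>_def[symmetric] using sin0 by simp
qed

lemma equatorial_power_type_IK: "equatorial_power_type 2 IK"
proof -
  define p where "p = real m / 2 * P / J 0"
  define k where "k = A / B"
  have k: "0 < k" using A_pos B_pos by (simp add: k_def)
  have "0 < P" using P_ge zero_less_power[OF J_pos, of 0 3] by linarith
  then have p: "0 < p" using m_ge_2 J_pos[of 0] by (simp add: p_def)
  have psi: "\<bar>psi IK x - psi IK 0\<bar> = D * J 0 * deficit (k * \<bar>x\<bar>)" for x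
  proof -
    have "psi IK 0 - psi IK x = D * J 0 * deficit (k * \<bar>x\<bar>)"
      unfolding psi_IK deficit_def k_def using J_pos[of 0] by (simp add: algebra_simps)
    moreover have "0 \<le> D * J 0 * deficit (k * \<bar>x\<bar>)"
      using D_pos J_pos[of 0] deficit_nonneg by (intro mult_nonneg_nonneg) (auto simp: less_imp_le)
    ultimately show ?thesis by linarith
  qed
  obtain d where d: "0 < d" "\<And>y. 0 < y \<Longrightarrow> y < d \<Longrightarrow> p / 2 * y\<^sup>2 \<le> deficit y"
    using deficit_quadratic unfolding eventually_at_right_field p_def by auto
  have upper: "deficit y \<le> p * y\<^sup>2" for y
  proof -
    have "(J 0 - J y) / J 0 \<le> (real m / 2 * y\<^sup>2 * P) / J 0"
      using J_lower[of y] J_pos[of 0] by (intro divide_right_mono) auto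
    then show ?thesis
      using J_pos[of 0] by (simp add: deficit_def p_def diff_divide_distrib mult_ac)
  qed
  define c where "c = D * J 0 * p * k\<^sup>2"
  have c: "0 < c" using D_pos J_pos[of 0] p k by (simp add: c_def)
  have "c / 4 < \<bar>psi IK x - psi IK 0\<bar> / \<bar>x\<bar> powr 2 \<and> \<bar>psi IK x - psi IK 0\<bar> / \<bar>x\<bar> powr 2 < 2 * c"
    if x: "x \<noteq> 0" "\<bar>x\<bar> < d / k" for x
  proof -
    have xk: "0 < k * \<bar>x\<bar>" "k * \<bar>x\<bar> < d"
      using x k by (simp_all add: pos_less_divide_eq mult.commute)
    have DJ: "0 \<le> D * J 0" using D_pos J_pos[of 0] by simp
    have pw: "\<bar>x\<bar> powr 2 = x\<^sup>2" "0 < x\<^sup>2" using x by auto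
    have "c / 2 * x\<^sup>2 = D * J 0 * (p / 2 * (k * \<bar>x\<bar>)\<^sup>2)"
      by (simp add: c_def power_mult_distrib)
    also have "\<dots> \<le> \<bar>psi IK x - psi IK 0\<bar>"
      unfolding psi using d(2)[OF xk] DJ by (intro mult_left_mono)
    finally have lo: "c / 2 \<le> \<bar>psi IK x - psi IK 0\<bar> / \<bar>x\<bar> powr 2"
      using pw by (simp add: pos_le_divide_eq)
    have "\<bar>psi IK x - psi IK 0\<bar> \<le> D * J 0 * (p * (k * \<bar>x\<bar>)\<^sup>2)"
      unfolding psi using upper DJ by (intro mult_left_mono)
    also have "\<dots> = c * x\<^sup>2"
      by (simp add: c_def power_mult_distrib)
    finally have "\<bar>psi IK x - psi IK 0\<bar> / \<bar>x\<bar> powr 2 \<le> c"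
      using pw by (simp add: pos_divide_le_eq)
    with lo c show ?thesis by linarith
  qed
  then have "\<forall>\<^sub>F x in at 0. c / 4 < \<bar>psi IK x - psi IK 0\<bar> / \<bar>x\<bar> powr 2 \<and>
      \<bar>psi IK x - psi IK 0\<bar> / \<bar>x\<bar> powr 2 < 2 * c"
    unfolding eventually_at using d k by (intro exI[of _ "d / k"]) (auto simp: dist_real_def)
  then show ?thesis
    unfolding equatorial_power_type_def using c by (intro conjI exI[of _ "c / 4"] exI[of _ "2 * c"]) auto
qed

end

section \<open>From a body of revolution to its profile\<close>

text \<open>A nonempty body has an interior point, which can be moved a little along coordinate
  \<open>k\<close>. For \<open>k = 0\<close> and \<open>k = 1\<close> this makes the half-length and
  the equatorial radius positive.\<close>

lemma convex_body_coordinate_nonzero: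
  assumes body: "is_body n K" "K \<noteq> {}" and k: "k < n"
  shows "\<exists>x\<in>K. x k \<noteq> 0"
proof -
  let ?U = "(Euclidean_space n) interior_of K"
  have "?U \<noteq> {}"
    using body unfolding is_body_def by (metis closure_of_empty)
  then obtain p where p: "p \<in> ?U" by blast
  obtain T where T: "open T" "?U = T \<inter> Rn n"
    using openin_interior_of[of "Euclidean_space n" K]
    unfolding Euclidean_space_def openin_subtopology euclidean_product_topology by auto
  have pR: "p \<in> Rn n" using p T by auto
  define g where "g s = (\<lambda>i. p i + (if i = k then s else 0))" for s :: real
  have gR: "g s \<in> Rn n" for s
    using pR k by (auto simp: g_def topspace_Euclidean_space)
  have "continuous_on UNIV g"
  proof (rule continuous_on_coordinatewise_then_product)
    show "continuous_on UNIV (\<lambda>s. g s i)" for i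
      unfolding g_def by (cases "i = k") (auto intro!: continuous_intros)
  qed
  then have "open (g -` T)"
    using T(1) by (simp add: open_vimage)
  moreover have "0 \<in> g -` T"
    using p T by (simp add: g_def)
  ultimately obtain e where e: "0 < e" "ball 0 e \<subseteq> g -` T"
    by (meson openE)
  then have "g (e / 2) \<in> T" by (auto simp: subset_iff dist_real_def)
  then have "g (e / 2) \<in> ?U" using T(2) gR by blast
  then have "g (e / 2) \<in> K" "p \<in> K"
    using p interior_of_subset[of "Euclidean_space n" K] by (auto dest: subsetD)
  moreover have "g (e / 2) k \<noteq> 0" if "p k = 0"
    using that e(1) by (simp add: g_def)
  ultimately show ?thesis
    by (cases "p k = 0") auto
qed

lemma body_compact:
  assumes "is_body n K"
  shows "compact K" "K \<subseteq> Rn n"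
proof -
  have "compactin (Euclidean_space n) K" using assms by (simp add: is_body_def)
  then show "compact K" "K \<subseteq> Rn n"
    by (auto simp: Euclidean_space_def compactin_subtopology euclidean_product_topology)
qed

text \<open>Rotation reduces \<open>K\<close> to a planar convex set \<open>q\<close>, symmetric in
  both coordinates. The profile is its upper boundary \<open>f\<close>, rescaled by the half-length
  \<open>A\<close> and the equatorial radius \<open>B\<close>.\<close>

lemma revolution_profile_exists:
  assumes n: "4 \<le> n" and K: "sym_convex_body_of_revolution n K"
  shows "\<exists>h A B. revolution_profile h (n - 2) n A B K"
proof -
  have body: "is_body n K" "K \<noteq> {}" and symm: "is_symmetric K" and conv: "is_convex K"
    and rev: "is_revolution n K"
    using K by (auto simp: sym_convex_body_of_revolution_def)
  note cpt = body_compact[OF body(1)]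
  define pt :: "real \<Rightarrow> real \<Rightarrow> nat \<Rightarrow> real"
    where "pt t r = (\<lambda>i. if i = 0 then t else if i = 1 then r else 0)" for t r
  define q where "q t r \<longleftrightarrow> pt t r \<in> K" for t r
  have ptR: "pt t r \<in> Rn n" for t r
    using n by (auto simp: pt_def topspace_Euclidean_space)
  have pt_sq: "(\<Sum>i\<in>{1..<n}. (pt t r i)\<^sup>2) = r\<^sup>2" for t r
  proof -
    have "(\<Sum>i\<in>{1..<n}. (pt t r i)\<^sup>2) = (\<Sum>i\<in>{1..<n}. if i = 1 then r\<^sup>2 else 0)"
      by (intro sum.cong) (auto simp: pt_def)
    then show ?thesis using n by simp
  qed
  have revD: "y \<in> K" if "x \<in> K" "y \<in> Rn n" "y 0 = x 0"
    "(\<Sum>i\<in>{1..<n}. (y i)\<^sup>2) = (\<Sum>i\<in>{1..<n}. (x i)\<^sup>2)" for x y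
    using rev that unfolding is_revolution_def by blast
  have K_q: "x \<in> K \<longleftrightarrow> x \<in> Rn n \<and> q (x 0) (axis_dist n x)" for x
  proof -
    have "(axis_dist n x)\<^sup>2 = (\<Sum>i\<in>{1..<n}. (x i)\<^sup>2)"
      by (simp add: axis_dist_def sum_nonneg)
    then have eq: "(\<Sum>i\<in>{1..<n}. (pt (x 0) (axis_dist n x) i)\<^sup>2) = (\<Sum>i\<in>{1..<n}. (x i)\<^sup>2)"
      unfolding pt_sq .
    have pt0: "pt (x 0) (axis_dist n x) 0 = x 0" by (simp add: pt_def)
    show ?thesis
    proof
      assume "x \<in> K"
      then show "x \<in> Rn n \<and> q (x 0) (axis_dist n x)"
        using revD[OF _ ptR pt0 eq] cpt(2) by (auto simp: q_def)
    next
      assume "x \<in> Rn n \<and> q (x 0) (axis_dist n x)"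
      then show "x \<in> K"
        using revD[OF _ _ pt0[symmetric] eq[symmetric]] by (auto simp: q_def)
    qed
  qed
  have q_conv: "q ((1 - v) * t + v * t') ((1 - v) * r + v * r')"
    if "q t r" "q t' r'" "0 \<le> v" "v \<le> 1" for v t t' r r'
  proof -
    have "(\<lambda>i. (1 - v) * pt t r i + v * pt t' r' i) \<in> K"
      using conv that unfolding is_convex_def q_def by blast
    moreover have "(\<lambda>i. (1 - v) * pt t r i + v * pt t' r' i) =
        pt ((1 - v) * t + v * t') ((1 - v) * r + v * r')"
      by (auto simp: pt_def)
    ultimately show ?thesis by (simp add: q_def)
  qed
  have q_neg_r: "q t (- r)" if "q t r" for t r
  proof -
    have "pt t (- r) \<in> K"
    proof (rule revD[OF that[unfolded q_def] ptR])
      show "(\<Sum>i\<in>{1..<n}. (pt t (- r) i)\<^sup>2) = (\<Sum>i\<in>{1..<n}. (pt t r i)\<^sup>2)"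
        unfolding pt_sq by simp
    qed (simp add: pt_def)
    then show ?thesis by (simp add: q_def)
  qed
  \<comment> \<open>Central symmetry flips both signs, and the rotation symmetry restores the radial
    one.\<close>
  have q_neg: "q (- t) r" if "q t r" for t r
  proof -
    have "scale (- 1) (pt t (- r)) \<in> K"
      using symm q_neg_r[OF that] unfolding is_symmetric_def q_def by blast
    moreover have "scale (- 1) (pt t (- r)) = pt (- t) r"
      by (auto simp: scale_def pt_def)
    ultimately show ?thesis by (simp add: q_def)
  qed
  have q_abs: "q \<bar>t\<bar> r \<longleftrightarrow> q t r" for t r
    using q_neg[of t r] q_neg[of "- t" r] by (auto simp: abs_if)
  have q_axis: "q t 0" if "q t r" for t r
    using q_conv[OF that q_neg_r[OF that], of "1 / 2"] by (simp add: field_simps)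
  have q_equator: "q 0 r" if "q t r" for t r
    using q_conv[OF that q_neg[OF that], of "1 / 2"] by (simp add: field_simps)
  have closed_K: "closed K" using cpt(1) by (rule compact_imp_closed)
  have pt_cont: "continuous_on UNIV (\<lambda>r. pt t r i)" "continuous_on UNIV (\<lambda>t. pt t r i)" for t r i
    unfolding pt_def by (cases "i = 0"; cases "i = 1"; simp)+
  have closed_r: "closed {r. q t r}" for t
  proof -
    have "continuous_on UNIV (pt t)"
      by (intro continuous_on_coordinatewise_then_product pt_cont)
    then have "closed (pt t -` K)"
      using closed_K by (simp add: closed_vimage)
    then show ?thesis by (simp add: vimage_def q_def)
  qed
  have closed_t: "closed {t. q t r}" for r
  proof -
    have "continuous_on UNIV (\<lambda>t. pt t r)"
      by (intro continuous_on_coordinatewise_then_product pt_cont)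
    then have "closed ((\<lambda>t. pt t r) -` K)"
      using closed_K by (simp add: closed_vimage)
    then show ?thesis by (simp add: vimage_def q_def)
  qed
  have coord_bdd: "\<exists>C. \<forall>x\<in>K. \<bar>x k\<bar> \<le> C" for k
  proof -
    have "compact ((\<lambda>x. x k) ` K)"
      by (intro compact_continuous_image cpt continuous_on_subset[OF continuous_on_product_coordinates]) auto
    then show ?thesis
      using compact_imp_bounded[of "(\<lambda>x. x k) ` K"] unfolding bounded_iff by auto
  qed
  have q_bdd: "\<exists>C. \<forall>t r. q t r \<longrightarrow> \<bar>t\<bar> \<le> C \<and> \<bar>r\<bar> \<le> C"
  proof -
    obtain C C' where C: "\<forall>x\<in>K. \<bar>x 0\<bar> \<le> C" "\<forall>x\<in>K. \<bar>x 1\<bar> \<le> C'"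
      using coord_bdd by metis
    have "\<bar>t\<bar> \<le> max C C' \<and> \<bar>r\<bar> \<le> max C C'" if "q t r" for t r
      using that C(1)[rule_format, of "pt t r"] C(2)[rule_format, of "pt t r"]
      by (auto simp: q_def pt_def)
    then show ?thesis by blast
  qed
  then obtain C where C: "\<And>t r. q t r \<Longrightarrow> \<bar>t\<bar> \<le> C" "\<And>t r. q t r \<Longrightarrow> \<bar>r\<bar> \<le> C"
    by blast
  define A where "A = Sup {t. q t 0}"
  have bdd_A: "bdd_above {t. q t 0}"
    using C(1) by (intro bdd_aboveI[of _ C]) (auto dest: abs_le_D1)
  obtain x0 where "x0 \<in> K" "x0 0 \<noteq> 0"
    using convex_body_coordinate_nonzero[OF body, of 0] n by auto
  then have x0: "q \<bar>x0 0\<bar> 0" "0 < \<bar>x0 0\<bar>"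
    using K_q q_axis by (auto simp: q_abs)
  have A_ge: "\<bar>t\<bar> \<le> A" if "q t r" for t r
    unfolding A_def using q_axis[OF that] bdd_A by (intro cSup_upper) (auto simp: q_abs)
  have A: "0 < A" using A_ge[OF x0(1)] x0(2) by simp
  \<comment> \<open>Closedness puts the supremum itself into the set, so \<open>K\<close> is
    described by non-strict inequalities.\<close>
  have qA: "q A 0"
    using closed_contains_Sup[OF _ bdd_A closed_t] x0(1) unfolding A_def by blast
  have q_axis_iff: "q t 0" if "\<bar>t\<bar> \<le> A" for t
  proof -
    have "q ((1 - (1 + t / A) / 2) * (- A) + (1 + t / A) / 2 * A) ((1 - (1 + t / A) / 2) * 0 + (1 + t / A) / 2 * 0)"
      using that A by (intro q_conv q_neg qA) (auto simp: field_simps abs_le_iff)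
    moreover have "(1 - (1 + t / A) / 2) * (- A) + (1 + t / A) / 2 * A = t"
      using A by (simp add: field_simps)
    ultimately show ?thesis by simp
  qed
  define f where "f t = Sup {r. q t r}" for t
  have bdd_f: "bdd_above {r. q t r}" for t
    using C(2) by (intro bdd_aboveI[of _ C]) (auto dest: abs_le_D1)
  have f_ge: "r \<le> f t" if "q t r" for t r
    unfolding f_def using that bdd_f by (intro cSup_upper) auto
  have qf: "q t (f t)" if "\<bar>t\<bar> \<le> A" for t
    using closed_contains_Sup[OF _ bdd_f closed_r, of t] q_axis_iff[OF that] unfolding f_def by blast
  have f0: "0 \<le> f t" if "\<bar>t\<bar> \<le> A" for t
    using q_axis_iff[OF that] by (rule f_ge)
  have q_iff: "q t r \<longleftrightarrow> \<bar>t\<bar> \<le> A \<and> r \<le> f \<bar>t\<bar>" if r: "0 \<le> r" for t r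
  proof
    assume "q t r"
    then show "\<bar>t\<bar> \<le> A \<and> r \<le> f \<bar>t\<bar>"
      using A_ge f_ge by (auto simp: q_abs)
  next
    assume tr: "\<bar>t\<bar> \<le> A \<and> r \<le> f \<bar>t\<bar>"
    then have "q \<bar>t\<bar> (f \<bar>t\<bar>)" "q \<bar>t\<bar> 0" using qf q_axis_iff by auto
    show "q t r"
    proof (cases "f \<bar>t\<bar> = 0")
      case True
      then have "r = 0" using r tr by simp
      with \<open>q \<bar>t\<bar> 0\<close> show ?thesis by (simp add: q_abs)
    next
      case False
      then have fp: "0 < f \<bar>t\<bar>" using r tr by simp
      have "q ((1 - r / f \<bar>t\<bar>) * \<bar>t\<bar> + r / f \<bar>t\<bar> * \<bar>t\<bar>) ((1 - r / f \<bar>t\<bar>) * 0 + r / f \<bar>t\<bar> * f \<bar>t\<bar>)"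
        using r tr fp by (intro q_conv \<open>q \<bar>t\<bar> (f \<bar>t\<bar>)\<close> \<open>q \<bar>t\<bar> 0\<close>) auto
      moreover have "(1 - r / f \<bar>t\<bar>) * \<bar>t\<bar> + r / f \<bar>t\<bar> * \<bar>t\<bar> = \<bar>t\<bar>"
        by (simp add: algebra_simps)
      ultimately show ?thesis using fp by (simp add: q_abs)
    qed
  qed
  define B where "B = f 0"
  obtain x1 where x1: "x1 \<in> K" "x1 1 \<noteq> 0"
    using convex_body_coordinate_nonzero[OF body, of 1] n by auto
  have "0 < (\<Sum>i\<in>{1..<n}. (x1 i)\<^sup>2)"
    using x1(2) n by (intro sum_pos2[of _ 1]) auto
  then have "0 < axis_dist n x1" by (simp add: axis_dist_def)
  also have "axis_dist n x1 \<le> B"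
    unfolding B_def using x1(1) K_q q_equator f_ge by blast
  finally have B: "0 < B" .
  define h where "h s = f (A * s) / B" for s
  have As: "\<bar>A * s\<bar> \<le> A" if "s \<in> {0..1}" for s
    using that A by (simp add: abs_mult mult_left_le)
  have "revolution_profile h (n - 2) n A B K"
  proof
    show "concave_on {0..1} h"
      unfolding concave_on_iff
    proof (intro conjI ballI allI impI)
      fix x y u v :: real
      assume xy: "x \<in> {0..1}" "y \<in> {0..1}" and uv: "0 \<le> u" "0 \<le> v" "u + v = 1"
      have "q ((1 - v) * (A * x) + v * (A * y)) ((1 - v) * f (A * x) + v * f (A * y))"
        using uv by (intro q_conv qf As xy) auto
      moreover have u: "u = 1 - v" using uv by simp
      have "(1 - v) * (A * x) + v * (A * y) = A * (u * x + v * y)"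
        unfolding u by (simp add: algebra_simps)
      ultimately have "u * f (A * x) + v * f (A * y) \<le> f (A * (u * x + v * y))"
        using f_ge by (simp add: u)
      then have "(u * f (A * x) + v * f (A * y)) / B \<le> f (A * (u * x + v * y)) / B"
        using B by (intro divide_right_mono) auto
      then show "u * h x + v * h y \<le> h (u *\<^sub>R x + v *\<^sub>R y)"
        by (simp add: h_def add_divide_distrib)
    qed simp
    show "h 0 = 1" using B by (simp add: h_def B_def)
    show "0 \<le> h t" if "t \<in> {0..1}" for t
      using f0[OF As[OF that]] B by (simp add: h_def)
    show "h t \<le> 1" if "t \<in> {0..1}" for t
      using f_ge[OF q_equator[OF qf[OF As[OF that]]]] B by (simp add: h_def B_def)
    show "2 \<le> n - 2" "n = n - 2 + 2" using n by auto
    show "0 < A" "0 < B" by fact+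
    show "x \<in> K \<longleftrightarrow> x \<in> Rn n \<and> \<bar>x 0\<bar> \<le> A \<and> axis_dist n x \<le> B * h (\<bar>x 0\<bar> / A)" for x
      using A B by (simp add: K_q[of x] q_iff axis_dist_nonneg h_def)
  qed
  then show ?thesis by blast
qed

section \<open>Uniform constants on the whole range of \<open>\<epsilon>\<close>\<close>

theorem theorem1:
  shows "uniform_equatorial_power_type 2
      {intersection_body n K | n K. 4 \<le> n \<and> sym_convex_body_of_revolution n K} \<and>
    (\<exists>a b C \<epsilon>\<^sub>0. 0 < a \<and> 0 < b \<and> 0 < C \<and> 0 < \<epsilon>\<^sub>0 \<and> \<epsilon>\<^sub>0 \<le> 1 \<and>
      (\<forall>n K. 4 \<le> n \<and> sym_convex_body_of_revolution n K \<longrightarrow>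
        (\<exists>c\<^sub>K. a \<le> c\<^sub>K \<and> c\<^sub>K \<le> b \<and>
          (\<forall>\<epsilon>. 0 < \<epsilon> \<and> \<epsilon> < \<epsilon>\<^sub>0 \<longrightarrow>
            \<bar>equatorial_modulus (intersection_body n K) \<epsilon> - c\<^sub>K * \<epsilon>\<^sup>2\<bar> \<le> C * \<epsilon> ^ 3))))"
proof (rule conjI)
  \<comment> \<open>For \<open>\<epsilon> \<le> e\<close> the cubic error is at most
    \<open>\<epsilon>\<^sup>2 / 36\<close>, half of what the coefficient bound \<open>1 / 18\<close>
    provides.\<close>
  define e :: real where "e = 1 / 10800000000"
  have e: "0 < e" "e < 1 / 12000" "300000000 * e = 1 / 36" by (simp_all add: e_def)
  have bounds: "e\<^sup>2 / 72 < equatorial_modulus (intersection_body n K) \<epsilon> / \<epsilon> powr 2 \<and>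
      equatorial_modulus (intersection_body n K) \<epsilon> / \<epsilon> powr 2 < 2 / e\<^sup>2"
    if n: "4 \<le> n" and K: "sym_convex_body_of_revolution n K" and eps: "0 < \<epsilon>" "\<epsilon> \<le> 1" for n K \<epsilon>
  proof -
    obtain h A B where "revolution_profile h (n - 2) n A B K"
      using revolution_profile_exists[OF n K] by blast
    then interpret revolution_profile h "n - 2" n A B K .
    let ?\<delta> = "equatorial_modulus IK"
    have small: "d\<^sup>2 / 36 \<le> ?\<delta> d" "?\<delta> d \<le> 2917 * d\<^sup>2" if d: "0 < d" "d \<le> e" for d
    proof -
      have "300000000 * d ^ 3 = (300000000 * d) * d\<^sup>2"
        by (simp add: power2_eq_square power3_eq_cube)
      also have "\<dots> \<le> (1 / 36) * d\<^sup>2"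
        using d e by (intro mult_right_mono) auto
      finally have "\<bar>?\<delta> d - modulus_coeff * d\<^sup>2\<bar> \<le> 1 / 36 * d\<^sup>2"
        using equatorial_modulus_expansion[of d] d e by simp
      moreover have "1 / 18 * d\<^sup>2 \<le> modulus_coeff * d\<^sup>2" "modulus_coeff * d\<^sup>2 \<le> 2916 * d\<^sup>2"
        by (rule mult_right_mono[OF modulus_coeff_bounds(1)] mult_right_mono[OF modulus_coeff_bounds(2)], simp)+
      moreover have "0 < d\<^sup>2" using d by simp
      ultimately show "d\<^sup>2 / 36 \<le> ?\<delta> d" "?\<delta> d \<le> 2917 * d\<^sup>2"
        unfolding abs_le_iff by linarith+
    qed
    have pw: "\<epsilon> powr 2 = \<epsilon>\<^sup>2" "0 < \<epsilon>\<^sup>2" "\<epsilon>\<^sup>2 \<le> 1" using eps by (auto simp: power_le_one)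
    have e2: "0 < e\<^sup>2" "e\<^sup>2 \<le> 1" "2917 * e\<^sup>2 \<le> 1" by (auto simp: e_def power2_eq_square)
    have "e\<^sup>2 / 36 * \<epsilon>\<^sup>2 \<le> ?\<delta> \<epsilon> \<and> ?\<delta> \<epsilon> \<le> 1 / e\<^sup>2 * \<epsilon>\<^sup>2"
    proof (cases "\<epsilon> \<le> e")
      case True
      have "e\<^sup>2 / 36 * \<epsilon>\<^sup>2 \<le> 1 / 36 * \<epsilon>\<^sup>2" using e2 by (intro mult_right_mono) auto
      moreover have "2917 * \<epsilon>\<^sup>2 \<le> 1 / e\<^sup>2 * \<epsilon>\<^sup>2"
        using e2 by (intro mult_right_mono) (auto simp: pos_le_divide_eq)
      ultimately show ?thesis using small[OF eps(1) True] by simp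
    next
      \<comment> \<open>Beyond \<open>e\<close> the expansion is replaced by monotonicity of the
        modulus from below and the bound 1 from above.\<close>
      case False
      have "e\<^sup>2 / 36 * \<epsilon>\<^sup>2 \<le> e\<^sup>2 / 36 * 1" using e2 pw by (intro mult_left_mono) auto
      also have "\<dots> \<le> ?\<delta> e" using small[of e] e by simp
      also have "\<dots> \<le> ?\<delta> \<epsilon>" using False e eps by (intro equatorial_modulus_bounds(2)) auto
      finally have "e\<^sup>2 / 36 * \<epsilon>\<^sup>2 \<le> ?\<delta> \<epsilon>" .
      moreover have "e\<^sup>2 \<le> \<epsilon>\<^sup>2" using False e by (intro power_mono) auto
      then have "1 \<le> 1 / e\<^sup>2 * \<epsilon>\<^sup>2" using e2 by (simp add: pos_le_divide_eq)
      ultimately show ?thesis using equatorial_modulus_bounds(1)[OF eps] by simp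
    qed
    then have "e\<^sup>2 / 36 \<le> ?\<delta> \<epsilon> / \<epsilon> powr 2" "?\<delta> \<epsilon> / \<epsilon> powr 2 \<le> 1 / e\<^sup>2"
      unfolding pw(1) using pw(2) by (simp_all add: pos_le_divide_eq pos_divide_le_eq)
    \<comment> \<open>Halving and doubling the constants yields the strict inequalities of the
      definition.\<close>
    moreover have "e\<^sup>2 / 72 < e\<^sup>2 / 36" "1 / e\<^sup>2 < 2 / e\<^sup>2" using e2 by (simp_all add: divide_strict_right_mono)
    ultimately show ?thesis by linarith
  qed
  have power_type: "equatorial_power_type 2 (intersection_body n K)"
    if "4 \<le> n" "sym_convex_body_of_revolution n K" for n K
    using revolution_profile_exists[OF that] revolution_profile.equatorial_power_type_IK by blast
  show "uniform_equatorial_power_type 2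
      {intersection_body n K | n K. 4 \<le> n \<and> sym_convex_body_of_revolution n K}"
    unfolding uniform_equatorial_power_type_def
  proof (rule conjI)
    show "\<exists>c\<^sub>1 c\<^sub>2. 0 < c\<^sub>1 \<and> 0 < c\<^sub>2 \<and>
      (\<forall>K\<in>{intersection_body n K | n K. 4 \<le> n \<and> sym_convex_body_of_revolution n K}.
        \<forall>\<epsilon>. 0 < \<epsilon> \<and> \<epsilon> \<le> 1 \<longrightarrow>
          c\<^sub>1 < equatorial_modulus K \<epsilon> / \<epsilon> powr 2 \<and> equatorial_modulus K \<epsilon> / \<epsilon> powr 2 < c\<^sub>2)"
    proof (rule exI[of _ "e\<^sup>2 / 72"], rule exI[of _ "2 / e\<^sup>2"], intro conjI)
      show "0 < e\<^sup>2 / 72" "0 < 2 / e\<^sup>2" using e by simp_all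
    qed (use bounds in blast)
  qed (use power_type in blast)
next
  have "\<exists>c. 1 / 18 \<le> c \<and> c \<le> 2916 \<and> (\<forall>\<epsilon>. 0 < \<epsilon> \<and> \<epsilon> < 1 / 12000 \<longrightarrow>
      \<bar>equatorial_modulus (intersection_body n K) \<epsilon> - c * \<epsilon>\<^sup>2\<bar> \<le> 300000000 * \<epsilon> ^ 3)"
    if n: "4 \<le> n" and K: "sym_convex_body_of_revolution n K" for n K
  proof -
    obtain h A B where "revolution_profile h (n - 2) n A B K"
      using revolution_profile_exists[OF n K] by blast
    then interpret revolution_profile h "n - 2" n A B K .
    show ?thesis
      using modulus_coeff_bounds equatorial_modulus_expansion by (intro exI[of _ modulus_coeff]) auto
  qed
  then have *: "\<forall>n K. 4 \<le> n \<and> sym_convex_body_of_revolution n K \<longrightarrow>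
      (\<exists>c. 1 / 18 \<le> c \<and> c \<le> 2916 \<and> (\<forall>\<epsilon>. 0 < \<epsilon> \<and> \<epsilon> < 1 / 12000 \<longrightarrow>
        \<bar>equatorial_modulus (intersection_body n K) \<epsilon> - c * \<epsilon>\<^sup>2\<bar> \<le> 300000000 * \<epsilon> ^ 3))"
    by blast
  show "\<exists>a b C \<epsilon>\<^sub>0. 0 < a \<and> 0 < b \<and> 0 < C \<and> 0 < \<epsilon>\<^sub>0 \<and> \<epsilon>\<^sub>0 \<le> 1 \<and>
      (\<forall>n K. 4 \<le> n \<and> sym_convex_body_of_revolution n K \<longrightarrow>
        (\<exists>c\<^sub>K. a \<le> c\<^sub>K \<and> c\<^sub>K \<le> b \<and>
          (\<forall>\<epsilon>. 0 < \<epsilon> \<and> \<epsilon> < \<epsilon>\<^sub>0 \<longrightarrow>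
            \<bar>equatorial_modulus (intersection_body n K) \<epsilon> - c\<^sub>K * \<epsilon>\<^sup>2\<bar> \<le> C * \<epsilon> ^ 3)))"
    by (rule exI[of _ "1 / 18"], rule exI[of _ 2916], rule exI[of _ 300000000],
        rule exI[of _ "1 / 12000"], intro conjI *) simp_all
qed

end
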